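(* (Categorification of the skein relations of the Kauffman bracket.) 1. Let $D$ be a link diagram, fix one of its crossings, and let $D_A$ and $D_B$ be the diagrams obtained from $D$ by replacing that crossing with its $A$-splitting and its $B$-splitting respectively. Then for each $j\in\mathbb Z$ there are homomorphisms making the following cyclic sequence of six abelian groups exact at every term: $$\mathcal H^F_{0,j+1}(D_B)\to\mathcal H^F_{0,j}(D)\to\mathcal H^F_{0,j-1}(D_A)\to\mathcal H^F_{1,j+1}(D_B)\to\mathcal H^F_{1,j}(D)\to\mathcal H^F_{1,j-1}(D_A)\to\mathcal H^F_{0,j+1}(D_B).$$ 2. Let $D$ be a link diagram and let $D\sqcup O$ be its disjoint union with a crossingless circle $O$. Then $\mathcal H^F_*(D\sqcup O)\cong\mathcal H^F_*(D)\otimes W^\spadesuit$, i.e. $\mathcal H^F_0(D\sqcup O)\cong\mathcal H^F_1(D)\otimes W$ and $\mathcal H^F_1(D\sqcup O)\cong\mathcal H^F_0(D)\otimes W$ as graded abelian groups. 3. For the crossingless diagram $O$ of the unknot, $\mathcal H^F_*(O)\cong W^\spadesuit$, i.e. $\mathcal H^F_0(O)=0$ and $\mathcal H^F_1(O)\cong W$.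
   Context: A diagram is an unoriented planar link diagram. Graded abelian groups are $\mathbb Z$-graded, morphisms have degree $0$, and $G\{l\}$ is the shift $(G\{l\})_j=G_{j-l}$. For $i\in\{0,1\}$ write $\underline i=1-i$. A $2$-complex of graded abelian groups is $(A_0,A_1,\partial_0,\partial_1)$ with $\partial_0:A_0\to A_1$, $\partial_1:A_1\to A_0$ degree-$0$ homomorphisms with $\partial_1\partial_0=0$ and $\partial_0\partial_1=0$. Its homology is $H_*(A)=(H_0(A),H_1(A))$ with $H_i(A)=\ker\partial_i/\operatorname{im}\partial_{\underline i}$. A graded abelian group $G$ is identified with the pair $(G,0)$ (with zero differentials), and $(G_0,G_1)^\spadesuit=(G_1,G_0)$, so $G^\spadesuit=(0,G)$. The tensor product of pairs is $(A_0,A_1)\otimes(B_0,B_1)=((A_0\otimes B_0)\oplus(A_1\otimes B_1),(A_0\otimes B_1)\oplus(A_1\otimes B_0))$. Let $W$ be the free graded abelian group with basis $w_+$ in degree $2$ and $w_-$ in degree $-2$. Define degree-$2$ maps $\bar m:W\otimes W\to W$, $w_-\otimes w_-\mapsto w_-$, $w_+\otimes w_-\mapsto w_+$, $w_-\otimes w_+\mapsto w_+$, $w_+\otimes w_+\mapsto 0$; and $\bar\Delta:W\to W\otimes W$, $w_-\mapsto w_+\otimes w_-+w_-\otimes w_+$, $w_+\mapsto w_+\otimes w_+$. A Kauffman state $s$ of $D$ marks each crossing with $A$ (or $0$) or $B$ (or $1$). Splitting each crossing according to its mark (the $A$-splitting joins the two regions swept by the overcrossing strand when rotated counterclockwise towards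 the undercrossing strand, the $B$-splitting joins the other two) gives a collection $D_s$ of $|s|$ disjoint circles. $a(s)$, $b(s)$ are the numbers of crossings marked $A$, $B$; $s_A$ is the state with all marks $A$. Put $W_s(D)=\big(\bigotimes_{\text{circles of }D_s}W\big)\{a(s)-b(s)\}$, and for $i\in\{0,1\}$ $$\langle\!\langle D\rangle\!\rangle_i=\bigoplus_{s:\ b(s)+|s_A|\in 2\mathbb Z+i}W_s(D).$$ An edge $\xi:s_0\to s_1$ is a pair of states differing at exactly one crossing, marked $A$ in $s_0$ and $B$ in $s_1$; $|\xi|=b(s_0)$. Passing from $D_{s_0}$ to $D_{s_1}$ either merges two circles into one or splits one circle into two; $\partial_\xi:W_{s_0}(D)\to W_{s_1}(D)$ (degree $0$ after the shifts) is $\bar m$, respectively $\bar\Delta$, on the factors of these circles and the identity on all other factors. Given an order of the crossings, $(-1)^\xi$ is $-1$ to the number of crossings marked $B$ in $s_0$ that precede the changing crossing. Set $\partial_i=\sum_{\xi:\ |\xi|+|s_A|\in 2\mathbb Z+i}(-1)^\xi\partial_\xi:\langle\!\langle D\rangle\!\rangle_i\to\langle\!\langle D\rangle\!\rangle_{\underline i}$ and $\langle\!\langle D\rangle\!\rangle=(\langle\!\langle D\rangle\!\rangle_0,\langle\!\langle D\rangle\!\rangle_1,\partial_0,\partial_1)$, a $2$-complex of graded abelian groups. $\mathcal H^F_*(D)=(\mathcal H^F_0(D),\mathcal H^F_1(D))$ denotes $H_*(\langle\!\langle D\rangle\!\rangle)$ (for any order of the crossings; up to isomorphism it does not depend on the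 order), and $\mathcal H^F_{i,j}(D)$ is the homogeneous component of degree $j$ of $\mathcal H^F_i(D)$. *)

theory Defs
  imports
    "HOL-Library.Disjoint_Sets"
    "HOL-Algebra.Product_Groups"
    "HOL-Algebra.Free_Abelian_Groups"
    "HOL-Algebra.Exact_Sequence"
begin

section \<open>Planar link diagrams\<close>

text \<open>
  A diagram is a plane graph, given combinatorially (as in a planar diagram code) by its darts
  (half-edges), its edges (unordered pairs of darts) and its vertices. A vertex is the list of its
  darts in counterclockwise order. A vertex of valency 4 is a crossing \<open>[a, b, c, d]\<close>, whose
  undercrossing strand is \<open>{a, c}\<close> and whose overcrossing strand is \<open>{b, d}\<close>. A vertex of valency 2
  is only a marked point on a strand; such points are needed because a component without
  crossings would otherwise have no darts at all.
\<close>

record 'h diagram =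
  edges :: "'h set set"
  verts :: "'h list set"

definition darts :: "'h diagram \<Rightarrow> 'h set"
  where "darts D = \<Union>(edges D)"

definition crossings :: "'h diagram \<Rightarrow> 'h list set"
  where "crossings D = {v \<in> verts D. length v = 4}"

definition adjacent :: "'h diagram \<Rightarrow> 'h rel"
  where "adjacent D = {(h, k). \<exists>x \<in> edges D \<union> set ` verts D. h \<in> x \<and> k \<in> x}"

definition component :: "'h diagram \<Rightarrow> 'h \<Rightarrow> 'h set"
  where "component D h = (adjacent D)\<^sup>* `` {h}"

definition components :: "'h diagram \<Rightarrow> 'h set set"
  where "components D = component D ` darts D"

definition next_at_vertex :: "'h diagram \<Rightarrow> 'h rel"
  where "next_at_vertex D =
    {(v ! k, v ! (Suc k mod length v)) | v k. v \<in> verts D \<and> k < length v}"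

text \<open>
  Faces are the boundary walks: follow an edge to its other end, then turn to the next dart at
  that vertex. Each step is a permutation of the finite set of darts, so the reflexive transitive
  closure is an equivalence relation.
\<close>

definition face_step :: "'h diagram \<Rightarrow> 'h rel"
  where "face_step D = {(h, k). \<exists>g. h \<noteq> g \<and> {h, g} \<in> edges D \<and> (g, k) \<in> next_at_vertex D}"

definition faces :: "'h diagram \<Rightarrow> 'h set set"
  where "faces D = (\<lambda>h. (face_step D)\<^sup>* `` {h}) ` darts D"

text \<open>
  Planarity is Euler's formula: every connected component \<open>K\<close> satisfies \<open>V - E + F \<le> 2\<close>, with
  equality iff its rotation system has genus 0, so the sum over all components characterises
  genus 0 of each of them. The faces are counted for each component separately; how components
  that do not meet are placed relative to each other in the plane is not recorded.
\<close>

definition planar :: "'h diagram \<Rightarrow> bool"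
  where "planar D \<longleftrightarrow>
    card (verts D) + card (faces D) = card (edges D) + 2 * card (components D)"

definition link_diagram :: "'h diagram \<Rightarrow> bool"
  where "link_diagram D \<longleftrightarrow>
    finite (edges D) \<and> (\<forall>e \<in> edges D. card e = 2) \<and> disjoint (edges D) \<and>
    (\<forall>v \<in> verts D. distinct v \<and> length v \<in> {2, 4}) \<and>
    pairwise (\<lambda>v w. set v \<inter> set w = {}) (verts D) \<and>
    \<Union>(set ` verts D) = darts D \<and>
    planar D"

text \<open>
  For disjoint sets of darts this is the disjoint union of diagrams.
\<close>

definition diagram_union :: "'h diagram \<Rightarrow> 'h diagram \<Rightarrow> 'h diagram"
  where "diagram_union D E = \<lparr>edges = edges D \<union> edges E, verts = verts D \<union> verts E\<rparr>"

definition crossingless_unknot :: "'h diagram \<Rightarrow> bool"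
  where "crossingless_unknot D \<longleftrightarrow>
    link_diagram D \<and> crossings D = {} \<and> card (components D) = 1"


section \<open>Splittings and Kauffman states\<close>

datatype mark = MarkA | MarkB

text \<open>
  At \<open>[a, b, c, d]\<close> the overcrossing strand \<open>{b, d}\<close>, rotated counterclockwise towards the
  undercrossing strand, sweeps the region between \<open>b\<close> and \<open>c\<close> and the region between \<open>d\<close> and \<open>a\<close>.
  Joining these two regions leaves the arcs \<open>a b\<close> and \<open>c d\<close>.
\<close>

fun splitting :: "mark \<Rightarrow> 'h list \<Rightarrow> 'h list set"
  where
    "splitting MarkA v = {[v ! 0, v ! 1], [v ! 2, v ! 3]}"
  | "splitting MarkB v = {[v ! 1, v ! 2], [v ! 3, v ! 0]}"

definition split_at :: "'h diagram \<Rightarrow> 'h list \<Rightarrow> mark \<Rightarrow> 'h diagram"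
  where "split_at D c m = D\<lparr>verts := (verts D - {c}) \<union> splitting m c\<rparr>"

type_synonym 'h state = "'h list \<Rightarrow> mark"

definition states :: "'h diagram \<Rightarrow> 'h state set"
  where "states D = crossings D \<rightarrow>\<^sub>E UNIV"

definition resolution :: "'h diagram \<Rightarrow> 'h state \<Rightarrow> 'h diagram"
  where "resolution D s =
    D\<lparr>verts := (verts D - crossings D) \<union> (\<Union>c \<in> crossings D. splitting (s c) c)\<rparr>"

abbreviation circles :: "'h diagram \<Rightarrow> 'h state \<Rightarrow> 'h set set"
  where "circles D s \<equiv> components (resolution D s)"

definition num_A :: "'h diagram \<Rightarrow> 'h state \<Rightarrow> nat"
  where "num_A D s = card {c \<in> crossings D. s c = MarkA}"

definition num_B :: "'h diagram \<Rightarrow> 'h state \<Rightarrow> nat"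
  where "num_B D s = card {c \<in> crossings D. s c = MarkB}"

definition all_A :: "'h diagram \<Rightarrow> 'h state"
  where "all_A D = (\<lambda>c \<in> crossings D. MarkA)"

definition crossing_order :: "'h diagram \<Rightarrow> 'h list list \<Rightarrow> bool"
  where "crossing_order D cs \<longleftrightarrow> distinct cs \<and> set cs = crossings D"


section \<open>Graded abelian groups, pairs and 2-complexes\<close>

text \<open>
  A graded abelian group is given by the family of its homogeneous components, so a
  homomorphism of degree 0 is a family of homomorphisms.
\<close>

type_synonym 'a graded = "int \<Rightarrow> 'a monoid"

definition graded_iso :: "'a graded \<Rightarrow> 'b graded \<Rightarrow> bool"  (infix \<open>\<cong>\<^sub>g\<close> 50)
  where "G \<cong>\<^sub>g H \<longleftrightarrow> (\<forall>j. G j \<cong> H j)"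

definition pair_iso :: "'a graded \<times> 'b graded \<Rightarrow> 'c graded \<times> 'd graded \<Rightarrow> bool"  (infix \<open>\<cong>\<^sub>p\<close> 50)
  where "P \<cong>\<^sub>p Q \<longleftrightarrow> fst P \<cong>\<^sub>g fst Q \<and> snd P \<cong>\<^sub>g snd Q"

definition zero_graded :: "unit graded"
  where "zero_graded = (\<lambda>_. singleton_group ())"

definition as_pair :: "'a graded \<Rightarrow> 'a graded \<times> unit graded"
  where "as_pair G = (G, zero_graded)"

definition spade :: "'a graded \<times> 'b graded \<Rightarrow> 'b graded \<times> 'a graded"
  where "spade P = (snd P, fst P)"

definition tensor_relations :: "'a monoid \<Rightarrow> 'b monoid \<Rightarrow> ('a \<times> 'b \<Rightarrow>\<^sub>0 int) set"
  where "tensor_relations G H =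
    {frag_of (x \<otimes>\<^bsub>G\<^esub> x', y) - frag_of (x, y) - frag_of (x', y) | x x' y.
       x \<in> carrier G \<and> x' \<in> carrier G \<and> y \<in> carrier H} \<union>
    {frag_of (x, y \<otimes>\<^bsub>H\<^esub> y') - frag_of (x, y) - frag_of (x, y') | x y y'.
       x \<in> carrier G \<and> y \<in> carrier H \<and> y' \<in> carrier H}"

text \<open>The tensor product over the integers of abelian groups, written multiplicatively.\<close>

definition tensor :: "'a monoid \<Rightarrow> 'b monoid \<Rightarrow> ('a \<times> 'b \<Rightarrow>\<^sub>0 int) set monoid"
  where "tensor G H =
    free_Abelian_group (carrier G \<times> carrier H) Mod
      generate (free_Abelian_group (carrier G \<times> carrier H)) (tensor_relations G H)"

definition graded_tensor ::
    "'a graded \<Rightarrow> 'b graded \<Rightarrow> (int \<Rightarrow> ('a \<times> 'b \<Rightarrow>\<^sub>0 int) set) graded"  (infixl \<open>\<otimes>\<^sub>g\<close> 70)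
  where "G \<otimes>\<^sub>g H = (\<lambda>j. sum_group UNIV (\<lambda>k. tensor (G k) (H (j - k))))"

definition graded_sum :: "'a graded \<Rightarrow> 'b graded \<Rightarrow> ('a \<times> 'b) graded"  (infixl \<open>\<oplus>\<^sub>g\<close> 65)
  where "G \<oplus>\<^sub>g H = (\<lambda>j. G j \<times>\<times> H j)"

definition pair_tensor  (infixl \<open>\<otimes>\<^sub>p\<close> 70)
  where "P \<otimes>\<^sub>p Q =
    ((fst P \<otimes>\<^sub>g fst Q) \<oplus>\<^sub>g (snd P \<otimes>\<^sub>g snd Q),
     (fst P \<otimes>\<^sub>g snd Q) \<oplus>\<^sub>g (snd P \<otimes>\<^sub>g fst Q))"

text \<open>
  A 2-complex is \<open>(A\<^sub>0, A\<^sub>1, \<partial>\<^sub>0, \<partial>\<^sub>1)\<close> with the differentials given in each degree. That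
  they are homomorphisms whose composites vanish is not part of the type.
\<close>

type_synonym 'a two_complex =
  "'a graded \<times> 'a graded \<times> (int \<Rightarrow> 'a \<Rightarrow> 'a) \<times> (int \<Rightarrow> 'a \<Rightarrow> 'a)"

definition ker_mod_im :: "'a monoid \<Rightarrow> 'b monoid \<Rightarrow> ('a \<Rightarrow> 'b) \<Rightarrow> 'c monoid \<Rightarrow> ('c \<Rightarrow> 'a) \<Rightarrow> 'a set monoid"
  where "ker_mod_im G H f K g = G\<lparr>carrier := kernel G H f\<rparr> Mod (g ` carrier K)"

fun homology :: "'a two_complex \<Rightarrow> 'a set graded \<times> 'a set graded"
  where "homology (A0, A1, d0, d1) =
    (\<lambda>j. ker_mod_im (A0 j) (A1 j) (d0 j) (A1 j) (d1 j),
     \<lambda>j. ker_mod_im (A1 j) (A0 j) (d1 j) (A0 j) (d0 j))"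


text \<open>
  The cyclic sequence \<open>G1 \<rightarrow> G2 \<rightarrow> G3 \<rightarrow> G4 \<rightarrow> G5 \<rightarrow> G6 \<rightarrow> G1\<close>. The lists of \<open>exact_seq\<close> run from
  target to source, and it requires exactness at every group but the two outermost ones;
  repeating \<open>G1\<close> and the map \<open>f1\<close> gives exactness at all six.
\<close>

definition exact_hexagon ::
    "'a monoid \<Rightarrow> 'a monoid \<Rightarrow> 'a monoid \<Rightarrow> 'a monoid \<Rightarrow> 'a monoid \<Rightarrow> 'a monoid \<Rightarrow> bool"
  where "exact_hexagon G1 G2 G3 G4 G5 G6 \<longleftrightarrow>
    (\<exists>f1 f2 f3 f4 f5 f6.
       exact_seq ([G2, G1, G6, G5, G4, G3, G2, G1], [f1, f6, f5, f4, f3, f2, f1]))"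


section \<open>The 2-complex of a diagram\<close>

datatype sign = Wplus | Wminus

fun wdeg :: "sign \<Rightarrow> int"
  where "wdeg Wplus = 2" | "wdeg Wminus = -2"

definition W :: "(sign \<Rightarrow>\<^sub>0 int) graded"
  where "W = (\<lambda>j. free_Abelian_group {w. wdeg w = j})"

text \<open>The maps \<open>W \<otimes> W \<rightarrow> W\<close> and \<open>W \<rightarrow> W \<otimes> W\<close> on basis elements.\<close>

fun mbar :: "sign \<Rightarrow> sign \<Rightarrow> sign \<Rightarrow>\<^sub>0 int"
  where
    "mbar Wminus Wminus = frag_of Wminus"
  | "mbar Wplus Wminus = frag_of Wplus"
  | "mbar Wminus Wplus = frag_of Wplus"
  | "mbar Wplus Wplus = 0"

fun Deltabar :: "sign \<Rightarrow> sign \<times> sign \<Rightarrow>\<^sub>0 int"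
  where
    "Deltabar Wminus = frag_of (Wplus, Wminus) + frag_of (Wminus, Wplus)"
  | "Deltabar Wplus = frag_of (Wplus, Wplus)"

text \<open>
  The tensor product of copies of \<open>W\<close> indexed by the circles of a state \<open>s\<close> is free on the
  labellings of these circles by \<open>w\<^sub>+\<close> and \<open>w\<^sub>-\<close>; hence the direct sum of the groups \<open>W\<^sub>s(D)\<close> over
  a set of states is free on the pairs of a state and a labelling of its circles.
\<close>

type_synonym 'h generator = "'h state \<times> ('h set \<Rightarrow> sign)"

definition generators :: "'h diagram \<Rightarrow> 'h generator set"
  where "generators D = (SIGMA s : states D. circles D s \<rightarrow>\<^sub>E UNIV)"

fun gdeg :: "'h diagram \<Rightarrow> 'h generator \<Rightarrow> int"
  where "gdeg D (s, \<epsilon>) =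
    (\<Sum>C \<in> circles D s. wdeg (\<epsilon> C)) + (int (num_A D s) - int (num_B D s))"

definition bracket_group :: "'h diagram \<Rightarrow> nat \<Rightarrow> ('h generator \<Rightarrow>\<^sub>0 int) graded"
  where "bracket_group D i = (\<lambda>j. free_Abelian_group
    {(s, \<epsilon>) \<in> generators D.
       (num_B D s + card (circles D (all_A D))) mod 2 = i \<and> gdeg D (s, \<epsilon>) = j})"

text \<open>
  The edge from \<open>s\<close> to \<open>s(c := MarkB)\<close>. The circles through \<open>c = [a, b, c', d]\<close> are, in both
  resolutions, those of \<open>a\<close> and of \<open>c'\<close>. If they are different before, they are merged;
  otherwise planarity of \<open>D\<close> ensures that they are different afterwards. Circles that do not pass
  through \<open>c\<close> are the same sets of darts in both resolutions.
\<close>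

fun edge_map :: "'h diagram \<Rightarrow> 'h list \<Rightarrow> 'h generator \<Rightarrow> 'h generator \<Rightarrow>\<^sub>0 int"
  where "edge_map D c (s, \<epsilon>) =
    (let t = s(c := MarkB);
         P = component (resolution D s) (c ! 0); Q = component (resolution D s) (c ! 2);
         P' = component (resolution D t) (c ! 0); Q' = component (resolution D t) (c ! 2)
     in if P \<noteq> Q
        then frag_extend
          (\<lambda>w. frag_of (t, restrict (\<epsilon>(P' := w)) (circles D t)))
          (mbar (\<epsilon> P) (\<epsilon> Q))
        else frag_extend
          (\<lambda>(w, w'). frag_of (t, restrict (\<epsilon>(P' := w, Q' := w')) (circles D t)))
          (Deltabar (\<epsilon> P)))"

definition edge_sign :: "'h list list \<Rightarrow> 'h list \<Rightarrow> 'h state \<Rightarrow> int"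
  where "edge_sign cs c s =
    (-1) ^ length (filter (\<lambda>c'. s c' = MarkB) (takeWhile (\<lambda>c'. c' \<noteq> c) cs))"

fun generator_boundary ::
    "'h diagram \<Rightarrow> 'h list list \<Rightarrow> 'h generator \<Rightarrow> 'h generator \<Rightarrow>\<^sub>0 int"
  where "generator_boundary D cs (s, \<epsilon>) =
    (\<Sum>c \<in> {c \<in> crossings D. s c = MarkA}. frag_cmul (edge_sign cs c s) (edge_map D c (s, \<epsilon>)))"

text \<open>
  An edge out of \<open>s\<close> has \<open>|\<xi>| = b(s)\<close>, so the maps \<open>\<partial>\<^sub>0\<close> and \<open>\<partial>\<^sub>1\<close> are the restrictions of one
  homomorphism to the two groups of chains.
\<close>

definition bracket_boundary ::
    "'h diagram \<Rightarrow> 'h list list \<Rightarrow> ('h generator \<Rightarrow>\<^sub>0 int) \<Rightarrow> ('h generator \<Rightarrow>\<^sub>0 int)"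
  where "bracket_boundary D cs = frag_extend (generator_boundary D cs)"

definition bracket :: "'h diagram \<Rightarrow> 'h list list \<Rightarrow> ('h generator \<Rightarrow>\<^sub>0 int) two_complex"
  where "bracket D cs =
    (bracket_group D 0, bracket_group D 1,
     \<lambda>j. bracket_boundary D cs, \<lambda>j. bracket_boundary D cs)"

definition HF ::
    "'h diagram \<Rightarrow> 'h list list \<Rightarrow>
     ('h generator \<Rightarrow>\<^sub>0 int) set graded \<times> ('h generator \<Rightarrow>\<^sub>0 int) set graded"
  where "HF D cs = homology (bracket D cs)"

abbreviation HF0 :: "'h diagram \<Rightarrow> 'h list list \<Rightarrow> ('h generator \<Rightarrow>\<^sub>0 int) set graded"
  where "HF0 D cs \<equiv> fst (HF D cs)"

abbreviation HF1 :: "'h diagram \<Rightarrow> 'h list list \<Rightarrow> ('h generator \<Rightarrow>\<^sub>0 int) set graded"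
  where "HF1 D cs \<equiv> snd (HF D cs)"

end

theory Submission
  imports Defs "HOL-Combinatorics.Permutations"
begin

text \<open>
  The darts of a diagram of genus 0 have a two-colouring in which the two ends of an edge, and
  neighbouring darts at a vertex, get different colours. It orients the circles of all states at once,
  so switching a crossing composes the permutation that walks along the circles with a transposition
  and hence merges two circles or splits one. Since \<open>W\<close> is \<open>\<int>[x]/(x\<^sup>2)\<close> with \<open>w\<^sub>+ = x\<close> and
  \<open>w\<^sub>- = 1\<close>, edge maps are multiplications by 1 or by a sum of two variables, so the squares
  of the cube of states commute and the differential squares to 0.

  The states that mark the chosen crossing with \<open>B\<close> span a subcomplex, which is the complex of
  \<open>D\<^sub>B\<close>; the quotient is the complex of \<open>D\<^sub>A\<close>, and the hexagon is the long exact sequence of this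
  short exact sequence. The complex of \<open>D \<squnion> O\<close> is two shifted copies of that of \<open>D\<close>, one for
  each label of \<open>O\<close>, and the additional circle exchanges the two parities.
\<close>

section \<open>Permutations and their orbits\<close>

text \<open>Planarity enters only as a count of vertices, edges and faces; no curves in a plane
  stand behind it. What it has to exclude is a crossing whose switch turns one circle into one
  circle, as can happen in higher genus. Such a switch would be neither a merge nor a split.

  The diagrams \<open>split_at D c m\<close> and \<open>diagram_union D U\<close> are never shown to
  be link diagrams themselves. Their resolutions are resolutions of \<open>D\<close>, up to the
  extra circle, so the behaviour of their differentials is carried over from \<open>D\<close> by
  explicit relabellings of states. The crossing orders given for the diagrams are unrelated, hence
  these relabellings carry signs.

  The parity of a chain involves the number of circles of the all-A state. In passing to the
  B-splitting a mark B is lost, and the change of this number makes up for it, so that both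
  splittings keep the parity of \<open>D\<close>.\<close>

definition eqc :: "'a rel \<Rightarrow> 'a rel"
  where "eqc r = (r \<union> r\<inverse>)\<^sup>*"

definition num_classes :: "'a rel \<Rightarrow> 'a set \<Rightarrow> nat"
  where "num_classes r S = card ((\<lambda>x. eqc r `` {x}) ` S)"

definition graph_on :: "('a \<Rightarrow> 'a) \<Rightarrow> 'a set \<Rightarrow> 'a rel"
  where "graph_on f S = (\<lambda>x. (x, f x)) ` S"

lemma eqc_refl [simp]: "(x, x) \<in> eqc r"
  by (simp add: eqc_def)

lemma eqc_sym: "(x, y) \<in> eqc r \<Longrightarrow> (y, x) \<in> eqc r"
proof -
  have "sym (eqc r)"
    unfolding eqc_def by (rule sym_rtrancl) (auto simp: sym_def)
  then show "(x, y) \<in> eqc r \<Longrightarrow> (y, x) \<in> eqc r" by (rule symD)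
qed

lemma eqc_trans: "(x, y) \<in> eqc r \<Longrightarrow> (y, z) \<in> eqc r \<Longrightarrow> (x, z) \<in> eqc r"
  unfolding eqc_def by (rule rtrancl_trans)

lemma eqc_incl: "p \<in> r \<Longrightarrow> p \<in> eqc r"
  unfolding eqc_def by auto

lemma eqc_class_eq: "eqc r `` {x} = eqc r `` {y} \<longleftrightarrow> (x, y) \<in> eqc r"
  using eqc_sym eqc_trans eqc_refl by fast

lemma eqc_least:
  assumes "r \<subseteq> E" "\<And>x. (x, x) \<in> E" "\<And>x y. (x, y) \<in> E \<Longrightarrow> (y, x) \<in> E"
    "\<And>x y z. (x, y) \<in> E \<Longrightarrow> (y, z) \<in> E \<Longrightarrow> (x, z) \<in> E"
  shows "eqc r \<subseteq> E"
proof (rule subrelI)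
  fix x y assume "(x, y) \<in> eqc r"
  then show "(x, y) \<in> E"
    unfolding eqc_def
  proof (induction rule: rtrancl_induct)
    case base
    show ?case by (rule assms(2))
  next
    case (step y z)
    then have "(y, z) \<in> E" using assms(1,3) by auto
    with step.IH show ?case by (rule assms(4))
  qed
qed

lemma eqc_subset: "r \<subseteq> eqc r' \<Longrightarrow> eqc r \<subseteq> eqc r'"
  by (rule eqc_least) (auto intro: eqc_sym eqc_trans)

lemma eqc_mono: "r \<subseteq> r' \<Longrightarrow> eqc r \<subseteq> eqc r'"
  by (rule eqc_subset) (auto intro: eqc_incl)

lemma eqc_eqI: "r \<subseteq> eqc r' \<Longrightarrow> r' \<subseteq> eqc r \<Longrightarrow> eqc r = eqc r'"
  by (simp add: eqc_subset subset_antisym)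

lemma eqc_rtrancl: "sym r \<Longrightarrow> eqc r = r\<^sup>*"
  unfolding eqc_def by (simp add: sym_conv_converse_eq)

lemma eqc_insert_cong: "eqc r = eqc r' \<Longrightarrow> eqc (insert p r) = eqc (insert p r')"
  by (rule eqc_eqI) (use eqc_mono[of r "insert p r"] eqc_mono[of r' "insert p r'"] in
      \<open>auto intro: eqc_incl\<close>)

lemma eqc_insert_absorb: "p \<in> eqc r \<Longrightarrow> eqc (insert p r) = eqc r"
  by (rule eqc_eqI) (auto intro: eqc_incl)

text \<open>A path needs the new pair at most once, in one direction or the other, so the right-hand
  side is already an equivalence relation.\<close>

lemma eqc_insert_iff:
  "(x, y) \<in> eqc (insert (a, b) r) \<longleftrightarrow>
    (x, y) \<in> eqc r \<or> (x, a) \<in> eqc r \<and> (b, y) \<in> eqc r \<or> (x, b) \<in> eqc r \<and> (a, y) \<in> eqc r"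
    (is "_ \<longleftrightarrow> ?E x y")
proof
  define f where "f = (\<lambda>x. eqc r `` {x})"
  have f: "(x, y) \<in> eqc r \<longleftrightarrow> f x = f y" for x y
    by (simp add: f_def eqc_class_eq)
  have "eqc (insert (a, b) r) \<subseteq> {(x, y). ?E x y}"
  proof (rule eqc_least)
    show "insert (a, b) r \<subseteq> {(x, y). ?E x y}" by (auto intro: eqc_incl)
  qed (auto simp: f)
  then show "(x, y) \<in> eqc (insert (a, b) r) \<Longrightarrow> ?E x y" by auto
next
  have "eqc r \<subseteq> eqc (insert (a, b) r)" "(a, b) \<in> eqc (insert (a, b) r)"
    by (auto intro: eqc_incl intro!: eqc_mono)
  then show "?E x y \<Longrightarrow> (x, y) \<in> eqc (insert (a, b) r)"
    by (meson eqc_sym eqc_trans subsetD)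
qed

lemma num_classes_cong: "eqc r = eqc r' \<Longrightarrow> num_classes r S = num_classes r' S"
  by (simp add: num_classes_def)

lemma card_image_same_fibres:
  assumes "\<And>x y. x \<in> T \<Longrightarrow> y \<in> T \<Longrightarrow> f x = f y \<longleftrightarrow> g x = g y"
  shows "card (f ` T) = card (g ` T)"
proof -
  have g: "g (inv_into T f (f x)) = g x" if "x \<in> T" for x
    using assms[of "inv_into T f (f x)" x] that
    by (simp add: f_inv_into_f inv_into_into)
  have "inj_on (\<lambda>X. g (inv_into T f X)) (f ` T)"
    by (rule inj_onI) (use assms g in auto)
  moreover have "(\<lambda>X. g (inv_into T f X)) ` f ` T = g ` T"
    using g by (simp add: image_image)
  ultimately show ?thesis
    using card_image by metis
qed

text \<open>Leaving out the class of \<open>b\<close> loses one value of \<open>f\<close> and none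
  of \<open>f'\<close>, because \<open>a\<close> still represents the united class; on what remains,
  the fibres of \<open>f\<close> and \<open>f'\<close> agree. Faces, components and circles are all
  counted this way.\<close>

lemma card_image_join:
  assumes "finite S" "a \<in> S" "b \<in> S" "f a \<noteq> f b"
    and f': "\<And>x y. f' x = f' y \<longleftrightarrow> f x = f y \<or> f x = f a \<and> f b = f y \<or> f x = f b \<and> f a = f y"
  shows "card (f ` S) = Suc (card (f' ` S))"
proof -
  let ?T = "{x \<in> S. f x \<noteq> f b}"
  have "f' ` S = f' ` ?T"
  proof (intro subset_antisym subsetI)
    fix X assume "X \<in> f' ` S"
    then obtain x where x: "x \<in> S" "X = f' x" by auto
    show "X \<in> f' ` ?T"
    proof (cases "f x = f b")
      case True
      then have "X = f' a" using x f' by simp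
      then show ?thesis using assms(2,4) by auto
    qed (use x in auto)
  qed auto
  moreover have "card (f' ` ?T) = card (f ` ?T)"
    by (rule card_image_same_fibres) (auto simp: f')
  moreover have "card (f ` S) = Suc (card (f ` ?T))"
  proof -
    have eq: "f ` S = insert (f b) (f ` ?T)" using assms by auto
    show ?thesis
      unfolding eq by (rule card_insert_disjoint) (use assms in auto)
  qed
  ultimately show ?thesis by (simp only:)
qed

lemma num_classes_insert:
  assumes "finite S" "a \<in> S" "b \<in> S"
  shows "num_classes r S = num_classes (insert (a, b) r) S + (if (a, b) \<in> eqc r then 0 else 1)"
proof (cases "(a, b) \<in> eqc r")
  case True
  then show ?thesis by (simp add: num_classes_def eqc_insert_absorb)
next
  case False
  define f where "f = (\<lambda>x. eqc r `` {x})"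
  define f' where "f' = (\<lambda>x. eqc (insert (a, b) r) `` {x})"
  have f: "(x, y) \<in> eqc r \<longleftrightarrow> f x = f y" for x y
    by (simp add: f_def eqc_class_eq)
  have "f' x = f' y \<longleftrightarrow> f x = f y \<or> f x = f a \<and> f b = f y \<or> f x = f b \<and> f a = f y" for x y
    unfolding f'_def eqc_class_eq eqc_insert_iff f ..
  moreover have "f a \<noteq> f b" using False f by simp
  ultimately have "card (f ` S) = Suc (card (f' ` S))"
    by (intro card_image_join[OF assms])
  then show ?thesis
    using False by (simp add: num_classes_def f_def f'_def)
qed

text \<open>On a finite set the inverse of a permutation acts on each point as one of its powers, so
  steps against the arrows can be replaced by steps along them.\<close>

lemma eqc_graph_on_iff:
  assumes f: "f permutes S" "finite S" and x: "x \<in> S"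
  shows "(x, y) \<in> eqc (graph_on f S) \<longleftrightarrow> (\<exists>n. y = (f ^^ n) x)"
proof
  have ex: "\<exists>n. x = (f ^^ n) (f x)" if "x \<in> S" for x
  proof -
    have "\<And>n. (f ^^ n) x \<in> S"
      using permutes_in_image[OF f(1)] that by (induct_tac n) auto
    then have "finite {y. \<exists>n. y = (f ^^ n) x}"
      by (intro finite_subset[OF _ f(2)]) auto
    then obtain n where "n > 0" "(f ^^ n) x = x"
      using funpow_inj_finite[OF permutes_inj[OF f(1)]] by metis
    then have "x = (f ^^ (n - 1)) (f x)" by (cases n) (auto simp: funpow_swap1)
    then show ?thesis ..
  qed
  have "y \<in> S \<and> (\<exists>n. y = (f ^^ n) x)" if "(x, y) \<in> eqc (graph_on f S)"
    using that unfolding eqc_def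
  proof (induction rule: rtrancl_induct)
    case base
    then show ?case using x by (auto intro: exI[of _ 0])
  next
    case (step y z)
    then obtain n where n: "y = (f ^^ n) x" by auto
    from step.hyps(2) consider "z = f y" | "y = f z" "z \<in> S" by (auto simp: graph_on_def)
    then show ?case
    proof cases
      case 1
      then show ?thesis using n step.IH permutes_in_image[OF f(1)] by (auto intro: exI[of _ "Suc n"])
    next
      case 2
      then obtain m where "z = (f ^^ m) y" using ex by auto
      then have "z = (f ^^ (m + n)) x" by (simp add: n funpow_add)
      then show ?thesis using 2 by auto
    qed
  qed
  then show "(x, y) \<in> eqc (graph_on f S) \<Longrightarrow> \<exists>n. y = (f ^^ n) x" by auto
next
  assume "\<exists>n. y = (f ^^ n) x"
  then obtain n where n: "y = (f ^^ n) x" ..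
  have "(f ^^ n) x \<in> S \<and> (x, (f ^^ n) x) \<in> eqc (graph_on f S)"
  proof (induction n)
    case (Suc n)
    then have "((f ^^ n) x, (f ^^ Suc n) x) \<in> eqc (graph_on f S)"
      by (intro eqc_incl) (auto simp: graph_on_def)
    then show ?case using Suc permutes_in_image[OF f(1)] by (auto intro: eqc_trans)
  qed (use x in simp)
  then show "(x, y) \<in> eqc (graph_on f S)" using n by simp
qed

text \<open>This is \<open>f\<close> composed with the transposition of \<open>a\<close> and
  \<open>b\<close>. Written as an update it matches the way a walk changes when a single edge or
  crossing changes.\<close>

definition swap_images :: "('a \<Rightarrow> 'b) \<Rightarrow> 'a \<Rightarrow> 'a \<Rightarrow> 'a \<Rightarrow> 'b"
  where "swap_images f a b = f(a := f b, b := f a)"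

lemma swap_images_permutes:
  assumes "f permutes S" "a \<in> S" "b \<in> S"
  shows "swap_images f a b permutes S"
proof -
  have "swap_images f a b = f \<circ> transpose a b"
    by (auto simp: swap_images_def transpose_def fun_eq_iff)
  then show ?thesis
    using permutes_compose[OF permutes_swap_id[OF assms(2,3)] assms(1)] by simp
qed

text \<open>Composing with a transposition cuts a cycle that contains both points and joins two
  cycles that contain one each. From \<open>a\<close> the new permutation continues as
  \<open>f\<close> does from \<open>b\<close>, until it meets \<open>a\<close> or \<open>b\<close>;
  which of the two comes first decides the case.\<close>

lemma eqc_swap_images_disj:
  assumes f: "f permutes S" "finite S" and ab: "a \<in> S" "b \<in> S" "a \<noteq> b"
  shows "(a, b) \<in> eqc (graph_on f S) \<longleftrightarrow> (a, b) \<notin> eqc (graph_on (swap_images f a b) S)"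
proof -
  define f' where "f' = swap_images f a b"
  have f': "f' permutes S" unfolding f'_def by (rule swap_images_permutes) fact+
  have f'_other: "f' x = f x" if "x \<noteq> a" "x \<noteq> b" for x
    using that by (simp add: f'_def swap_images_def)
  have f'a: "f' a = f b" using ab by (simp add: f'_def swap_images_def)
  have follow: "(f' ^^ k) a = (f ^^ k) b"
    if "\<And>j. 0 < j \<Longrightarrow> j < n \<Longrightarrow> (f ^^ j) b \<noteq> a \<and> (f ^^ j) b \<noteq> b" "0 < k" "k \<le> n" for k n
    using that(2,3)
  proof (induction k)
    case (Suc k)
    show ?case
    proof (cases "k = 0")
      case False
      then have "(f' ^^ k) a = (f ^^ k) b" "(f ^^ k) b \<noteq> a \<and> (f ^^ k) b \<noteq> b"
        using Suc that(1)[of k] by auto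
      then show ?thesis using f'_other by simp
    qed (simp add: f'a)
  qed simp
  have inS: "(f ^^ n) b \<in> S" for n
    using permutes_in_image[OF f(1)] ab by (induction n) auto
  show ?thesis
    unfolding f'_def[symmetric]
  proof
    assume "(a, b) \<in> eqc (graph_on f S)"
    then have "\<exists>n. (f ^^ n) b = a"
      using eqc_graph_on_iff[OF f ab(2)] eqc_sym by metis
    \<comment> \<open>The \<open>f\<close>-path from \<open>b\<close> reaches \<open>a\<close> at
      step \<open>n\<close>. The new cycle of \<open>a\<close> closes up there and consists of the
      points \<open>(f ^^ k) b\<close> with \<open>0 < k \<le> n\<close>, none of which is
      \<open>b\<close>.\<close>
    define n where "n = (LEAST n. (f ^^ n) b = a)"
    have n: "(f ^^ n) b = a" and least: "\<And>k. k < n \<Longrightarrow> (f ^^ k) b \<noteq> a"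
      unfolding n_def using LeastI_ex[OF \<open>\<exists>n. (f ^^ n) b = a\<close>] not_less_Least by auto
    have "n > 0" using n ab by (cases n) auto
    have notb: "(f ^^ j) b \<noteq> b" if "0 < j" "j \<le> n" for j
    proof
      assume "(f ^^ j) b = b"
      then have "(f ^^ (n - j)) b = (f ^^ (n - j)) ((f ^^ j) b)" by simp
      also have "\<dots> = (f ^^ n) b" using that by (simp flip: funpow_add comp_apply[of "f ^^ _" "f ^^ _"])
      finally show False using n least[of "n - j"] that by simp
    qed
    have orb: "\<exists>k. 0 < k \<and> k \<le> n \<and> (f' ^^ j) a = (f ^^ k) b" for j
    proof (induction j)
      case 0
      then show ?case using n \<open>n > 0\<close> by (intro exI[of _ n]) auto
    next
      case (Suc j)
      then obtain k where k: "0 < k" "k \<le> n" "(f' ^^ j) a = (f ^^ k) b" by auto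
      show ?case
      proof (cases "k = n")
        case True
        then show ?thesis using k n f'a \<open>n > 0\<close> by (intro exI[of _ 1]) auto
      next
        case False
        then have "(f' ^^ Suc j) a = (f ^^ Suc k) b"
          using k f'_other least[of k] notb[of k] by simp
        then show ?thesis using k False by (intro exI[of _ "Suc k"]) auto
      qed
    qed
    then show "(a, b) \<notin> eqc (graph_on f' S)"
      unfolding eqc_graph_on_iff[OF f' f(2) ab(1)] using notb by metis
  next
    assume nn: "(a, b) \<notin> eqc (graph_on f' S)"
    show "(a, b) \<in> eqc (graph_on f S)"
    proof (rule ccontr)
      assume no: "(a, b) \<notin> eqc (graph_on f S)"
      have nota: "(f ^^ j) b \<noteq> a" for j
        using no eqc_graph_on_iff[OF f ab(2)] eqc_sym by metis
      have "finite {y. \<exists>n. y = (f ^^ n) b}"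
        using inS by (intro finite_subset[OF _ f(2)]) auto
      then have "\<exists>m>0. (f ^^ m) b = b"
        using funpow_inj_finite[OF permutes_inj[OF f(1)]] by metis
      \<comment> \<open>With \<open>a\<close> off the cycle of \<open>b\<close>, the new permutation
        runs from \<open>a\<close> once around that cycle and arrives at \<open>b\<close> after one
        full period.\<close>
      define m where "m = (LEAST m. m > 0 \<and> (f ^^ m) b = b)"
      have m: "m > 0" "(f ^^ m) b = b" and least: "\<And>k. 0 < k \<Longrightarrow> k < m \<Longrightarrow> (f ^^ k) b \<noteq> b"
        unfolding m_def using LeastI_ex[OF \<open>\<exists>m>0. (f ^^ m) b = b\<close>] not_less_Least by auto
      then have "(f' ^^ m) a = b" using follow[of m m] nota by auto
      then show False using nn eqc_graph_on_iff[OF f' f(2) ab(1)] by metis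
    qed
  qed
qed

text \<open>Once \<open>a\<close> and \<open>b\<close> are identified it no longer matters which of
  the two values belongs to which of them.\<close>

lemma eqc_swap_images_insert:
  assumes "a \<in> S" "b \<in> S"
  shows "eqc (insert (a, b) (graph_on (swap_images f a b) S)) = eqc (insert (a, b) (graph_on f S))"
proof -
  have *: "graph_on (swap_images f a b) S \<subseteq> eqc (insert (a, b) (graph_on f S))" for f
  proof
    fix p assume "p \<in> graph_on (swap_images f a b) S"
    then obtain x where x: "x \<in> S" "p = (x, swap_images f a b x)" by (auto simp: graph_on_def)
    have g: "(y, f y) \<in> eqc (insert (a, b) (graph_on f S))" if "y \<in> S" for y
      using that by (auto intro!: eqc_incl simp: graph_on_def)
    have ab: "(a, b) \<in> eqc (insert (a, b) (graph_on f S))" by (auto intro: eqc_incl)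
    show "p \<in> eqc (insert (a, b) (graph_on f S))"
      using x g[of x] g[of a] g[of b] assms ab
      by (auto simp: swap_images_def intro: eqc_trans eqc_sym)
  qed
  have inv: "swap_images (swap_images f a b) a b = f"
    by (auto simp: swap_images_def)
  show ?thesis
    by (rule eqc_eqI) (use *[of f] *[of "swap_images f a b"] inv in \<open>auto intro: eqc_incl\<close>)
qed

section \<open>Checkerboard colourings of rotation systems of genus 0\<close>

definition matching :: "'a set set \<Rightarrow> bool"
  where "matching M \<longleftrightarrow> (\<forall>e \<in> M. card e = 2) \<and> disjoint M"

text \<open>Points outside the matching are fixed, so that this is an involution of all darts even
  for a partial set of edges.\<close>

definition partner :: "'a set set \<Rightarrow> 'a \<Rightarrow> 'a"
  where "partner M h = (if h \<in> \<Union>M then THE g. g \<noteq> h \<and> {h, g} \<in> M else h)"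

lemma matching_subset: "matching M \<Longrightarrow> N \<subseteq> M \<Longrightarrow> matching N"
  unfolding matching_def by (meson in_mono pairwise_subset)

lemma matching_disjointD: "matching M \<Longrightarrow> e \<in> M \<Longrightarrow> e' \<in> M \<Longrightarrow> x \<in> e \<Longrightarrow> x \<in> e' \<Longrightarrow> e = e'"
  unfolding matching_def by (meson disjnt_iff pairwiseD)

lemma matchingE:
  assumes "matching M" "e \<in> M" "h \<in> e"
  obtains g where "g \<noteq> h" "e = {h, g}"
proof -
  have "card e = 2" using assms by (simp add: matching_def)
  then obtain a b where "e = {a, b}" "a \<noteq> b" by (auto simp: card_2_iff)
  then show ?thesis using assms(3) that by (metis insert_commute insertE singletonD)
qed

lemma partner_eq:
  assumes "matching M" "{h, g} \<in> M" "h \<noteq> g"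
  shows "partner M h = g"
proof -
  have "g' = g" if "g' \<noteq> h" "{h, g'} \<in> M" for g'
    using matching_disjointD[OF assms(1,2) that(2), of h] that(1) by (auto simp: doubleton_eq_iff)
  then have "(THE g. g \<noteq> h \<and> {h, g} \<in> M) = g" using assms by blast
  then show ?thesis using assms by (auto simp: partner_def)
qed

lemma partner_in:
  assumes "matching M" "h \<in> \<Union>M"
  shows "partner M h \<noteq> h" "{h, partner M h} \<in> M"
proof -
  obtain e where e: "e \<in> M" "h \<in> e" using assms by auto
  obtain g where "g \<noteq> h" "e = {h, g}" using matchingE[OF assms(1) e] .
  then show "partner M h \<noteq> h" "{h, partner M h} \<in> M"
    using partner_eq[OF assms(1)] e by auto
qed

lemma partner_notin: "h \<notin> \<Union>M \<Longrightarrow> partner M h = h"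
  by (simp add: partner_def)

lemma partner_partner: "matching M \<Longrightarrow> partner M (partner M h) = h"
proof (cases "h \<in> \<Union>M")
  case True
  assume M: "matching M"
  show ?thesis using partner_eq[OF M, of "partner M h" h] partner_in[OF M True]
    by (simp add: insert_commute)
qed (simp add: partner_notin)

lemma partner_permutes: "matching M \<Longrightarrow> partner M permutes \<Union>M"
  unfolding permutes_def by (metis partner_notin partner_partner)

text \<open>\<open>P\<close> holds equally often before and after \<open>f\<close>, so the points
  where \<open>f\<close> turns \<open>P\<close> on are as many as those where it turns
  \<open>P\<close> off.\<close>

lemma permutes_image_count:
  fixes P :: "'a \<Rightarrow> bool"
  assumes "inj_on f K" "f ` K = K" "finite K"
  shows "even (card {x \<in> K. P (f x) \<noteq> P x})"
proof -
  let ?A = "{x \<in> K. P (f x) \<and> \<not> P x}" and ?B = "{x \<in> K. \<not> P (f x) \<and> P x}"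
    and ?C = "{x \<in> K. P (f x) \<and> P x}"
  have "f ` {x \<in> K. P (f x)} = {x \<in> K. P x}" using assms(2) by auto
  then have "card {x \<in> K. P x} = card {x \<in> K. P (f x)}"
    using card_image[of f "{x \<in> K. P (f x)}"] inj_on_subset[OF assms(1)] by auto
  moreover have "{x \<in> K. P x} = ?B \<union> ?C" "{x \<in> K. P (f x)} = ?A \<union> ?C"
    "{x \<in> K. P (f x) \<noteq> P x} = ?A \<union> ?B" by auto
  moreover have "card (?A \<union> ?C) = card ?A + card ?C" "card (?B \<union> ?C) = card ?B + card ?C"
    "card (?A \<union> ?B) = card ?A + card ?B"
    using assms(3) by (auto intro!: card_Un_disjoint)
  ultimately show ?thesis by simp
qed

section \<open>Euler's formula for a rotation system, edge by edge\<close>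

locale rotation_system =
  fixes H :: "'a set" and \<sigma> :: "'a \<Rightarrow> 'a" and E :: "'a set set"
  assumes fin: "finite E" "finite H" and E: "matching E" "\<Union>E = H" and \<sigma>: "\<sigma> permutes H"
begin

text \<open>A dart whose edge is absent from \<open>S\<close> is a loose end, at which the walk
  turns on to the next dart of the same vertex. Without edges the faces are therefore the orbits of
  \<open>\<sigma>\<close>.\<close>

definition face_perm :: "'a set set \<Rightarrow> 'a rel"
  where "face_perm S = graph_on (\<sigma> \<circ> partner S) H"

definition links :: "'a set set \<Rightarrow> 'a rel"
  where "links S = graph_on \<sigma> H \<union> {(h, g). h \<noteq> g \<and> {h, g} \<in> S}"

text \<open>
  Adding the edges one at a time, every edge either cuts a face in two, or joins two faces of
  different components, or raises the defect by 2. Euler's formula says that the final defect is 0,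
  so the third case never occurs.
\<close>

definition defect :: "'a set set \<Rightarrow> int"
  where "defect S = 2 * int (num_classes (links S) H) + int (card S)
    - int (num_classes (graph_on \<sigma> H) H) - int (num_classes (face_perm S) H)"

lemma partner_permutes_H: "S \<subseteq> E \<Longrightarrow> partner S permutes H"
  by (rule permutes_subset[OF partner_permutes[OF matching_subset[OF E(1)]]]) (use E(2) in auto)

lemma face_perm_permutes: "S \<subseteq> E \<Longrightarrow> \<sigma> \<circ> partner S permutes H"
  by (rule permutes_compose[OF partner_permutes_H \<sigma>])

text \<open>Before the insertion \<open>h\<close> and \<open>g\<close> are loose ends, fixed by
  \<open>partner S\<close>; afterwards they are exchanged.\<close>

lemma face_perm_insert:
  assumes S: "S \<subseteq> E" and e: "{h, g} \<in> E" "{h, g} \<notin> S" "h \<noteq> g"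
  shows "\<sigma> \<circ> partner (insert {h, g} S) = swap_images (\<sigma> \<circ> partner S) h g"
proof -
  have m: "matching S" "matching (insert {h, g} S)"
    using matching_subset[OF E(1)] S e by auto
  have "e' \<notin> S" if "x \<in> e'" "x \<in> {h, g}" for x e'
    using matching_disjointD[OF E(1) _ e(1) that] S e(2) by auto
  then have out: "h \<notin> \<Union>S" "g \<notin> \<Union>S"
    by auto
  have new: "partner (insert {h, g} S) h = g" "partner (insert {h, g} S) g = h"
    using partner_eq[OF m(2)] e by (auto simp: insert_commute)
  have "partner (insert {h, g} S) x = partner S x" if "x \<noteq> h" "x \<noteq> g" for x
  proof (cases "x \<in> \<Union>S")
    case True
    then show ?thesis
      using partner_in[OF m(1) True] partner_eq[OF m(2)] by auto
  next
    case False
    then show ?thesis using that by (simp add: partner_notin)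
  qed
  then show ?thesis using new out by (auto simp: swap_images_def partner_notin)
qed

lemma links_insert: "h \<noteq> g \<Longrightarrow> eqc (links (insert {h, g} S)) = eqc (insert (h, g) (links S))"
proof (rule eqc_eqI)
  assume "h \<noteq> g"
  have "eqc (links S) \<subseteq> eqc (insert (h, g) (links S))" by (rule eqc_mono) auto
  then show "links (insert {h, g} S) \<subseteq> eqc (insert (h, g) (links S))"
    by (auto simp: links_def doubleton_eq_iff intro: eqc_incl eqc_sym)
next
  assume "h \<noteq> g"
  then show "insert (h, g) (links S) \<subseteq> eqc (links (insert {h, g} S))"
    by (auto simp: links_def intro!: eqc_incl)
qed

lemma face_perm_subset_links:
  assumes "S \<subseteq> E"
  shows "eqc (face_perm S) \<subseteq> eqc (links S)"
proof (rule eqc_subset, rule subsetI)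
  fix p assume "p \<in> face_perm S"
  then obtain x where x: "x \<in> H" "p = (x, \<sigma> (partner S x))"
    by (auto simp: face_perm_def graph_on_def)
  have m: "matching S" using matching_subset[OF E(1) assms] .
  have "partner S x \<in> H"
    using x(1) permutes_in_image[OF partner_permutes_H[OF assms]] by simp
  then have 1: "(partner S x, \<sigma> (partner S x)) \<in> eqc (links S)"
    by (intro eqc_incl) (auto simp: links_def graph_on_def)
  have "(x, partner S x) \<in> eqc (links S)"
    using partner_in[OF m, of x] partner_notin[of x S]
    by (cases "x \<in> \<Union>S") (auto simp: links_def intro!: eqc_incl)
  then show "p \<in> eqc (links S)" using 1 x(2) eqc_trans by fast
qed

lemma face_perm_insert_classes:
  assumes S: "S \<subseteq> E" and e: "{h, g} \<in> E" "{h, g} \<notin> S" "h \<noteq> g"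
  shows "(h, g) \<in> eqc (face_perm S) \<longleftrightarrow> (h, g) \<notin> eqc (face_perm (insert {h, g} S))"
    and "eqc (insert (h, g) (face_perm (insert {h, g} S))) = eqc (insert (h, g) (face_perm S))"
proof -
  have hg: "h \<in> H" "g \<in> H" using e E(2) by auto
  show "(h, g) \<in> eqc (face_perm S) \<longleftrightarrow> (h, g) \<notin> eqc (face_perm (insert {h, g} S))"
    unfolding face_perm_def face_perm_insert[OF assms]
    by (rule eqc_swap_images_disj[OF face_perm_permutes[OF S] fin(2) hg e(3)])
  show "eqc (insert (h, g) (face_perm (insert {h, g} S))) = eqc (insert (h, g) (face_perm S))"
    unfolding face_perm_def face_perm_insert[OF assms]
    by (rule eqc_swap_images_insert[OF hg])
qed

lemma defect_insert:
  assumes S: "S \<subseteq> E" and e: "{h, g} \<in> E" "{h, g} \<notin> S" "h \<noteq> g"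
  shows "defect (insert {h, g} S) = defect S +
    (if (h, g) \<in> eqc (links S) \<and> (h, g) \<notin> eqc (face_perm S) then 2 else 0)"
proof -
  have hg: "h \<in> H" "g \<in> H" using e E(2) by auto
  let ?S = "insert {h, g} S"
  note n = num_classes_insert[OF fin(2) hg]
  have "num_classes (insert (h, g) (face_perm ?S)) H = num_classes (insert (h, g) (face_perm S)) H"
    "num_classes (insert (h, g) (links S)) H = num_classes (links ?S) H"
    using num_classes_cong[OF face_perm_insert_classes(2)[OF assms]]
      num_classes_cong[OF links_insert[OF e(3)]] by simp_all
  moreover have "card ?S = Suc (card S)"
    using e(2) finite_subset[OF S fin(1)] by simp
  moreover have "(h, g) \<in> eqc (face_perm S) \<Longrightarrow> (h, g) \<in> eqc (links S)"
    using face_perm_subset_links[OF S] by auto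
  ultimately show ?thesis
    using n[of "links S"] n[of "face_perm S"] n[of "face_perm ?S"]
      face_perm_insert_classes(1)[OF assms]
    unfolding defect_def by (auto split: if_splits)
qed

lemma defect_mono:
  assumes "S \<subseteq> T" "T \<subseteq> E"
  shows "defect S \<le> defect T"
proof -
  have "defect S \<le> defect (S \<union> U)" if "finite U" "U \<subseteq> E" for U
    using that
  proof (induction U rule: finite_induct)
    case (insert e U)
    then obtain h g where hg: "h \<noteq> g" "e = {h, g}"
      using E(1) by (metis card_2_iff insert_subset matching_def)
    show ?case
    proof (cases "e \<in> S \<union> U")
      case True
      then show ?thesis using insert by (simp add: insert_absorb)
    next
      case False
      then show ?thesis
        using insert defect_insert[of "S \<union> U" h g] hg assms by (auto split: if_splits)
    qed
  qed simp
  from this[of T] show ?thesis using assms finite_subset[OF _ fin(1)] by (simp add: Un_absorb1)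
qed

lemma defect_empty: "defect {} = 0"
proof -
  have "partner ({} :: 'a set set) = id" by (auto simp: partner_def)
  then show ?thesis by (simp add: defect_def links_def face_perm_def)
qed

text \<open>Consider a largest set \<open>S\<close> of edges that some colouring respects, where
  \<open>P0\<close> does for no edges at all. Across an edge between two components of
  \<open>links S\<close> the colouring extends after reversing all colours on one of them. For an
  edge inside one component, the vanishing defect forces both ends onto one face, and a parity count
  applies.\<close>

lemma checkerboard:
  assumes planar: "defect E = 0" and ex: "\<forall>x\<in>H. P0 (\<sigma> x) \<longleftrightarrow> \<not> P0 x"
  shows "\<exists>P. (\<forall>x\<in>H. P (\<sigma> x) \<longleftrightarrow> \<not> P x) \<and> (\<forall>h g. h \<noteq> g \<and> {h, g} \<in> E \<longrightarrow> (P g \<longleftrightarrow> \<not> P h))"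
proof -
  define col where "col S P \<longleftrightarrow> (\<forall>x\<in>H. P (\<sigma> x) \<longleftrightarrow> \<not> P x) \<and>
    (\<forall>h g. h \<noteq> g \<and> {h, g} \<in> S \<longrightarrow> (P g \<longleftrightarrow> \<not> P h))" for S P
  \<comment> \<open>The defect starts at 0, never decreases and ends at 0, so no edge raises it at
    any stage; \<open>key\<close> is this fact for a single edge.\<close>
  have zero: "defect S = 0" if "S \<subseteq> E" for S
    using defect_mono[of S E] defect_mono[of "{}" S] that planar defect_empty by auto
  have key: "(h, g) \<in> eqc (face_perm S)"
    if "S \<subseteq> E" "{h, g} \<in> E" "{h, g} \<notin> S" "h \<noteq> g" "(h, g) \<in> eqc (links S)" for S h g
    using defect_insert[OF that(1-4)] zero[of S] zero[of "insert {h, g} S"] that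
    by (auto split: if_splits)
  define Q where "Q S \<longleftrightarrow> S \<subseteq> E \<and> (\<exists>P. col S P)" for S
  have "Q {}" using ex by (auto simp: Q_def col_def)
  moreover have "\<forall>S. Q S \<longrightarrow> card S < Suc (card E)"
    using card_mono[OF fin(1)] by (auto simp: Q_def less_Suc_eq_le)
  ultimately have "\<exists>S. Q S \<and> (\<forall>T. Q T \<longrightarrow> card T \<le> card S)"
    by (rule ex_has_greatest_nat)
  then obtain S where S: "Q S" and max: "\<And>T. Q T \<Longrightarrow> card T \<le> card S"
    by blast
  obtain P where P: "col S P" and SE: "S \<subseteq> E" using S by (auto simp: Q_def)
  have noext: "\<not> Q (insert e S)" if "e \<notin> S" for e
  proof
    assume "Q (insert e S)"
    then have "card (insert e S) \<le> card S" by (rule max)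
    then show False
      using card_insert_disjoint[OF finite_subset[OF SE fin(1)] that] by simp
  qed
  have conn: "(h, g) \<in> eqc (links S)" if e: "{h, g} \<in> E" "h \<noteq> g" for h g
  proof (rule ccontr)
    assume no: "(h, g) \<notin> eqc (links S)"
    have eS: "{h, g} \<notin> S"
      using no e(2) eqc_incl[of "(h, g)" "links S"] by (auto simp: links_def)
    have ext: "\<exists>P. col S P \<and> (P g \<longleftrightarrow> \<not> P h)"
    proof (cases "P g \<longleftrightarrow> \<not> P h")
      case True
      with P show ?thesis by (intro exI conjI)
    next
      case False
      \<comment> \<open>All colours on the component of \<open>g\<close> are reversed. No pair in
        \<open>links S\<close> leaves that component, so the conditions for \<open>S\<close> stay
        true.\<close>
      define P' where "P' x \<longleftrightarrow> ((g, x) \<in> eqc (links S)) \<noteq> P x" for x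
      have same: "(g, y) \<in> eqc (links S) \<longleftrightarrow> (g, x) \<in> eqc (links S)" if "(x, y) \<in> links S" for x y
        using eqc_incl[OF that] eqc_sym[of x y] eqc_trans[of g x _ y] eqc_trans[of g y _ x] by blast
      have "col S P'"
        using P same by (auto simp: col_def P'_def links_def graph_on_def)
      moreover have "P' g \<longleftrightarrow> \<not> P' h"
        using False no eqc_sym[of g h "links S"] by (auto simp: P'_def)
      ultimately show ?thesis by (intro exI conjI)
    qed
    then obtain P' where P': "col S P'" "P' g \<longleftrightarrow> \<not> P' h" by (elim exE conjE)
    have "col (insert {h, g} S) P'"
      using P' by (auto simp: col_def doubleton_eq_iff)
    then have "Q (insert {h, g} S)" using SE e(1) by (auto simp: Q_def)
    then show False using noext eS by auto
  qed
  txt \<open>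
    By maximality every edge has both ends in one component of \<open>links S\<close>. If the two ends of a missing
    edge \<open>{h, g}\<close> had the same colour, then along the new face through \<open>h\<close> the colour would change at
    \<open>h\<close> and at the ends of missing edges, which come in pairs: an odd number of times.
  \<close>
  have "S = E"
  proof (rule ccontr)
    assume "S \<noteq> E"
    then obtain e where e: "e \<in> E" "e \<notin> S" using SE by auto
    then obtain h g where hg: "h \<noteq> g" "e = {h, g}"
      using E(1) by (metis card_2_iff matching_def)
    define S' where "S' = insert {h, g} S"
    have S'E: "S' \<subseteq> E" using SE e hg by (auto simp: S'_def)
    have hgE: "{h, g} \<in> E" "{h, g} \<notin> S" using e hg by auto
    have "(h, g) \<in> eqc (face_perm S)" using key[OF SE] conn e hg by auto
    then have sep: "(h, g) \<notin> eqc (face_perm S')"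
      using face_perm_insert_classes(1)[OF SE, of h g] e hg by (auto simp: S'_def)
    \<comment> \<open>The new edge cuts its face in two; \<open>K\<close> is the part that contains
      \<open>h\<close> and not \<open>g\<close>.\<close>
    define K where "K = {x \<in> H. (h, x) \<in> eqc (face_perm S')}"
    define \<psi> where "\<psi> = \<sigma> \<circ> partner S'"
    have \<psi>: "\<psi> permutes H" unfolding \<psi>_def by (rule face_perm_permutes[OF S'E])
    have finK: "finite K" using fin by (simp add: K_def)
    have "\<psi> ` K \<subseteq> K"
    proof
      fix y assume "y \<in> \<psi> ` K"
      then obtain x where x: "x \<in> K" "y = \<psi> x" by auto
      then have "(x, y) \<in> eqc (face_perm S')"
        by (intro eqc_incl) (auto simp: face_perm_def graph_on_def \<psi>_def K_def)
      then show "y \<in> K"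
        using x permutes_in_image[OF \<psi>] eqc_trans[of h x _ y] by (auto simp: K_def)
    qed
    moreover have inj: "inj_on \<psi> K" using permutes_inj[OF \<psi>] by (rule inj_on_subset) simp
    ultimately have im: "\<psi> ` K = K" using endo_inj_surj[OF finK] by auto
    have ev: "even (card {x \<in> K. P (\<psi> x) \<noteq> P x})"
      by (rule permutes_image_count[OF inj im finK])
    have "P g \<longleftrightarrow> \<not> P h"
    proof (rule ccontr)
      assume "\<not> (P g \<longleftrightarrow> \<not> P h)"
      then have same: "P g = P h" by auto
      have m: "matching S" "matching S'" using matching_subset[OF E(1)] SE S'E by auto
      have hK: "h \<in> K" "g \<notin> K" using sep hgE E(2) by (auto simp: K_def)
      have inS': "h \<in> \<Union>S'" by (auto simp: S'_def)
      \<comment> \<open>At a loose end only \<open>\<sigma>\<close> acts, and it changes the colour.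
        Along an edge of \<open>S\<close> the changes by the edge and by \<open>\<sigma>\<close>
        cancel. Along the new edge there is just one change, because its ends share their colour,
        and only its end \<open>h\<close> lies in \<open>K\<close>.\<close>
      have flip: "P (\<psi> x) \<noteq> P x \<longleftrightarrow> x = h \<or> x \<notin> \<Union>S'" if "x \<in> K" for x
      proof (cases "x \<in> \<Union>S'")
        case False
        then show ?thesis
          using P that by (auto simp: \<psi>_def partner_notin col_def K_def)
      next
        case True
        have px: "partner S' x \<noteq> x" "{x, partner S' x} \<in> S'" using partner_in[OF m(2) True] by auto
        then have pH: "partner S' x \<in> H" using S'E E(2) by blast
        then have Px: "P (\<psi> x) \<longleftrightarrow> \<not> P (partner S' x)"
          using P by (auto simp: col_def \<psi>_def)
        show ?thesis
        proof (cases "{x, partner S' x} \<in> S")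
          case True
          then have "P (partner S' x) \<longleftrightarrow> \<not> P x" using P px by (auto simp: col_def)
          moreover have "x \<noteq> h"
            using matching_disjointD[OF E(1) _ hgE(1), of "{x, partner S' x}" h] True hgE SE by auto
          ultimately show ?thesis using Px \<open>x \<in> \<Union>S'\<close> by auto
        next
          case False
          then have "{x, partner S' x} = {h, g}" using px by (auto simp: S'_def)
          then have "x = h \<and> partner S' x = g"
            using that hK by (auto simp: doubleton_eq_iff)
          then show ?thesis using Px same by auto
        qed
      qed
      have "{x \<in> K. P (\<psi> x) \<noteq> P x} = insert h (K - \<Union>S')"
      proof (rule Set.set_eqI)
        fix x
        show "x \<in> {x \<in> K. P (\<psi> x) \<noteq> P x} \<longleftrightarrow> x \<in> insert h (K - \<Union>S')"
          using flip[of x] hK(1) by (cases "x \<in> K") auto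
      qed
      moreover have "card (insert h (K - \<Union>S')) = Suc (card (K - \<Union>S'))"
        by (rule card_insert_disjoint) (use finK inS' in auto)
      moreover have "even (card (K - \<Union>S'))"
      proof -
        \<comment> \<open>The loose ends in \<open>K\<close> pair up: both ends of a missing edge
          lie in one component, hence on one face by \<open>key\<close>.\<close>
        let ?F = "{f \<in> E - S'. f \<subseteq> K}"
        have "K - \<Union>S' = \<Union>?F"
        proof (intro subset_antisym subsetI)
          fix x assume x: "x \<in> K - \<Union>S'"
          then have "x \<in> \<Union>E" using E(2) by (auto simp: K_def)
          note p = partner_in[OF E(1) this]
          have notin: "{x, partner E x} \<notin> S'" using x by auto
          have "links S \<subseteq> links S'" by (auto simp: links_def S'_def)
          from eqc_mono[OF this] conn[OF p(2)] p(1)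
          have "(x, partner E x) \<in> eqc (links S')" by auto
          then have "(x, partner E x) \<in> eqc (face_perm S')"
            using key[OF S'E p(2) notin] p(1) by auto
          then have "partner E x \<in> K"
            using x p(2) E(2) eqc_trans[of h x "face_perm S'" "partner E x"] by (auto simp: K_def)
          then show "x \<in> \<Union>?F" using x p notin by auto
        next
          fix x assume "x \<in> \<Union>?F"
          then obtain f where f: "f \<in> E" "f \<notin> S'" "f \<subseteq> K" "x \<in> f" by auto
          have "x \<notin> f'" if "f' \<in> S'" for f'
            using matching_disjointD[OF E(1) f(1) subsetD[OF S'E that] f(4)] f(2) that by blast
          then have "x \<notin> \<Union>S'" by blast
          then show "x \<in> K - \<Union>S'" using f by auto
        qed
        moreover have "card (\<Union>?F) = sum card ?F"
          by (rule card_Union_disjoint)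
            (use E(1) finK in \<open>auto simp: matching_def intro: finite_subset pairwise_subset\<close>)
        moreover have "sum card ?F = 2 * card ?F"
          using E(1) by (simp add: matching_def)
        ultimately show ?thesis by simp
      qed
      ultimately show False using ev by simp
    qed
    then have "col (insert e S) P" using P hg by (auto simp: col_def doubleton_eq_iff)
    then show False using noext[OF e(2)] SE e(1) by (auto simp: Q_def)
  qed
  then show ?thesis using P by (auto simp: col_def)
qed

end

section \<open>Circles of the states of a diagram\<close>

locale diagram =
  fixes D :: "'h diagram"
  assumes link: "link_diagram D"
begin

lemma finite_darts [simp]: "finite (darts D)"
  using link unfolding link_diagram_def darts_def
  by (metis card.infinite finite_Union zero_neq_numeral)

lemma matching_edges: "matching (edges D)"
  using link by (auto simp: link_diagram_def matching_def)

lemma vertex: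
  assumes "v \<in> verts D"
  shows "distinct v" "length v = 2 \<or> length v = 4" "set v \<subseteq> darts D"
  using link assms by (auto simp: link_diagram_def)

lemma vertex_eq: "v \<in> verts D \<Longrightarrow> w \<in> verts D \<Longrightarrow> h \<in> set v \<Longrightarrow> h \<in> set w \<Longrightarrow> v = w"
  using link unfolding link_diagram_def pairwise_def by (metis disjoint_iff)

lemma vertex_nth: "v \<in> verts D \<Longrightarrow> k < length v \<Longrightarrow> v ! k \<in> darts D"
  using vertex(3)[of v] nth_mem[of k v] by blast

lemma dart_vertexE:
  assumes "h \<in> darts D"
  obtains v k where "v \<in> verts D" "k < length v" "h = v ! k"
proof -
  have "\<Union>(set ` verts D) = darts D" using link by (simp add: link_diagram_def)
  then obtain v where "v \<in> verts D" "h \<in> set v" using assms by auto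
  then show thesis using that by (metis in_set_conv_nth)
qed

lemma vertex_index:
  assumes "v \<in> verts D" "k < length v" "w \<in> verts D" "l < length w" "v ! k = w ! l"
  shows "v = w \<and> k = l"
proof -
  have "v = w" using vertex_eq[of v w "v ! k"] assms nth_mem[OF assms(2)] nth_mem[OF assms(4)] by simp
  then show ?thesis using assms vertex(1) nth_eq_iff_index_eq by metis
qed

lemma crossing:
  assumes "c \<in> crossings D"
  shows "c \<in> verts D" "length c = 4" "distinct c"
  using assms vertex by (auto simp: crossings_def)

lemma crossing_darts: "c \<in> crossings D \<Longrightarrow> k < 4 \<Longrightarrow> c ! k \<in> darts D"
  using crossing[of c] vertex(3)[of c] by auto

definition next_dart :: "'h \<Rightarrow> 'h"
  where "next_dart h = (if h \<in> darts D then THE k. (h, k) \<in> next_at_vertex D else h)"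

lemma next_at_vertex_iff:
  assumes "v \<in> verts D" "k < length v"
  shows "(v ! k, g) \<in> next_at_vertex D \<longleftrightarrow> g = v ! (Suc k mod length v)"
  using vertex_index[OF assms] assms by (auto simp: next_at_vertex_def)

lemma next_dart_nth:
  assumes "v \<in> verts D" "k < length v"
  shows "next_dart (v ! k) = v ! (Suc k mod length v)"
  using vertex_nth[OF assms] assms by (simp add: next_dart_def next_at_vertex_iff)

lemma next_dart_permutes: "next_dart permutes darts D"
proof (rule bij_imp_permutes)
  have "darts D \<subseteq> next_dart ` darts D"
  proof
    fix h assume "h \<in> darts D"
    then obtain v k where v: "v \<in> verts D" "k < length v" "h = v ! k" by (rule dart_vertexE)
    define l where "l = (if k = 0 then length v - 1 else k - 1)"
    have l: "l < length v" "Suc l mod length v = k" using v by (auto simp: l_def)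
    then have "h = next_dart (v ! l)" using next_dart_nth[OF v(1) l(1)] v by simp
    then show "h \<in> next_dart ` darts D" using vertex_nth[OF v(1) l(1)] by (rule image_eqI)
  qed
  moreover have "next_dart ` darts D \<subseteq> darts D"
  proof
    fix h assume "h \<in> next_dart ` darts D"
    then obtain g where g: "g \<in> darts D" "h = next_dart g" by auto
    obtain v k where v: "v \<in> verts D" "k < length v" "g = v ! k" using g(1) by (rule dart_vertexE)
    then have "Suc k mod length v < length v" by (intro mod_less_divisor) auto
    then show "h \<in> darts D" using next_dart_nth[OF v(1,2)] vertex_nth[OF v(1)] g v by simp
  qed
  ultimately have "next_dart ` darts D = darts D" by auto
  then show "bij_betw next_dart (darts D) (darts D)"
    by (simp add: bij_betw_def eq_card_imp_inj_on)
qed (simp add: next_dart_def)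

lemma vertex_connected:
  assumes "v \<in> verts D" "h \<in> set v" "g \<in> set v"
  shows "(h, g) \<in> eqc (graph_on next_dart (darts D))"
proof -
  have *: "(v ! 0, v ! k) \<in> eqc (graph_on next_dart (darts D))" if "k < length v" for k
    using that
  proof (induction k)
    case (Suc k)
    have "(v ! k, v ! Suc k) \<in> graph_on next_dart (darts D)"
      using next_dart_nth[OF assms(1), of k] Suc.prems vertex_nth[OF assms(1), of k]
      by (auto simp: graph_on_def image_iff intro!: bexI[of _ "v ! k"])
    then show ?case using Suc eqc_incl eqc_trans by (metis Suc_lessD)
  qed simp
  then show ?thesis
    using assms(2,3) eqc_sym eqc_trans by (metis in_set_conv_nth)
qed

lemma num_classes_vertices: "num_classes (graph_on next_dart (darts D)) (darts D) = card (verts D)"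
proof -
  let ?r = "graph_on next_dart (darts D)"
  have cls: "eqc ?r `` {h} = set v" if v: "v \<in> verts D" "h \<in> set v" for h v
  proof (intro subset_antisym subsetI)
    fix g assume "g \<in> set v"
    then show "g \<in> eqc ?r `` {h}" using vertex_connected v by auto
  next
    fix g assume "g \<in> eqc ?r `` {h}"
    moreover have "eqc ?r \<subseteq> {(x, y). x = y \<or> (\<exists>v \<in> verts D. x \<in> set v \<and> y \<in> set v)}"
    proof (rule eqc_least)
      show "?r \<subseteq> {(x, y). x = y \<or> (\<exists>v \<in> verts D. x \<in> set v \<and> y \<in> set v)}"
      proof
        fix p assume "p \<in> ?r"
        then obtain x where x: "x \<in> darts D" "p = (x, next_dart x)" by (auto simp: graph_on_def)
        obtain v k where v: "v \<in> verts D" "k < length v" "x = v ! k" using x(1) by (rule dart_vertexE)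
        then have "Suc k mod length v < length v" by (intro mod_less_divisor) auto
        then have "next_dart x \<in> set v" "x \<in> set v" using next_dart_nth[OF v(1,2)] v by auto
        then show "p \<in> {(x, y). x = y \<or> (\<exists>v \<in> verts D. x \<in> set v \<and> y \<in> set v)}"
          using x v by auto
      qed
    next
      let ?E = "{(x, y). x = y \<or> (\<exists>v \<in> verts D. x \<in> set v \<and> y \<in> set v)}"
      fix x y z
      assume xyz: "(x, y) \<in> ?E" "(y, z) \<in> ?E"
      then consider "x = y" | "y = z"
        | v w where "v \<in> verts D" "x \<in> set v" "y \<in> set v" "w \<in> verts D" "y \<in> set w" "z \<in> set w"
        by auto
      then show "(x, z) \<in> ?E"
      proof cases
        case 3
        then have "v = w" using vertex_eq[of v w y] by simp
        then show ?thesis using 3 by auto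
      qed (use xyz in auto)
    qed auto
    ultimately have "h = g \<or> (\<exists>w \<in> verts D. h \<in> set w \<and> g \<in> set w)" by auto
    then show "g \<in> set v"
    proof
      assume "\<exists>w \<in> verts D. h \<in> set w \<and> g \<in> set w"
      then obtain w where w: "w \<in> verts D" "h \<in> set w" "g \<in> set w" by auto
      then have "w = v" using vertex_eq[of w v h] v by simp
      then show ?thesis using w by simp
    qed (use v in simp)
  qed
  have "(\<lambda>h. eqc ?r `` {h}) ` darts D = set ` verts D"
  proof (intro subset_antisym subsetI)
    fix X assume "X \<in> (\<lambda>h. eqc ?r `` {h}) ` darts D"
    then obtain h where h: "h \<in> darts D" "X = eqc ?r `` {h}" by auto
    from h(1) obtain v k where "v \<in> verts D" "k < length v" "h = v ! k" by (rule dart_vertexE)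
    then show "X \<in> set ` verts D" using h cls[of v h] by auto
  next
    fix X assume "X \<in> set ` verts D"
    then obtain v where v: "v \<in> verts D" "X = set v" by auto
    then have "v ! 0 \<in> set v" using vertex(2)[of v] by auto
    then show "X \<in> (\<lambda>h. eqc ?r `` {h}) ` darts D"
      using v cls[of v "v ! 0"] vertex(3)[of v] by (auto intro!: rev_image_eqI[of "v ! 0"])
  qed
  moreover have "inj_on set (verts D)"
  proof (rule inj_onI)
    fix v w assume "v \<in> verts D" "w \<in> verts D" "set v = set w"
    moreover have "v ! 0 \<in> set v" using vertex(2)[of v] \<open>v \<in> verts D\<close> by auto
    ultimately show "v = w" using vertex_eq by blast
  qed
  ultimately show ?thesis by (simp add: num_classes_def card_image)
qed

sublocale rotation_system "darts D" next_dart "edges D"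
proof
  show "finite (edges D)" using link by (simp add: link_diagram_def)
qed (use matching_edges next_dart_permutes in \<open>simp_all flip: darts_def\<close>)

lemma face_step_eq: "face_step D = face_perm (edges D)"
proof (intro subset_antisym subsetI)
  fix p assume "p \<in> face_step D"
  then obtain h k g where p: "p = (h, k)" "h \<noteq> g" "{h, g} \<in> edges D" "(g, k) \<in> next_at_vertex D"
    by (auto simp: face_step_def)
  then have "g \<in> darts D" by (auto simp: darts_def)
  then obtain v i where "v \<in> verts D" "i < length v" "g = v ! i" by (rule dart_vertexE)
  then have "k = next_dart g" using p next_at_vertex_iff next_dart_nth by simp
  moreover have "h \<in> darts D" using p by (auto simp: darts_def)
  ultimately show "p \<in> face_perm (edges D)"
    using p partner_eq[OF matching_edges p(3,2)]
    by (auto simp: face_perm_def graph_on_def)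
next
  fix p assume "p \<in> face_perm (edges D)"
  then obtain h where h: "h \<in> darts D" "p = (h, next_dart (partner (edges D) h))"
    by (auto simp: face_perm_def graph_on_def)
  then have e: "partner (edges D) h \<noteq> h" "{h, partner (edges D) h} \<in> edges D"
    using partner_in[OF matching_edges, of h] by (auto simp: darts_def)
  then have "partner (edges D) h \<in> darts D" by (auto simp: darts_def)
  then obtain v i where "v \<in> verts D" "i < length v" "partner (edges D) h = v ! i"
    by (rule dart_vertexE)
  then have "(partner (edges D) h, next_dart (partner (edges D) h)) \<in> next_at_vertex D"
    using next_at_vertex_iff next_dart_nth by simp
  then show "p \<in> face_step D" using h e(2) e(1)[symmetric] unfolding face_step_def by blast
qed

text \<open>Faces are defined by forward steps only. For a permutation of a finite set these already
  reach the whole equivalence class, so the count is the one that occurs in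
  \<open>defect\<close>.\<close>

lemma card_faces: "card (faces D) = num_classes (face_perm (edges D)) (darts D)"
proof -
  have "(face_step D)\<^sup>* `` {h} = eqc (face_perm (edges D)) `` {h}" if h: "h \<in> darts D" for h
  proof (intro subset_antisym subsetI)
    fix g assume "g \<in> eqc (face_perm (edges D)) `` {h}"
    define f where "f = next_dart \<circ> partner (edges D)"
    have f: "f permutes darts D" unfolding f_def by (rule face_perm_permutes) simp
    have g: "face_perm (edges D) = graph_on f (darts D)" by (simp add: face_perm_def f_def)
    obtain n where n: "g = (f ^^ n) h"
      using \<open>g \<in> _\<close> eqc_graph_on_iff[OF f finite_darts h] by (auto simp: g)
    have "(f ^^ n) h \<in> darts D \<and> (h, (f ^^ n) h) \<in> (graph_on f (darts D))\<^sup>*"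
    proof (induction n)
      case (Suc n)
      have "((f ^^ n) h, (f ^^ Suc n) h) \<in> graph_on f (darts D)"
        using Suc by (auto simp: graph_on_def)
      moreover have "(f ^^ Suc n) h \<in> darts D"
        using Suc permutes_in_image[OF f] by simp
      ultimately show ?case using Suc by (meson rtrancl.rtrancl_into_rtrancl)
    qed (use h in simp)
    then show "g \<in> (face_step D)\<^sup>* `` {h}" using n by (simp add: face_step_eq g)
  next
    fix g assume "g \<in> (face_step D)\<^sup>* `` {h}"
    then show "g \<in> eqc (face_perm (edges D)) `` {h}"
      using rtrancl_mono[of "face_perm (edges D)" "face_perm (edges D) \<union> (face_perm (edges D))\<inverse>"]
      by (auto simp: face_step_eq eqc_def)
  qed
  then have "faces D = (\<lambda>h. eqc (face_perm (edges D)) `` {h}) ` darts D"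
    by (simp add: faces_def)
  then show ?thesis by (simp add: num_classes_def)
qed

end

section \<open>Components and the colouring of the darts\<close>

lemma component_eqc: "component D h = eqc (adjacent D) `` {h}"
proof -
  have "sym (adjacent D)" by (auto simp: sym_def adjacent_def)
  then show ?thesis by (simp add: component_def eqc_rtrancl)
qed

lemma component_eq_iff: "component D h = component D g \<longleftrightarrow> (h, g) \<in> eqc (adjacent D)"
  by (simp add: component_eqc eqc_class_eq)

context diagram
begin

lemma eqc_adjacent: "eqc (adjacent D) = eqc (links (edges D))"
proof (rule eqc_eqI)
  have sub: "eqc (graph_on next_dart (darts D)) \<subseteq> eqc (links (edges D))"
    by (rule eqc_mono) (auto simp: links_def)
  show "adjacent D \<subseteq> eqc (links (edges D))"
  proof
    fix p assume "p \<in> adjacent D"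
    then obtain h k x where p: "p = (h, k)" "x \<in> edges D \<union> set ` verts D" "h \<in> x" "k \<in> x"
      by (auto simp: adjacent_def)
    show "p \<in> eqc (links (edges D))"
    proof (cases "x \<in> edges D")
      case True
      obtain g where "g \<noteq> h" "x = {h, g}" using matchingE[OF matching_edges True p(3)] .
      then show ?thesis using p True
        by (cases "h = k") (auto simp: links_def intro!: eqc_incl)
    next
      case False
      then show ?thesis using p vertex_connected sub by auto
    qed
  qed
  show "links (edges D) \<subseteq> eqc (adjacent D)"
  proof
    fix p assume "p \<in> links (edges D)"
    then consider h where "h \<in> darts D" "p = (h, next_dart h)"
      | h g where "p = (h, g)" "{h, g} \<in> edges D"
      by (auto simp: links_def graph_on_def)
    then show "p \<in> eqc (adjacent D)"
    proof cases
      case 1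
      from 1(1) obtain v k where v: "v \<in> verts D" "k < length v" "h = v ! k" by (rule dart_vertexE)
      then have "Suc k mod length v < length v" by (intro mod_less_divisor) auto
      then have "next_dart h \<in> set v" "h \<in> set v" using next_dart_nth[OF v(1,2)] v by auto
      then have "p \<in> adjacent D" using 1(2) v(1) by (auto simp: adjacent_def)
      then show ?thesis by (rule eqc_incl)
    next
      case 2
      then have "p \<in> adjacent D" by (auto simp: adjacent_def intro!: bexI[of _ "{h, g}"])
      then show ?thesis by (rule eqc_incl)
    qed
  qed
qed

text \<open>Euler's formula becomes \<open>defect (edges D) = 0\<close> once vertices, faces and
  components are counted as classes of darts.\<close>

lemma dart_colouring:
  "\<exists>P. (\<forall>v \<in> verts D. \<forall>k < length v. P (v ! (Suc k mod length v)) \<longleftrightarrow> \<not> P (v ! k)) \<and>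
    (\<forall>h g. h \<noteq> g \<and> {h, g} \<in> edges D \<longrightarrow> (P g \<longleftrightarrow> \<not> P h))"
proof -
  have "card (components D) = num_classes (links (edges D)) (darts D)"
    by (simp add: num_classes_def components_def component_eqc[abs_def] eqc_adjacent)
  moreover have "planar D" using link by (simp add: link_diagram_def)
  ultimately have "defect (edges D) = 0"
    by (simp add: defect_def num_classes_vertices planar_def flip: card_faces)
  \<comment> \<open>All valencies are even, so the parity of the position in the list alternates all
    the way around a vertex. This is the colouring to start from, before any edge is taken into
    account.\<close>
  moreover define P0 where
    "P0 h \<longleftrightarrow> (\<exists>v \<in> verts D. \<exists>k < length v. h = v ! k \<and> even k)" for h
  have P0: "P0 (v ! k) \<longleftrightarrow> even k" if "v \<in> verts D" "k < length v" for v k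
    using that vertex_index[OF that] by (auto simp: P0_def)
  have "\<forall>x \<in> darts D. P0 (next_dart x) \<longleftrightarrow> \<not> P0 x"
  proof
    fix x assume "x \<in> darts D"
    then obtain v k where v: "v \<in> verts D" "k < length v" "x = v ! k" by (rule dart_vertexE)
    then have "Suc k mod length v < length v" by (intro mod_less_divisor) auto
    moreover have "even (Suc k mod length v) \<longleftrightarrow> odd k"
      using vertex(2)[OF v(1)] by (auto simp: dvd_mod_iff)
    ultimately show "P0 (next_dart x) \<longleftrightarrow> \<not> P0 x"
      using v P0 next_dart_nth by simp
  qed
  ultimately have "\<exists>P. (\<forall>x \<in> darts D. P (next_dart x) \<longleftrightarrow> \<not> P x) \<and>
      (\<forall>h g. h \<noteq> g \<and> {h, g} \<in> edges D \<longrightarrow> (P g \<longleftrightarrow> \<not> P h))"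
    by (rule checkerboard)
  then obtain P where P: "\<forall>x \<in> darts D. P (next_dart x) \<longleftrightarrow> \<not> P x"
    "\<forall>h g. h \<noteq> g \<and> {h, g} \<in> edges D \<longrightarrow> (P g \<longleftrightarrow> \<not> P h)"
    by (elim exE conjE)
  have "P (v ! (Suc k mod length v)) \<longleftrightarrow> \<not> P (v ! k)" if "v \<in> verts D" "k < length v" for v k
    using bspec[OF P(1) vertex_nth[OF that]] unfolding next_dart_nth[OF that] .
  with P(2) show ?thesis by (intro exI conjI) auto
qed

section \<open>The arcs of a state and the walk along its circles\<close>

definition arcs :: "'h state \<Rightarrow> 'h set set"
  where "arcs s = set ` verts (resolution D s)"

definition pieces :: "'h state \<Rightarrow> 'h list \<Rightarrow> 'h set set"
  where "pieces s v = set ` (if v \<in> crossings D then splitting (s v) v else {v})"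

lemma arcs_eq: "arcs s = (\<Union>v \<in> verts D. pieces s v)"
proof -
  have "verts (resolution D s) =
      (\<Union>v \<in> verts D. if v \<in> crossings D then splitting (s v) v else {v})"
    by (auto simp: resolution_def crossings_def split: if_splits)
  then show ?thesis by (simp only: arcs_def pieces_def image_UN)
qed

lemma length_4E:
  assumes "length v = 4"
  obtains x0 x1 x2 x3 where "v = [x0, x1, x2, x3]"
  using assms by (auto simp: eval_nat_numeral length_Suc_conv)

lemma pieces_props:
  assumes "v \<in> verts D"
  shows "matching (pieces s v)" "\<Union>(pieces s v) = set v"
proof -
  have "matching (pieces s v) \<and> \<Union>(pieces s v) = set v"
  proof (cases "v \<in> crossings D")
    case True
    obtain x0 x1 x2 x3 where "v = [x0, x1, x2, x3]"
      using crossing(2)[OF True] by (rule length_4E)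
    then show ?thesis
      using True crossing(3)[OF True]
      by (cases "s v") (auto simp: pieces_def matching_def pairwise_def disjnt_def)
  next
    case False
    then show ?thesis
      using vertex[OF assms] assms
      by (auto simp: pieces_def matching_def pairwise_def crossings_def distinct_card)
  qed
  then show "matching (pieces s v)" "\<Union>(pieces s v) = set v" by auto
qed

lemma matching_arcs: "matching (arcs s)"
  unfolding matching_def arcs_eq
proof (intro conjI)
  show "\<forall>e \<in> \<Union>v \<in> verts D. pieces s v. card e = 2"
    using pieces_props(1) by (auto simp: matching_def)
  show "disjoint (\<Union>v \<in> verts D. pieces s v)"
  proof (rule pairwiseI)
    fix e e' assume "e \<in> (\<Union>v \<in> verts D. pieces s v)" "e' \<in> (\<Union>v \<in> verts D. pieces s v)" "e \<noteq> e'"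
    then obtain v v' where v: "v \<in> verts D" "e \<in> pieces s v" "v' \<in> verts D" "e' \<in> pieces s v'" "e \<noteq> e'"
      by auto
    then have "e \<subseteq> set v" "e' \<subseteq> set v'" using pieces_props(2) by blast+
    show "disjnt e e'"
    proof (cases "v = v'")
      case True
      then show ?thesis
        using v pieces_props(1)[OF v(1), of s] by (simp add: matching_def pairwise_def)
    next
      case False
      then have "set v \<inter> set v' = {}" using vertex_eq[OF v(1,3)] by blast
      then show ?thesis using \<open>e \<subseteq> set v\<close> \<open>e' \<subseteq> set v'\<close> unfolding disjnt_def by blast
    qed
  qed
qed

lemma Union_arcs: "\<Union>(arcs s) = darts D"
proof -
  have "\<Union>(arcs s) = (\<Union>v \<in> verts D. \<Union>(pieces s v))"
    by (auto simp: arcs_eq)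
  also have "\<dots> = (\<Union>v \<in> verts D. set v)"
    by (simp add: pieces_props(2))
  finally have "\<Union>(arcs s) = (\<Union>v \<in> verts D. set v)" .
  then show ?thesis using link by (simp add: link_diagram_def)
qed

lemma darts_resolution [simp]: "darts (resolution D s) = darts D"
  by (simp add: darts_def resolution_def)

abbreviation R :: "'h state \<Rightarrow> 'h \<Rightarrow> 'h set"
  where "R s \<equiv> component (resolution D s)"

definition walk :: "('h \<Rightarrow> bool) \<Rightarrow> 'h state \<Rightarrow> 'h \<Rightarrow> 'h"
  where "walk P s h = (if P h then partner (edges D) h else partner (arcs s) h)"

text \<open>
  The colouring orients every circle of every state, since a strand through a crossing or along an
  edge always joins darts of different colours; hence switching one crossing composes the
  permutation that walks along the circles with a transposition.
\<close>

lemma walk_permutes: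
  assumes P: "\<And>h g. h \<noteq> g \<Longrightarrow> {h, g} \<in> edges D \<Longrightarrow> P g \<longleftrightarrow> \<not> P h"
    "\<And>h g. h \<noteq> g \<Longrightarrow> {h, g} \<in> arcs s \<Longrightarrow> P g \<longleftrightarrow> \<not> P h"
  shows "walk P s permutes darts D"
proof (rule bij_imp_permutes)
  have e: "P (partner (edges D) h) \<longleftrightarrow> \<not> P h" "partner (edges D) h \<in> darts D" if "h \<in> darts D" for h
    using partner_in[OF matching_edges, of h] P(1)[of h "partner (edges D) h"] that
    by (auto simp: darts_def)
  have a: "P (partner (arcs s) h) \<longleftrightarrow> \<not> P h" "partner (arcs s) h \<in> darts D" if "h \<in> darts D" for h
    using partner_in[OF matching_arcs, of h s] P(2)[of h "partner (arcs s) h"] that Union_arcs[of s]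
    by auto
  have "inj_on (walk P s) (darts D)"
  proof (rule inj_onI)
    fix x y assume xy: "x \<in> darts D" "y \<in> darts D" and eq: "walk P s x = walk P s y"
    have "P (walk P s z) \<longleftrightarrow> \<not> P z" if "z \<in> darts D" for z
      using e(1)[OF that] a(1)[OF that] by (simp add: walk_def)
    from this[OF xy(1)] this[OF xy(2)] have "P x = P y" unfolding eq by simp
    with eq have "partner (edges D) x = partner (edges D) y \<or> partner (arcs s) x = partner (arcs s) y"
      by (cases "P x") (simp_all add: walk_def)
    then show "x = y"
      using partner_partner[OF matching_edges] partner_partner[OF matching_arcs] by metis
  qed
  moreover have "walk P s ` darts D \<subseteq> darts D" using e(2) a(2) by (auto simp: walk_def)
  ultimately show "bij_betw (walk P s) (darts D) (darts D)"
    by (simp add: bij_betw_def endo_inj_surj)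
  show "walk P s x = x" if "x \<notin> darts D" for x
    using that partner_notin[of x "edges D"] partner_notin[of x "arcs s"] Union_arcs[of s]
    by (simp add: walk_def darts_def)
qed

text \<open>The colour decides from which end the walk passes: an edge from its end in
  \<open>P\<close>, an arc from its end outside \<open>P\<close>. Each is passed in exactly one
  direction, so the orbits of the walk are the circles.\<close>

lemma eqc_walk:
  assumes P: "\<And>h g. h \<noteq> g \<Longrightarrow> {h, g} \<in> edges D \<Longrightarrow> P g \<longleftrightarrow> \<not> P h"
    "\<And>h g. h \<noteq> g \<Longrightarrow> {h, g} \<in> arcs s \<Longrightarrow> P g \<longleftrightarrow> \<not> P h"
  shows "eqc (adjacent (resolution D s)) = eqc (graph_on (walk P s) (darts D))"
proof (rule eqc_eqI)
  have adj: "adjacent (resolution D s) = {(h, k). \<exists>x \<in> edges D \<union> arcs s. h \<in> x \<and> k \<in> x}"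
    by (simp add: adjacent_def arcs_def resolution_def)
  have w: "(h, walk P s h) \<in> eqc (graph_on (walk P s) (darts D))" if "h \<in> darts D" for h
    using that by (intro eqc_incl) (auto simp: graph_on_def)
  have pair: "(h, k) \<in> eqc (graph_on (walk P s) (darts D))"
    if M: "M = edges D \<or> M = arcs s" "{h, k} \<in> M" "h \<noteq> k" for M h k
  proof -
    have hk: "h \<in> darts D" "k \<in> darts D" using M Union_arcs[of s] by (auto simp: darts_def)
    have Phk: "P k \<longleftrightarrow> \<not> P h" using P[of h k] M by auto
    have "walk P s h = k \<or> walk P s k = h"
      using M Phk partner_eq[OF matching_edges, of h k] partner_eq[OF matching_edges, of k h]
        partner_eq[OF matching_arcs, of h k] partner_eq[OF matching_arcs, of k h]
      by (auto simp: walk_def insert_commute)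
    then show ?thesis using w[OF hk(1)] w[OF hk(2)] eqc_sym by metis
  qed
  show "adjacent (resolution D s) \<subseteq> eqc (graph_on (walk P s) (darts D))"
  proof
    fix p assume "p \<in> adjacent (resolution D s)"
    then obtain h k x where p: "p = (h, k)" "x \<in> edges D \<union> arcs s" "h \<in> x" "k \<in> x"
      by (auto simp: adj)
    then obtain M where M: "M = edges D \<or> M = arcs s" "x \<in> M" by auto
    then have "matching M" using matching_edges matching_arcs by auto
    then obtain g where "g \<noteq> h" "x = {h, g}" using matchingE M(2) p(3) by metis
    then show "p \<in> eqc (graph_on (walk P s) (darts D))" using pair[OF M(1), of h k] M p by auto
  qed
  show "graph_on (walk P s) (darts D) \<subseteq> eqc (adjacent (resolution D s))"
  proof
    fix p assume "p \<in> graph_on (walk P s) (darts D)"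
    then obtain h where h: "h \<in> darts D" "p = (h, walk P s h)" by (auto simp: graph_on_def)
    then have "{h, walk P s h} \<in> edges D \<union> arcs s"
      using partner_in(2)[OF matching_edges, of h] partner_in(2)[OF matching_arcs, of h s]
        Union_arcs[of s]
      by (auto simp: walk_def darts_def)
    then have "p \<in> adjacent (resolution D s)" using h by (auto simp: adj)
    then show "p \<in> eqc (adjacent (resolution D s))" by (rule eqc_incl)
  qed
qed

text \<open>The colours alternate around \<open>c\<close>, so \<open>c ! 0\<close> and
  \<open>c ! 2\<close> share a colour. If it is the one that leaves along arcs, the walk goes from
  them to \<open>c ! 1\<close> and \<open>c ! 3\<close> under the A-splitting, and to
  \<open>c ! 3\<close> and \<open>c ! 1\<close> under the B-splitting: two values change places and
  nothing else changes.\<close>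

lemma skein_step:
  assumes c: "c \<in> crossings D" and s: "s c = MarkA"
  defines "t \<equiv> s(c := MarkB)"
  shows "(c ! 0, c ! 2) \<in> eqc (adjacent (resolution D s)) \<longleftrightarrow>
      (c ! 0, c ! 2) \<notin> eqc (adjacent (resolution D t))"
    and "eqc (insert (c ! 0, c ! 2) (adjacent (resolution D t))) =
      eqc (insert (c ! 0, c ! 2) (adjacent (resolution D s)))"
proof -
  obtain x0 x1 x2 x3 where cx: "c = [x0, x1, x2, x3]"
    using crossing(2)[OF c] by (rule length_4E)
  have dist: "distinct [x0, x1, x2, x3]" using crossing(3)[OF c] cx by simp
  obtain P0 where P0: "\<forall>v \<in> verts D. \<forall>k < length v. P0 (v ! (Suc k mod length v)) \<longleftrightarrow> \<not> P0 (v ! k)"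
    "\<forall>h g. h \<noteq> g \<and> {h, g} \<in> edges D \<longrightarrow> (P0 g \<longleftrightarrow> \<not> P0 h)"
    using dart_colouring by (elim exE conjE)
  \<comment> \<open>Reversing all colours if necessary makes \<open>x0\<close> false, so that
    \<open>x0\<close> and \<open>x2\<close> are the darts at \<open>c\<close> which the walk leaves
    along an arc.\<close>
  define P where "P h \<longleftrightarrow> P0 h \<noteq> P0 x0" for h
  have Pv: "P (v ! (Suc k mod length v)) \<longleftrightarrow> \<not> P (v ! k)" if "v \<in> verts D" "k < length v" for v k
    using P0(1)[rule_format, OF that] unfolding P_def by argo
  have Pe: "P g \<longleftrightarrow> \<not> P h" if "h \<noteq> g" "{h, g} \<in> edges D" for h g
  proof -
    have "P0 g \<longleftrightarrow> \<not> P0 h" using P0(2)[rule_format, of h g] that by fast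
    then show ?thesis unfolding P_def by argo
  qed
  \<comment> \<open>Both splittings join darts that are neighbours around the vertex, so one
    colouring serves every state.\<close>
  have Pa: "P g \<longleftrightarrow> \<not> P h" if ne: "h \<noteq> g" and ha: "{h, g} \<in> arcs s'" for h g s'
  proof -
    obtain v where v: "v \<in> verts D" "{h, g} \<in> pieces s' v" using ha by (auto simp: arcs_eq)
    have "length v = 2 \<or> length v = 4" by (rule vertex(2)[OF v(1)])
    then show ?thesis
    proof
      assume l: "length v = 2"
      then obtain a b where ab: "v = [a, b]" by (auto simp: eval_nat_numeral length_Suc_conv)
      then have "v \<notin> crossings D" by (simp add: crossings_def)
      then have "h = a \<and> g = b \<or> h = b \<and> g = a"
        using v(2) ab by (auto simp: pieces_def doubleton_eq_iff)
      moreover have "P b \<longleftrightarrow> \<not> P a" using Pv[OF v(1), of 0] ab by simp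
      ultimately show ?thesis by (elim disjE conjE) simp_all
    next
      assume l: "length v = 4"
      obtain a b c' d where ab: "v = [a, b, c', d]" by (rule length_4E[OF l])
      have "v \<in> crossings D" using l v(1) unfolding crossings_def by blast
      then obtain p where p: "p \<in> splitting (s' v) v" "{h, g} = set p"
        using v(2) by (auto simp: pieces_def)
      have Pb: "P b \<longleftrightarrow> \<not> P a" using Pv[OF v(1), of 0] by (simp add: ab)
      have Pc: "P c' \<longleftrightarrow> P a" using Pv[OF v(1), of 1] Pb by (simp add: ab)
      have Pd: "P d \<longleftrightarrow> \<not> P a" using Pv[OF v(1), of 2] Pc by (simp add: ab)
      have "p = [a, b] \<or> p = [c', d] \<or> p = [b, c'] \<or> p = [d, a]"
        using p(1) by (cases "s' v") (auto simp: ab)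
      then have "\<forall>x \<in> set p. \<forall>y \<in> set p. x \<noteq> y \<longrightarrow> (P y \<longleftrightarrow> \<not> P x)"
        by (elim disjE) (simp_all add: Pb Pc Pd)
      moreover have "h \<in> set p" "g \<in> set p" using p(2) by blast+
      ultimately show ?thesis using ne by blast
    qed
  qed
  have p0: "\<not> P x0" by (simp add: P_def)
  have p1: "P x1" using Pv[OF crossing(1)[OF c], of 0] p0 by (simp add: cx)
  have p2: "\<not> P x2" using Pv[OF crossing(1)[OF c], of 1] p1 by (simp add: cx)
  have p3: "P x3" using Pv[OF crossing(1)[OF c], of 2] p2 by (simp add: cx)
  note Px = p0 p1 p2 p3
  have x: "x0 \<in> darts D" "x2 \<in> darts D" "x0 \<noteq> x2"
    using crossing_darts[OF c, of 0] crossing_darts[OF c, of 2] dist cx by auto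
  have pc: "pieces s c \<subseteq> arcs s" "pieces t c \<subseteq> arcs t" using crossing(1)[OF c] by (auto simp: arcs_eq)
  then have in_arcs: "{x0, x1} \<in> arcs s" "{x2, x3} \<in> arcs s" "{x2, x1} \<in> arcs t" "{x0, x3} \<in> arcs t"
    using c s cx by (auto simp: pieces_def t_def insert_commute)
  have "walk P t = swap_images (walk P s) x0 x2"
  proof
    fix h
    consider "P h" | "h = x0" | "h = x2" | "\<not> P h" "h \<noteq> x0" "h \<noteq> x2" by blast
    then show "walk P t h = swap_images (walk P s) x0 x2 h"
    proof cases
      case 4
      \<comment> \<open>The darts \<open>x1\<close> and \<open>x3\<close> satisfy \<open>P\<close>,
        so such an \<open>h\<close> does not belong to \<open>c\<close> and keeps its arc.\<close>
      then have hc: "h \<notin> set c" using Px cx by auto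
      have "partner (arcs t) h = partner (arcs s) h"
      proof (cases "h \<in> darts D")
        case True
        then have "h \<in> \<Union>(arcs s)" using Union_arcs[of s] by simp
        note p = partner_in[OF matching_arcs this]
        obtain v where v: "v \<in> verts D" "{h, partner (arcs s) h} \<in> pieces s v"
          using p(2) by (auto simp: arcs_eq)
        then have "h \<in> set v" using pieces_props(2)[OF v(1), of s] by auto
        then have "v \<noteq> c" using hc by auto
        then have "pieces t v = pieces s v" by (simp add: pieces_def t_def)
        then have "{h, partner (arcs s) h} \<in> arcs t" using v by (auto simp: arcs_eq)
        then show ?thesis using p(1) by (intro partner_eq[OF matching_arcs]) auto
      next
        case False
        then show ?thesis
          using partner_notin[of h "arcs t"] partner_notin[of h "arcs s"] Union_arcs[of s]
              Union_arcs[of t]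
          by simp
      qed
      then show ?thesis using 4 by (simp add: walk_def swap_images_def)
    next
      case 1
      then have "h \<noteq> x0" "h \<noteq> x2" using Px by auto
      then show ?thesis using 1 by (simp add: walk_def swap_images_def)
    next
      case 2
      then show ?thesis
        using Px x(3) partner_eq[OF matching_arcs in_arcs(2)] partner_eq[OF matching_arcs in_arcs(4)] dist
        by (simp add: walk_def swap_images_def)
    next
      case 3
      have "x2 \<noteq> x1" using dist by auto
      with 3 show ?thesis
        using Px x(3) partner_eq[OF matching_arcs in_arcs(1)] partner_eq[OF matching_arcs in_arcs(3)] dist
        by (simp add: walk_def swap_images_def)
    qed
  qed
  note wt = this
  have perm: "walk P s permutes darts D" by (rule walk_permutes[OF Pe Pa])
  have E: "eqc (adjacent (resolution D s')) = eqc (graph_on (walk P s') (darts D))" for s'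
    by (rule eqc_walk[OF Pe Pa])
  have c02: "c ! 0 = x0" "c ! 2 = x2" by (simp_all add: cx)
  show "(c ! 0, c ! 2) \<in> eqc (adjacent (resolution D s)) \<longleftrightarrow>
      (c ! 0, c ! 2) \<notin> eqc (adjacent (resolution D t))"
    unfolding c02 E wt by (rule eqc_swap_images_disj[OF perm finite_darts x])
  have "eqc (insert (x0, x2) (adjacent (resolution D t))) =
      eqc (insert (x0, x2) (graph_on (walk P t) (darts D)))"
    by (rule eqc_insert_cong[OF E])
  also have "\<dots> = eqc (insert (x0, x2) (graph_on (walk P s) (darts D)))"
    unfolding wt by (rule eqc_swap_images_insert[OF x(1,2)])
  also have "\<dots> = eqc (insert (x0, x2) (adjacent (resolution D s)))"
    by (rule eqc_insert_cong[OF E[symmetric]])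
  finally show "eqc (insert (c ! 0, c ! 2) (adjacent (resolution D t))) =
      eqc (insert (c ! 0, c ! 2) (adjacent (resolution D s)))"
    unfolding c02 .
qed

section \<open>Merging two circles\<close>

lemma R_mem_iff: "y \<in> R s x \<longleftrightarrow> R s x = R s y"
  by (simp add: component_eq_iff) (simp add: component_eqc)

lemma circles_eq: "circles D s = R s ` darts D"
  by (simp add: components_def)

text \<open>The circles of \<open>w\<close> are those of \<open>u\<close> with the circles of
  \<open>a\<close> and \<open>b\<close> united. The order of the states is left open: for a merge
  \<open>w\<close> comes after \<open>u\<close> in the cube, for a split before it, and both are
  treated alike.\<close>

definition joins :: "'h state \<Rightarrow> 'h state \<Rightarrow> 'h \<Rightarrow> 'h \<Rightarrow> bool"
  where "joins u w a b \<longleftrightarrow> R u a \<noteq> R u b \<and>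
    (\<forall>x y. R w x = R w y \<longleftrightarrow>
      R u x = R u y \<or> R u x = R u a \<and> R u b = R u y \<or> R u x = R u b \<and> R u a = R u y)"

lemma skein_joins:
  assumes c: "c \<in> crossings D" and s: "s c = MarkA"
  shows "R s (c ! 0) \<noteq> R s (c ! 2) \<Longrightarrow> joins s (s(c := MarkB)) (c ! 0) (c ! 2)"
    and "R s (c ! 0) = R s (c ! 2) \<Longrightarrow> joins (s(c := MarkB)) s (c ! 0) (c ! 2)"
proof -
  note step = skein_step[where s = s, OF c s]
  have *: "joins u w a b"
    if "(a, b) \<notin> eqc (adjacent (resolution D u))" "(a, b) \<in> eqc (adjacent (resolution D w))"
      "eqc (insert (a, b) (adjacent (resolution D w))) = eqc (insert (a, b) (adjacent (resolution D u)))"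
    for u w a b
  proof -
    have "eqc (adjacent (resolution D w)) = eqc (insert (a, b) (adjacent (resolution D u)))"
      using that(3) eqc_insert_absorb[OF that(2)] by simp
    then show ?thesis
      using that(1) unfolding joins_def component_eq_iff by (simp add: eqc_insert_iff)
  qed
  show "R s (c ! 0) \<noteq> R s (c ! 2) \<Longrightarrow> joins s (s(c := MarkB)) (c ! 0) (c ! 2)"
    using step unfolding component_eq_iff by (intro *) simp_all
  show "R s (c ! 0) = R s (c ! 2) \<Longrightarrow> joins (s(c := MarkB)) s (c ! 0) (c ! 2)"
    using step unfolding component_eq_iff by (intro *) simp_all
qed

lemma joins_iff:
  assumes "joins u w a b"
  shows "R w x = R w y \<longleftrightarrow>
    R u x = R u y \<or> R u x = R u a \<and> R u b = R u y \<or> R u x = R u b \<and> R u a = R u y"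
  using assms unfolding joins_def by (elim conjE allE)

lemma joins_finer: "joins u w a b \<Longrightarrow> R u x = R u y \<Longrightarrow> R w x = R w y"
  by (simp add: joins_iff)

lemma joins_eq: "joins u w a b \<Longrightarrow> R w a = R w b"
  by (simp add: joins_iff)

lemma joins_class_iff:
  assumes "joins u w a b"
  shows "R w a = R w y \<longleftrightarrow> R u a = R u y \<or> R u b = R u y"
  unfolding joins_iff[OF assms, of a y] by auto

lemma joins_other_iff:
  assumes "joins u w a b" "R w x \<noteq> R w a"
  shows "R w x = R w y \<longleftrightarrow> R u x = R u y"
proof -
  have "R u a \<noteq> R u x" "R u b \<noteq> R u x"
    using joins_class_iff[OF assms(1), of x] assms(2) by auto
  then show ?thesis unfolding joins_iff[OF assms(1), of x y] by auto
qed

lemma joins_other: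
  assumes "joins u w a b" "R w x \<noteq> R w a"
  shows "R w x = R u x"
  using joins_other_iff[OF assms] by (auto simp: R_mem_iff)

lemma joins_ne: "joins u w a b \<Longrightarrow> R u a \<noteq> R u b"
  unfolding joins_def by (elim conjE)

lemma joins_card:
  assumes J: "joins u w a b" and "a \<in> darts D" "b \<in> darts D"
  shows "card (circles D u) = Suc (card (circles D w))"
  unfolding circles_eq
  by (rule card_image_join[OF finite_darts assms(2,3) joins_ne[OF J] joins_iff[OF J]])

lemma joins_distinct:
  assumes J: "joins u w a b" and d: "distinct (map (R w) M)"
  shows "distinct (map (R u) M)"
proof -
  have "inj_on (R u) (set M)"
  proof (rule inj_onI)
    fix x y assume "x \<in> set M" "y \<in> set M" "R u x = R u y"
    then show "x = y"
      using d joins_finer[OF J, of x y] inj_onD[of "R w" "set M" x y] by (simp add: distinct_map)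
  qed
  then show ?thesis using d by (simp add: distinct_map)
qed

section \<open>Edge maps on monomials\<close>

definition lab :: "'h state \<Rightarrow> 'h list \<Rightarrow> 'h set \<Rightarrow> sign"
  where "lab s M = (\<lambda>C \<in> circles D s. if C \<in> R s ` set M then Wplus else Wminus)"

text \<open>
  The group of the state \<open>s\<close> is the quotient of the polynomial ring over the darts, with all squares
  zero and darts on the same circle identified; \<open>mon s M\<close> is the class of the monomial \<open>M\<close>. In these
  terms every edge map sends the monomial \<open>M\<close> to \<open>M\<close> if it merges two circles, and to
  \<open>(c ! 0 + c ! 2) M\<close> if it splits the circle through \<open>c ! 0\<close> and \<open>c ! 2\<close>.
\<close>

definition mon :: "'h state \<Rightarrow> 'h list \<Rightarrow> 'h generator \<Rightarrow>\<^sub>0 int"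
  where "mon s M = (if distinct (map (R s) M) then frag_of (s, lab s M) else 0)"

lemma lab_apply: "x \<in> darts D \<Longrightarrow> lab s M (R s x) = (if R s x \<in> R s ` set M then Wplus else Wminus)"
  by (simp add: lab_def circles_eq)

lemma lab_eqI:
  assumes "\<And>x. x \<in> darts D \<Longrightarrow> \<epsilon> (R s x) = (if R s x \<in> R s ` set M then Wplus else Wminus)"
  shows "restrict \<epsilon> (circles D s) = lab s M"
proof
  fix C
  show "restrict \<epsilon> (circles D s) C = lab s M C"
  proof (cases "C \<in> circles D s")
    case True
    then obtain x where "x \<in> darts D" "C = R s x" by (auto simp: circles_eq)
    then show ?thesis using assms[of x] True by (simp add: lab_def)
  qed (simp add: lab_def)
qed

lemma mon_perm:
  assumes "mset M = mset N"
  shows "mon s M = mon s N"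
proof -
  have "set M = set N" using assms by (rule mset_eq_setD)
  moreover have "distinct (map (R s) M) = distinct (map (R s) N)"
    using assms by (intro mset_eq_imp_distinct_iff) simp
  ultimately show ?thesis by (simp add: mon_def lab_def)
qed

lemma mon_cong: "map (R s) M = map (R s) N \<Longrightarrow> mon s M = mon s N"
proof -
  assume *: "map (R s) M = map (R s) N"
  then have "R s ` set M = R s ` set N" by (metis list.set_map)
  with * show ?thesis by (simp add: mon_def lab_def)
qed

text \<open>One dart is picked on every circle labelled \<open>Wplus\<close>. Identities between
  edge maps thus have to be checked on monomials only.\<close>

lemma generator_mon:
  assumes "(s, \<epsilon>) \<in> generators D"
  obtains M where "set M \<subseteq> darts D" "distinct (map (R s) M)" "lab s M = \<epsilon>"
proof -
  have \<epsilon>: "\<epsilon> \<in> circles D s \<rightarrow>\<^sub>E UNIV" using assms by (simp add: generators_def)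
  let ?X = "{C \<in> circles D s. \<epsilon> C = Wplus}"
  have "finite ?X" by (simp add: circles_eq)
  then obtain Cs where Cs: "set Cs = ?X" "distinct Cs" using finite_distinct_list by blast
  define M where "M = map (inv_into (darts D) (R s)) Cs"
  have inv: "inv_into (darts D) (R s) C \<in> darts D \<and> R s (inv_into (darts D) (R s) C) = C"
    if "C \<in> ?X" for C
  proof -
    have "C \<in> R s ` darts D" using that by (simp add: circles_eq)
    then show ?thesis by (simp add: f_inv_into_f inv_into_into)
  qed
  have RM: "map (R s) M = Cs"
    unfolding M_def map_map using inv Cs(1) by (intro map_idI) simp
  then have RM': "R s ` set M = ?X" using Cs(1) by (metis list.set_map)
  show thesis
  proof (rule that)
    show "set M \<subseteq> darts D" using inv Cs(1) by (auto simp: M_def)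
    show "distinct (map (R s) M)" using RM Cs(2) by simp
    show "lab s M = \<epsilon>"
    proof
      fix C
      show "lab s M C = \<epsilon> C"
        using \<epsilon> RM' by (cases "\<epsilon> C") (auto simp: lab_def PiE_def extensional_def restrict_def)
    qed
  qed
qed

text \<open>Identifying two variables leaves the monomial as it is. If \<open>M\<close> meets both
  circles it acquires a square, which matches \<open>mbar Wplus Wplus = 0\<close>; otherwise the
  merged circle is met iff one of the two circles was.\<close>

lemma edge_map_merge:
  assumes M: "set M \<subseteq> darts D" and c: "c \<in> crossings D" and s: "s c = MarkA"
    and ne: "R s (c ! 0) \<noteq> R s (c ! 2)"
  shows "frag_extend (edge_map D c) (mon s M) = mon (s(c := MarkB)) M"
proof -
  define t a b where "t = s(c := MarkB)" and "a = c ! 0" and "b = c ! 2"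
  have J: "joins s t a b" unfolding t_def a_def b_def by (rule skein_joins(1)[where s = s, OF c s ne])
  have dab: "a \<in> darts D" "b \<in> darts D"
    using crossing_darts[OF c, of 0] crossing_darts[OF c, of 2] by (simp_all add: a_def b_def)
  show ?thesis
    unfolding t_def[symmetric]
  proof (cases "distinct (map (R s) M)")
    case False
    then have "\<not> distinct (map (R t) M)"
      using joins_distinct[OF J, of M] by blast
    then show "frag_extend (edge_map D c) (mon s M) = mon t M" using False by (simp add: mon_def)
  next
    case True
    have inj: "inj_on (R s) (set M)" and dM: "distinct M" using True by (auto simp: distinct_map)
    let ?pa = "R s a \<in> R s ` set M" and ?pb = "R s b \<in> R s ` set M"
    define w where "w = (if ?pa \<or> ?pb then Wplus else Wminus)"
    have E: "frag_extend (edge_map D c) (mon s M) = (if ?pa \<and> ?pb then 0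
        else frag_of (t, restrict ((lab s M)(R t a := w)) (circles D t)))"
      using True ne dab by (auto simp: mon_def Let_def lab_apply t_def[symmetric] w_def
          simp flip: a_def b_def)
    show "frag_extend (edge_map D c) (mon s M) = mon t M"
    proof (cases "?pa \<and> ?pb")
      case True
      then obtain x y where xy: "x \<in> set M" "R s a = R s x" "y \<in> set M" "R s b = R s y" by auto
      then have "x \<noteq> y" using joins_ne[OF J] by auto
      moreover have "R t x = R t y"
        using xy joins_finer[OF J, of a x] joins_finer[OF J, of b y] joins_eq[OF J] by simp
      ultimately have "\<not> inj_on (R t) (set M)"
        using inj_onD[of "R t" "set M" x y] xy(1,3) by blast
      then have "\<not> distinct (map (R t) M)" by (simp add: distinct_map)
      then show ?thesis using E True by (simp add: mon_def)
    next
      case False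
      have "inj_on (R t) (set M)"
      proof (rule inj_onI)
        fix x y assume xy: "x \<in> set M" "y \<in> set M" "R t x = R t y"
        then have "R s x = R s y \<or> R s x = R s a \<and> R s b = R s y \<or> R s x = R s b \<and> R s a = R s y"
          using joins_iff[OF J, of x y] by blast
        moreover have "\<not> (R s x = R s a \<and> R s b = R s y)" "\<not> (R s x = R s b \<and> R s a = R s y)"
          using False imageI[OF xy(1), of "R s"] imageI[OF xy(2), of "R s"] by (intro notI; simp)+
        ultimately show "x = y" using inj_onD[OF inj _ xy(1,2)] by blast
      qed
      then have "mon t M = frag_of (t, lab t M)" using dM by (simp add: mon_def distinct_map)
      moreover have "restrict ((lab s M)(R t a := w)) (circles D t) = lab t M"
      proof (rule lab_eqI)
        fix x assume x: "x \<in> darts D"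
        show "((lab s M)(R t a := w)) (R t x) = (if R t x \<in> R t ` set M then Wplus else Wminus)"
        proof (cases "R t x = R t a")
          case True
          have "R t a \<in> R t ` set M \<longleftrightarrow> ?pa \<or> ?pb"
            using joins_class_iff[OF J] by (simp add: image_iff bex_disj_distrib)
          then show ?thesis using True by (simp add: w_def)
        next
          case False
          have "R t x \<in> R t ` set M \<longleftrightarrow> R s x \<in> R s ` set M"
            using joins_other_iff[OF J False] by (simp add: image_iff)
          then show ?thesis
            using False joins_other[OF J False] x lab_apply[OF x, of s M] by simp
        qed
      qed
      ultimately show ?thesis using E False by simp
    qed
  qed
qed

text \<open>\<open>Deltabar\<close> multiplies by the sum of the variables of the two new circles.
  On \<open>Wminus\<close> this is the sum itself; on \<open>Wplus\<close> the summand of the circle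
  that already carries the dart of \<open>M\<close> is a square and drops out.\<close>

lemma edge_map_split:
  assumes M: "set M \<subseteq> darts D" and c: "c \<in> crossings D" and s: "s c = MarkA"
    and eq: "R s (c ! 0) = R s (c ! 2)"
  shows "frag_extend (edge_map D c) (mon s M) =
    mon (s(c := MarkB)) (c ! 0 # M) + mon (s(c := MarkB)) (c ! 2 # M)"
proof -
  define t a b where "t = s(c := MarkB)" and "a = c ! 0" and "b = c ! 2"
  have J: "joins t s a b" unfolding t_def a_def b_def by (rule skein_joins(2)[where s = s, OF c s eq])
  have ab: "R t a \<noteq> R t b" by (rule joins_ne[OF J])
  have dab: "a \<in> darts D" "b \<in> darts D"
    using crossing_darts[OF c, of 0] crossing_darts[OF c, of 2] by (simp_all add: a_def b_def)
  show ?thesis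
    unfolding t_def[symmetric] a_def[symmetric] b_def[symmetric]
  proof (cases "distinct (map (R s) M)")
    case False
    \<comment> \<open>Two darts of \<open>M\<close> on one circle of \<open>s\<close> may be
      separated in \<open>t\<close>, but then they lie on the circles of \<open>a\<close> and of
      \<open>b\<close>, and the additional dart \<open>e\<close> repeats one of them.\<close>
    have *: "distinct (map (R s) M)" if d: "distinct (map (R t) (e # M))" and e: "e = a \<or> e = b" for e
    proof -
      have "inj_on (R s) (set M)"
      proof (rule inj_onI)
        fix x y assume xy: "x \<in> set M" "y \<in> set M" "R s x = R s y"
        then have "R t x = R t y \<or> R t x = R t a \<and> R t b = R t y \<or> R t x = R t b \<and> R t a = R t y"
          using joins_iff[OF J, of x y] by blast
        moreover have "R t e \<noteq> R t x" "R t e \<noteq> R t y" using d xy(1,2) by auto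
        ultimately have "R t x = R t y" using e by auto
        then show "x = y" using d xy(1,2) inj_onD[of "R t" "set M" x y] by (simp add: distinct_map)
      qed
      then show ?thesis using d by (simp add: distinct_map)
    qed
    have "mon t (a # M) = 0" "mon t (b # M) = 0"
      using *[of a] *[of b] False unfolding mon_def by auto
    then show "frag_extend (edge_map D c) (mon s M) = mon t (a # M) + mon t (b # M)"
      using False by (simp add: mon_def)
  next
    case True
    have inj: "inj_on (R s) (set M)" and dM: "distinct M" using True by (auto simp: distinct_map)
    have inj_t: "inj_on (R t) (set M)"
    proof (rule inj_onI)
      fix x y assume "x \<in> set M" "y \<in> set M" "R t x = R t y"
      then show "x = y" using joins_finer[OF J, of x y] inj_onD[OF inj, of x y] by simp
    qed
    let ?pa = "R s a \<in> R s ` set M"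
    let ?g = "\<lambda>w w'. frag_of (t, restrict ((lab s M)(R t a := w, R t b := w')) (circles D t))"
    have E: "frag_extend (edge_map D c) (mon s M) = (if ?pa then ?g Wplus Wplus
        else ?g Wplus Wminus + ?g Wminus Wplus)"
      using True eq dab by (auto simp: mon_def Let_def lab_apply t_def[symmetric] frag_extend_add
          simp flip: a_def b_def)
    have G: "?g (if R t a \<in> R t ` set N then Wplus else Wminus) (if R t b \<in> R t ` set N then Wplus
        else Wminus)
        = frag_of (t, lab t N)" if N: "N = a # M \<or> N = b # M" for N
    proof -
      have "restrict ((lab s M)(R t a := if R t a \<in> R t ` set N then Wplus else Wminus,
          R t b := if R t b \<in> R t ` set N then Wplus else Wminus)) (circles D t) = lab t N"
      proof (rule lab_eqI)
        fix x assume x: "x \<in> darts D"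
        show "((lab s M)(R t a := if R t a \<in> R t ` set N then Wplus else Wminus,
            R t b := if R t b \<in> R t ` set N then Wplus else Wminus)) (R t x) =
          (if R t x \<in> R t ` set N then Wplus else Wminus)"
        proof (cases "R t x = R t a \<or> R t x = R t b")
          case True
          then show ?thesis using ab by auto
        next
          case False
          then have "\<not> (R t a = R t x \<or> R t b = R t x)" by auto
          then have "R s a \<noteq> R s x" using joins_class_iff[OF J, of x] by simp
          then have ne: "R s x \<noteq> R s a" by (rule not_sym)
          have "R t x \<in> R t ` set N \<longleftrightarrow> R t x \<in> R t ` set M" using N False by (elim disjE) simp_all
          also have "\<dots> \<longleftrightarrow> R s x \<in> R s ` set M"
            using joins_other_iff[OF J ne] by (simp add: image_iff)
          finally show ?thesis
            using False joins_other[OF J ne] lab_apply[OF x, of s M] by simp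
        qed
      qed
      then show ?thesis by simp
    qed
    show "frag_extend (edge_map D c) (mon s M) = mon t (a # M) + mon t (b # M)"
    proof (cases ?pa)
      case True
      then obtain m where m: "m \<in> set M" "R s a = R s m" by auto
      then have "R t a = R t m \<or> R t b = R t m" using joins_class_iff[OF J] by simp
      \<comment> \<open>Here \<open>e\<close> is the one of \<open>a\<close> and \<open>b\<close>
        whose circle in \<open>t\<close> already carries the dart \<open>m\<close>, and
        \<open>f\<close> is the other one.\<close>
      moreover have *: "mon t (e # M) = 0 \<and> mon t (f # M) = ?g Wplus Wplus"
        if em: "R t e = R t m" and ef: "e = a \<and> f = b \<or> e = b \<and> f = a" for e f
      proof
        show "mon t (e # M) = 0" using em m(1) by (auto simp: mon_def)
        have "R t f \<notin> R t ` set M"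
        proof
          assume "R t f \<in> R t ` set M"
          then obtain m' where m': "m' \<in> set M" "R t f = R t m'" by auto
          then have "R s m' = R s a" using joins_class_iff[OF J, of m'] ef by auto
          then have "m' = m" using inj_onD[OF inj, of m' m] m m'(1) by simp
          then show False using em ef m'(2) ab by auto
        qed
        then have "mon t (f # M) = frag_of (t, lab t (f # M))"
          using dM inj_t by (simp add: mon_def distinct_map)
        moreover have "R t a \<in> R t ` set (f # M)" "R t b \<in> R t ` set (f # M)"
          using ef em m(1) by auto
        ultimately show "mon t (f # M) = ?g Wplus Wplus"
          using G[of "f # M"] ef by (simp only: if_True) auto
      qed
      ultimately have "mon t (a # M) + mon t (b # M) = ?g Wplus Wplus"
        using *[of a b] *[of b a] by auto
      then show ?thesis using E True by simp
    next
      case False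
      then have no: "R t a \<notin> R t ` set M" "R t b \<notin> R t ` set M"
        using joins_class_iff[OF J] by (auto simp: image_iff)
      have "mon t (a # M) = frag_of (t, lab t (a # M))" "mon t (b # M) = frag_of (t, lab t (b # M))"
        using no dM inj_t by (simp_all add: mon_def distinct_map)
      moreover have "?g Wplus Wminus = frag_of (t, lab t (a # M))"
        using G[of "a # M"] no ab by simp
      moreover have "?g Wminus Wplus = frag_of (t, lab t (b # M))"
        using G[of "b # M"] no ab by simp
      ultimately show ?thesis using E False by simp
    qed
  qed
qed

lemma edge_map_mon:
  assumes "set M \<subseteq> darts D" "c \<in> crossings D" "s c = MarkA"
  shows "frag_extend (edge_map D c) (mon s M) =
    (if R s (c ! 0) = R s (c ! 2)
     then mon (s(c := MarkB)) (c ! 0 # M) + mon (s(c := MarkB)) (c ! 2 # M)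
     else mon (s(c := MarkB)) M)"
  using edge_map_merge[where s = s, OF assms] edge_map_split[where s = s, OF assms] by simp

end

section \<open>The differential squares to zero\<close>

lemma frag_extend_frag_extend:
  "frag_extend f (frag_extend g c) = frag_extend (\<lambda>x. frag_extend f (g x)) c"
  using subset_UNIV by (induction c rule: frag_induction) (simp_all add: frag_extend_diff)

lemma frag_extend_commute:
  assumes "\<And>x. x \<in> Poly_Mapping.keys c \<Longrightarrow> frag_extend f (g x) = frag_extend f' (g' x)"
  shows "frag_extend f (frag_extend g c) = frag_extend f' (frag_extend g' c)"
  unfolding frag_extend_frag_extend by (rule frag_extend_eq) (rule assms)

text \<open>Free abelian groups have no 2-torsion. This turns the antisymmetry of a double sum over
  pairs of crossings into its vanishing.\<close>

lemma frag_eq_minus_self: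
  fixes x :: "'a \<Rightarrow>\<^sub>0 int"
  assumes "x = - x"
  shows "x = 0"
proof (rule poly_mapping_eqI)
  fix k
  have "Poly_Mapping.lookup x k = Poly_Mapping.lookup (- x) k" using assms by (rule arg_cong)
  also have "\<dots> = - Poly_Mapping.lookup x k" by (rule lookup_uminus)
  finally show "Poly_Mapping.lookup x k = Poly_Mapping.lookup 0 k" by simp
qed

section \<open>Edge signs\<close>

definition precedes :: "'a list \<Rightarrow> 'a \<Rightarrow> 'a \<Rightarrow> bool"
  where "precedes cs x c \<longleftrightarrow> x \<in> set (takeWhile (\<lambda>y. y \<noteq> c) cs)"

lemma precedes_in: "precedes cs x c \<Longrightarrow> x \<in> set cs"
  unfolding precedes_def by (rule set_takeWhileD[THEN conjunct1])

lemma precedes_irrefl: "\<not> precedes cs c c"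
  unfolding precedes_def using set_takeWhileD by fastforce

lemma precedes_total:
  "distinct cs \<Longrightarrow> x \<in> set cs \<Longrightarrow> y \<in> set cs \<Longrightarrow> x \<noteq> y \<Longrightarrow> precedes cs x y \<longleftrightarrow> \<not> precedes cs y x"
  unfolding precedes_def
proof (induction cs)
  case (Cons a cs)
  then show ?case
    using set_takeWhileD[of _ _ cs] by (cases "a = x"; cases "a = y") auto
qed simp

lemma edge_sign_card:
  assumes "distinct cs"
  shows "edge_sign cs c s = (-1) ^ card {x. precedes cs x c \<and> s x = MarkB}"
proof -
  have "{x. precedes cs x c \<and> s x = MarkB} =
      {x. s x = MarkB} \<inter> set (takeWhile (\<lambda>c'. c' \<noteq> c) cs)"
    by (auto simp: precedes_def)
  then show ?thesis
    by (simp add: edge_sign_def distinct_length_filter distinct_takeWhile[OF assms])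
qed

lemma finite_precedes [simp]: "finite {x. precedes cs x c \<and> P x}"
  by (simp add: precedes_def)

lemma edge_sign_upd:
  assumes "distinct cs" "s c \<noteq> MarkB"
  shows "edge_sign cs x (s(c := MarkB)) = (if precedes cs c x then - edge_sign cs x s else edge_sign
      cs x s)"
proof (cases "precedes cs c x")
  case True
  then have "{y. precedes cs y x \<and> (s(c := MarkB)) y = MarkB} =
      insert c {y. precedes cs y x \<and> s y = MarkB}" by auto
  moreover have "card (insert c {y. precedes cs y x \<and> s y = MarkB}) =
      Suc (card {y. precedes cs y x \<and> s y = MarkB})"
    by (rule card_insert_disjoint) (use assms(2) in simp_all)
  ultimately show ?thesis using True by (simp add: edge_sign_card[OF assms(1)])
next
  case False
  then have "{y. precedes cs y x \<and> (s(c := MarkB)) y = MarkB} = {y. precedes cs y x \<and> s y = MarkB}"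
    by auto
  then show ?thesis using False by (simp add: edge_sign_card[OF assms(1)])
qed

lemma num_upd:
  assumes "finite (crossings D)" "c \<in> crossings D" "s c = MarkA"
  shows "num_B D (s(c := MarkB)) = Suc (num_B D s)" "num_A D s = Suc (num_A D (s(c := MarkB)))"
proof -
  have "{c' \<in> crossings D. (s(c := MarkB)) c' = MarkB} = insert c {c' \<in> crossings D. s c' = MarkB}"
    using assms by auto
  moreover have "card (insert c {c' \<in> crossings D. s c' = MarkB})
      = Suc (card {c' \<in> crossings D. s c' = MarkB})"
    by (rule card_insert_disjoint) (use assms in simp_all)
  ultimately show "num_B D (s(c := MarkB)) = Suc (num_B D s)" by (simp add: num_B_def)
  have "{c' \<in> crossings D. s c' = MarkA} = insert c {c' \<in> crossings D. (s(c := MarkB)) c' = MarkA}"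
    using assms by auto
  moreover have "card (insert c {c' \<in> crossings D. (s(c := MarkB)) c' = MarkA}) =
      Suc (card {c' \<in> crossings D. (s(c := MarkB)) c' = MarkA})"
    by (rule card_insert_disjoint) (use assms in simp_all)
  ultimately show "num_A D s = Suc (num_A D (s(c := MarkB)))" by (simp add: num_A_def)
qed

definition gens :: "'h diagram \<Rightarrow> nat \<Rightarrow> int \<Rightarrow> 'h generator set"
  where "gens D i j = {(s, \<epsilon>) \<in> generators D.
    (num_B D s + card (circles D (all_A D))) mod 2 = i \<and> gdeg D (s, \<epsilon>) = j}"

lemma bracket_group_gens: "bracket_group D i j = free_Abelian_group (gens D i j)"
  by (simp add: bracket_group_def gens_def)

lemma states_upd: "s \<in> states D \<Longrightarrow> c \<in> crossings D \<Longrightarrow> s(c := m) \<in> states D"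
  unfolding states_def by (auto simp: PiE_def extensional_def)

context diagram
begin

lemma finite_crossings [simp]: "finite (crossings D)"
proof (rule finite_subset)
  show "crossings D \<subseteq> {v. set v \<subseteq> darts D \<and> length v = 4}"
  proof
    fix c assume "c \<in> crossings D"
    then show "c \<in> {v. set v \<subseteq> darts D \<and> length v = 4}"
      using crossing(1,2)[of c] vertex(3)[of c] by simp
  qed
qed (simp add: finite_lists_length_eq)

text \<open>Each split multiplies by a sum of two darts and each merge by 1. Both paths begin and
  end with the same numbers of circles, hence contain equally many splits. If these happen at the
  same crossings, the products agree up to the order of factors. Otherwise each path has exactly one
  split, at different crossings, and the two sums have to be compared on the circles of
  \<open>s3\<close>.\<close>

lemma edge_map_square:
  assumes M: "set M \<subseteq> darts D"
    and c: "c \<in> crossings D" "s c = MarkA" and c': "c' \<in> crossings D" "s c' = MarkA" and ne: "c \<noteq> c'"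
  shows "frag_extend (edge_map D c') (frag_extend (edge_map D c) (mon s M)) =
    frag_extend (edge_map D c) (frag_extend (edge_map D c') (mon s M))"
proof -
  define a b a' b' where "a = c ! 0" and "b = c ! 2" and "a' = c' ! 0" and "b' = c' ! 2"
  define s1 s2 s3 where "s1 = s(c := MarkB)" and "s2 = s(c' := MarkB)" and "s3 = s1(c' := MarkB)"
  note abd = a_def[symmetric] b_def[symmetric] a'_def[symmetric] b'_def[symmetric]
  have s3: "s2(c := MarkB) = s3" using ne by (simp add: s1_def s2_def s3_def fun_upd_twist)
  have s1A: "s1 c' = MarkA" and s2A: "s2 c = MarkA" using ne c c' by (simp_all add: s1_def s2_def)
  have d: "a \<in> darts D" "b \<in> darts D" "a' \<in> darts D" "b' \<in> darts D"
    using crossing_darts[OF c(1), of 0] crossing_darts[OF c(1), of 2]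
      crossing_darts[OF c'(1), of 0] crossing_darts[OF c'(1), of 2]
    by (simp_all add: a_def b_def a'_def b'_def)
  have J01: "R s a \<noteq> R s b \<Longrightarrow> joins s s1 a b" "R s a = R s b \<Longrightarrow> joins s1 s a b"
    using skein_joins[where s = s, OF c] unfolding abd s1_def by blast+
  have J02: "R s a' \<noteq> R s b' \<Longrightarrow> joins s s2 a' b'" "R s a' = R s b' \<Longrightarrow> joins s2 s a' b'"
    using skein_joins[where s = s, OF c'] unfolding abd s2_def by blast+
  have J13: "R s1 a' \<noteq> R s1 b' \<Longrightarrow> joins s1 s3 a' b'" "R s1 a' = R s1 b' \<Longrightarrow> joins s3 s1 a' b'"
    using skein_joins[where s = s1, OF c'(1) s1A] unfolding abd s3_def by blast+
  have J23: "R s2 a \<noteq> R s2 b \<Longrightarrow> joins s2 s3 a b" "R s2 a = R s2 b \<Longrightarrow> joins s3 s2 a b"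
    using skein_joins[where s = s2, OF c(1) s2A] unfolding abd s3 by blast+
  define n0 n1 n2 n3 where "n0 = card (circles D s)" and "n1 = card (circles D s1)"
    and "n2 = card (circles D s2)" and "n3 = card (circles D s3)"
  let ?p = "R s a = R s b" and ?q = "R s a' = R s b'" and ?q1 = "R s1 a' = R s1 b'" and ?p2
      = "R s2 a = R s2 b"
  \<comment> \<open>Every edge of the cube changes the number of circles by exactly one, upwards
    precisely when it splits. Comparing the two routes to \<open>s3\<close> gives
    \<open>bal\<close>, which leaves six of the sixteen patterns.\<close>
  have "int n1 = int n0 + 2 * (if ?p then 1 else 0) - 1"
    unfolding n0_def n1_def using joins_card[OF J01(1) d(1,2)] joins_card[OF J01(2) d(1,2)]
    by (cases ?p) simp_all
  moreover have "int n2 = int n0 + 2 * (if ?q then 1 else 0) - 1"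
    unfolding n0_def n2_def using joins_card[OF J02(1) d(3,4)] joins_card[OF J02(2) d(3,4)]
    by (cases ?q) simp_all
  moreover have "int n3 = int n1 + 2 * (if ?q1 then 1 else 0) - 1"
    unfolding n1_def n3_def using joins_card[OF J13(1) d(3,4)] joins_card[OF J13(2) d(3,4)]
    by (cases ?q1) simp_all
  moreover have "int n3 = int n2 + 2 * (if ?p2 then 1 else 0) - 1"
    unfolding n2_def n3_def using joins_card[OF J23(1) d(1,2)] joins_card[OF J23(2) d(1,2)]
    by (cases ?p2) simp_all
  ultimately have bal: "(if ?p then 1 else 0) + (if ?q1 then 1 else 0) =
      (if ?q then 1 else 0) + (if ?p2 then 1 else (0 :: int))"
    by linarith
  have L: "frag_extend (edge_map D c') (frag_extend (edge_map D c) (mon s M)) =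
    (if ?p then if ?q1 then mon s3 (a' # a # M) + mon s3 (b' # a # M) + (mon s3 (a' # b # M) + mon
        s3 (b' # b # M))
        else mon s3 (a # M) + mon s3 (b # M)
      else if ?q1 then mon s3 (a' # M) + mon s3 (b' # M) else mon s3 M)"
    using edge_map_mon[where s = s, OF M c] edge_map_mon[where s = s1 and M = M, OF _ c'(1) s1A]
      edge_map_mon[where s = s1 and M = "a # M", OF _ c'(1) s1A]
      edge_map_mon[where s = s1 and M = "b # M", OF _ c'(1) s1A] M d
    unfolding abd s1_def[symmetric] s3_def[symmetric] by (simp add: frag_extend_add)
  have L': "frag_extend (edge_map D c) (frag_extend (edge_map D c') (mon s M)) =
    (if ?q then if ?p2 then mon s3 (a # a' # M) + mon s3 (b # a' # M) + (mon s3 (a # b' # M) + mon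
        s3 (b # b' # M))
        else mon s3 (a' # M) + mon s3 (b' # M)
      else if ?p2 then mon s3 (a # M) + mon s3 (b # M) else mon s3 M)"
    using edge_map_mon[where s = s, OF M c'] edge_map_mon[where s = s2 and M = M, OF _ c(1) s2A]
      edge_map_mon[where s = s2 and M = "a' # M", OF _ c(1) s2A]
      edge_map_mon[where s = s2 and M = "b' # M", OF _ c(1) s2A] M d
    unfolding abd s2_def[symmetric] s3 by (simp add: frag_extend_add)
  have swap: "mon s3 (x # y # M) = mon s3 (y # x # M)" for x y
    by (rule mon_perm) simp
  have same: "mon s3 (x # M) = mon s3 (y # M)" if "R s3 x = R s3 y" for x y
    by (rule mon_cong) (simp add: that)
  consider (four) "?p" "?q" "?q1" "?p2" | (none) "\<not> ?p" "\<not> ?q" "\<not> ?q1" "\<not> ?p2"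
    | (first) "?p" "\<not> ?q1" "\<not> ?q" "?p2" | (second) "\<not> ?p" "?q1" "?q" "\<not> ?p2"
    | (double) "?p" "\<not> ?q1" "?q" "\<not> ?p2" | (pair) "\<not> ?p" "?q1" "\<not> ?q" "?p2"
    using bal by (auto split: if_splits)
  then show ?thesis
  proof cases
    case four
    then show ?thesis
      unfolding L L' by (simp add: swap[of a a'] swap[of a b'] swap[of b a'] swap[of b b'] add_ac)
  next
    case double
    text \<open>Here \<open>c\<close> and \<open>c'\<close> interleave on a single circle, and both composites are \<open>2 a M\<close>.\<close>
    have "R s1 a' = R s1 a \<and> R s1 b = R s1 b' \<or> R s1 a' = R s1 b \<and> R s1 a = R s1 b'"
      using joins_iff[OF J01(2)[OF double(1)], of a' b'] double by blast
    then have "R s3 a' = R s3 a \<and> R s3 b = R s3 b' \<or> R s3 a' = R s3 b \<and> R s3 a = R s3 b'"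
      using joins_finer[OF J13(1)[OF double(2)], of a' a] joins_finer[OF J13(1)[OF double(2)], of b b']
        joins_finer[OF J13(1)[OF double(2)], of a' b] joins_finer[OF J13(1)[OF double(2)], of a b']
      by blast
    moreover have "R s3 a' = R s3 b'" by (rule joins_eq[OF J13(1)[OF double(2)]])
    ultimately have "R s3 a = R s3 a'" "R s3 b = R s3 b'" by auto
    then show ?thesis using double unfolding L L' by (simp add: same[of a a'] same[of b b'])
  next
    case pair
    text \<open>Here \<open>c\<close> and \<open>c'\<close> both join the same two circles, before and after.\<close>
    have "R s3 a \<noteq> R s3 b" by (rule joins_ne[OF J23(2)[OF pair(4)]])
    moreover have "R s1 a = R s1 b" by (rule joins_eq[OF J01(1)[OF pair(1)]])
    ultimately have "R s3 a = R s3 a' \<and> R s3 b' = R s3 b \<or> R s3 a = R s3 b' \<and> R s3 a' = R s3 b"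
      using joins_iff[OF J13(2)[OF pair(2)], of a b] by blast
    then show ?thesis
    proof
      assume "R s3 a = R s3 a' \<and> R s3 b' = R s3 b"
      then show ?thesis using pair unfolding L L' by (simp add: same[of a a'] same[of b' b])
    next
      assume "R s3 a = R s3 b' \<and> R s3 a' = R s3 b"
      then show ?thesis using pair unfolding L L' by (simp add: same[of a b'] same[of a' b])
    qed
  qed (simp_all add: L L')
qed

lemma boundary_mon:
  "bracket_boundary D cs (mon s M) =
    (\<Sum>c \<in> {c \<in> crossings D. s c = MarkA}. frag_cmul (edge_sign cs c s) (frag_extend (edge_map D c)
        (mon s M)))"
  unfolding bracket_boundary_def by (cases "distinct (map (R s) M)") (simp_all add: mon_def)

lemma boundary_edge_mon:
  assumes "set M \<subseteq> darts D" "c \<in> crossings D" "s c = MarkA"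
  shows "bracket_boundary D cs (frag_extend (edge_map D c) (mon s M)) =
    (\<Sum>c' \<in> {c' \<in> crossings D. s c' = MarkA} - {c}. frag_cmul (edge_sign cs c' (s(c := MarkB)))
      (frag_extend (edge_map D c') (frag_extend (edge_map D c) (mon s M))))"
proof -
  have "{c' \<in> crossings D. (s(c := MarkB)) c' = MarkA} = {c' \<in> crossings D. s c' = MarkA} - {c}"
    by auto
  then have 1: "bracket_boundary D cs (mon (s(c := MarkB)) N) =
    (\<Sum>c' \<in> {c' \<in> crossings D. s c' = MarkA} - {c}. frag_cmul (edge_sign cs c' (s(c := MarkB)))
      (frag_extend (edge_map D c') (mon (s(c := MarkB)) N)))" for N
    unfolding boundary_mon by simp
  have add: "bracket_boundary D cs (x + y) = bracket_boundary D cs x + bracket_boundary D cs y" for x y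
    by (simp add: bracket_boundary_def frag_extend_add)
  show ?thesis
    unfolding edge_map_mon[where s = s, OF assms]
    by (simp add: add 1 frag_extend_add frag_cmul_distrib2 sum.distrib del: fun_upd_apply)
qed

lemma boundary_boundary_mon:
  assumes M: "set M \<subseteq> darts D" and cs: "crossing_order D cs"
  shows "bracket_boundary D cs (bracket_boundary D cs (mon s M)) = 0"
proof -
  let ?A = "{c \<in> crossings D. s c = MarkA}"
  \<comment> \<open>The value 0 on the diagonal lets both indices run over the same set, so that the
    double sum can be compared with its own transpose.\<close>
  define g where "g c c' = (if c' = c then 0 else frag_cmul (edge_sign cs c s * edge_sign cs c' (s(c
      := MarkB)))
      (frag_extend (edge_map D c') (frag_extend (edge_map D c) (mon s M))))" for c c'
  have dcs: "distinct cs" "set cs = crossings D" using cs by (auto simp: crossing_order_def)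
  have "bracket_boundary D cs (bracket_boundary D cs (mon s M)) = (\<Sum>c \<in> ?A. frag_cmul (edge_sign cs c s)
      (bracket_boundary D cs (frag_extend (edge_map D c) (mon s M))))"
    unfolding boundary_mon[of cs s M]
    by (simp add: bracket_boundary_def frag_extend_sum frag_extend_cmul o_def)
  also have "\<dots> = (\<Sum>c \<in> ?A. \<Sum>c' \<in> ?A. g c c')"
  proof (rule sum.cong[OF refl])
    fix c assume c: "c \<in> ?A"
    have "frag_cmul (edge_sign cs c s) (bracket_boundary D cs (frag_extend (edge_map D c) (mon s M))) =
        (\<Sum>c' \<in> ?A - {c}. g c c')"
      using c by (subst boundary_edge_mon[OF M]) (auto simp: frag_cmul_sum g_def intro!: sum.cong)
    also have "\<dots> = (\<Sum>c' \<in> ?A. g c c')"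
      by (rule sum.mono_neutral_left) (auto simp: g_def)
    finally show "frag_cmul (edge_sign cs c s) (bracket_boundary D cs (frag_extend (edge_map D c)
        (mon s M))) =
        (\<Sum>c' \<in> ?A. g c c')" .
  qed
  finally have S: "bracket_boundary D cs (bracket_boundary D cs (mon s M))
      = (\<Sum>c \<in> ?A. \<Sum>c' \<in> ?A. g c c')" .
  have anti: "g c c' = - g c' c" if "c \<in> ?A" "c' \<in> ?A" for c c'
  proof (cases "c = c'")
    case False
    have cc: "c \<in> set cs" "c' \<in> set cs" using that dcs by auto
    \<comment> \<open>Of the two crossings exactly one precedes the other. Switching that one first
      reverses the sign of the second edge; switching in the other order reverses nothing.\<close>
    have sg: "edge_sign cs c s * edge_sign cs c' (s(c := MarkB)) =
        - (edge_sign cs c' s * edge_sign cs c (s(c' := MarkB)))"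
      using precedes_total[OF dcs(1) cc False] that
        edge_sign_upd[OF dcs(1), of s c c'] edge_sign_upd[OF dcs(1), of s c' c]
      by (simp split: if_splits)
    have "frag_extend (edge_map D c') (frag_extend (edge_map D c) (mon s M)) =
        frag_extend (edge_map D c) (frag_extend (edge_map D c') (mon s M))"
      by (rule edge_map_square[OF M]) (use that False in simp_all)
    then show ?thesis using False by (simp only: g_def sg if_False minus_frag_cmul not_sym[OF False])
  qed (simp add: g_def)
  have "(\<Sum>c \<in> ?A. \<Sum>c' \<in> ?A. g c c') = (\<Sum>c \<in> ?A. \<Sum>c' \<in> ?A. - g c' c)"
    by (intro sum.cong refl anti)
  also have "\<dots> = - (\<Sum>c' \<in> ?A. \<Sum>c \<in> ?A. g c' c)"
    by (subst sum.swap) (simp add: sum_negf)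
  finally show ?thesis unfolding S by (rule frag_eq_minus_self)
qed

lemma boundary_boundary:
  assumes "crossing_order D cs" "Poly_Mapping.keys x \<subseteq> generators D"
  shows "bracket_boundary D cs (bracket_boundary D cs x) = 0"
  using assms(2)
proof (induction x rule: frag_induction)
  case (one g)
  obtain s \<epsilon> where g: "g = (s, \<epsilon>)" by (cases g)
  obtain M where M: "set M \<subseteq> darts D" "distinct (map (R s) M)" "lab s M = \<epsilon>"
    using generator_mon[of s \<epsilon>] one g by auto
  then have "frag_of g = mon s M" by (simp add: mon_def g)
  then show ?case using boundary_boundary_mon[OF M(1) assms(1)] by simp
qed (simp_all add: bracket_boundary_def frag_extend_diff)

section \<open>Degree and parity of the differential\<close>

lemma gdeg_lab:
  assumes M: "set M \<subseteq> darts D" "distinct (map (R s) M)"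
  shows "gdeg D (s, lab s M) = 4 * int (length M) - 2 * int (card (circles D s))
    + (int (num_A D s) - int (num_B D s))"
proof -
  let ?X = "R s ` set M"
  have X: "?X \<subseteq> circles D s" using M(1) by (auto simp: circles_eq)
  have fin: "finite (circles D s)" by (simp add: circles_eq)
  \<comment> \<open>\<open>wdeg\<close> is 4 - 2 on \<open>Wplus\<close> and 0 - 2 on
    \<open>Wminus\<close>, so that each dart of \<open>M\<close> counts 4 and every circle
    -2.\<close>
  have "(\<Sum>C \<in> circles D s. wdeg (lab s M C)) = (\<Sum>C \<in> circles D s. (if C \<in> ?X then 4 else 0) - 2)"
    by (rule sum.cong) (simp_all add: lab_def)
  also have "\<dots> = (\<Sum>C \<in> circles D s. if C \<in> ?X then 4 else 0) - 2 * int (card (circles D s))"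
    by (simp add: sum_subtractf)
  also have "(\<Sum>C \<in> circles D s. if C \<in> ?X then 4 else 0) = (4 :: int) * int (card ?X)"
    using fin X by (simp add: sum.If_cases Int_absorb1)
  also have "card ?X = length M"
    using M(2) distinct_card[OF M(2)] by simp
  finally show ?thesis by simp
qed

lemma keys_mon:
  assumes "k \<in> Poly_Mapping.keys (mon s M)" "set M \<subseteq> darts D" "s \<in> states D"
  shows "k \<in> generators D \<and> fst k = s \<and> gdeg D k = 4 * int (length M) - 2 * int (card (circles D s))
    + (int (num_A D s) - int (num_B D s))"
proof -
  have d: "distinct (map (R s) M)" and k: "k = (s, lab s M)"
    using assms(1) by (auto simp: mon_def split: if_splits)
  have "lab s M \<in> circles D s \<rightarrow>\<^sub>E UNIV" by (simp add: lab_def)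
  then show ?thesis
    using gdeg_lab[OF assms(2) d] assms(3) by (simp add: k generators_def)
qed

text \<open>The degree shift drops by 2 when a mark turns from A to B. A merge has one circle less,
  which is worth +2; a split has one circle more, worth -2, and one more dart in the monomial, worth
  +4.\<close>

lemma keys_edge_map:
  assumes g: "(s, \<epsilon>) \<in> generators D" and c: "c \<in> crossings D" "s c = MarkA"
    and k: "k \<in> Poly_Mapping.keys (edge_map D c (s, \<epsilon>))"
  shows "k \<in> generators D \<and> fst k = s(c := MarkB) \<and> gdeg D k = gdeg D (s, \<epsilon>)"
proof -
  obtain M where M: "set M \<subseteq> darts D" "distinct (map (R s) M)" "lab s M = \<epsilon>"
    using generator_mon[OF g] by auto
  have s: "s \<in> states D" using g by (simp add: generators_def)
  define t where "t = s(c := MarkB)"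
  have t: "t \<in> states D" using states_upd[OF s c(1)] by (simp add: t_def)
  have d: "c ! 0 \<in> darts D" "c ! 2 \<in> darts D"
    using crossing_darts[OF c(1), of 0] crossing_darts[OF c(1), of 2] by simp_all
  have "edge_map D c (s, \<epsilon>) = frag_extend (edge_map D c) (mon s M)"
    using M by (simp add: mon_def)
  then have e: "edge_map D c (s, \<epsilon>) = (if R s (c ! 0) = R s (c ! 2)
      then mon t (c ! 0 # M) + mon t (c ! 2 # M) else mon t M)"
    using edge_map_mon[where s = s, OF M(1) c] by (simp add: t_def)
  note deg = gdeg_lab[OF M(1,2)] num_upd[OF finite_crossings c(1), of s, OF c(2)]
  show ?thesis
  proof (cases "R s (c ! 0) = R s (c ! 2)")
    case True
    have "card (circles D t) = Suc (card (circles D s))"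
      using joins_card[OF skein_joins(2)[where s = s, OF c True] d] by (simp add: t_def)
    moreover have "k \<in> Poly_Mapping.keys (mon t (c ! 0 # M)) \<union> Poly_Mapping.keys (mon t (c ! 2 # M))"
      using k e True keys_add[of "mon t (c ! 0 # M)" "mon t (c ! 2 # M)"] by auto
    then obtain x where x: "x \<in> darts D" "k \<in> Poly_Mapping.keys (mon t (x # M))"
      using d by blast
    moreover have "set (x # M) \<subseteq> darts D" using M(1) x(1) by simp
    ultimately show ?thesis
      using keys_mon[of k t "x # M"] M(3) t deg by (simp add: t_def[symmetric] del: gdeg.simps)
  next
    case False
    have "card (circles D s) = Suc (card (circles D t))"
      using joins_card[OF skein_joins(1)[where s = s, OF c False] d] by (simp add: t_def)
    then show ?thesis
      using keys_mon[of k t M] k e False M t deg by (simp add: t_def[symmetric] del: gdeg.simps)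
  qed
qed

lemma keys_boundary:
  assumes x: "Poly_Mapping.keys x \<subseteq> gens D i j" and i: "i < 2"
  shows "Poly_Mapping.keys (bracket_boundary D cs x) \<subseteq> gens D (1 - i) j"
proof
  fix k assume "k \<in> Poly_Mapping.keys (bracket_boundary D cs x)"
  then obtain g where g: "g \<in> Poly_Mapping.keys x" "k \<in> Poly_Mapping.keys (generator_boundary D cs g)"
    using keys_frag_extend unfolding bracket_boundary_def by fast
  obtain s \<epsilon> where se: "g = (s, \<epsilon>)" by (cases g)
  have "k \<in> (\<Union>c \<in> {c \<in> crossings D. s c = MarkA}.
      Poly_Mapping.keys (frag_cmul (edge_sign cs c s) (edge_map D c (s, \<epsilon>))))"
    using g(2) keys_sum unfolding se generator_boundary.simps by fast
  then obtain c where c: "c \<in> crossings D" "s c = MarkA" "k \<in> Poly_Mapping.keys (edge_map D c (s, \<epsilon>))"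
    by auto
  have gen: "(s, \<epsilon>) \<in> gens D i j" using x g(1) se by auto
  then have "(s, \<epsilon>) \<in> generators D" by (simp add: gens_def)
  note ke = keys_edge_map[OF this c]
  obtain t \<epsilon>' where k: "k = (t, \<epsilon>')" by (cases k)
  have "num_B D t = Suc (num_B D s)"
    using num_upd(1)[OF finite_crossings c(1), of s, OF c(2)] ke k by simp
  moreover have "(num_B D s + card (circles D (all_A D))) mod 2 = i"
    using gen by (simp add: gens_def)
  ultimately have "(num_B D t + card (circles D (all_A D))) mod 2 = 1 - i"
    using i by (simp only:) presburger
  then show "k \<in> gens D (1 - i) j"
    using ke gen unfolding k by (simp add: gens_def del: gdeg.simps) blast
qed

end

section \<open>The exact hexagon of a short exact sequence\<close>

definition add_group :: "'a :: ab_group_add set \<Rightarrow> 'a monoid"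
  where "add_group Z = \<lparr>carrier = Z, monoid.mult = (+), one = 0\<rparr>"

definition add_subgroup :: "'a :: ab_group_add set \<Rightarrow> bool"
  where "add_subgroup Z \<longleftrightarrow> 0 \<in> Z \<and> (\<forall>x \<in> Z. \<forall>y \<in> Z. x - y \<in> Z)"

definition add_coset :: "'a :: ab_group_add set \<Rightarrow> 'a \<Rightarrow> 'a set"
  where "add_coset I x = (\<lambda>h. h + x) ` I"

lemma add_group_simps [simp]:
  "carrier (add_group Z) = Z" "x \<otimes>\<^bsub>add_group Z\<^esub> y = x + y" "\<one>\<^bsub>add_group Z\<^esub> = 0"
  by (simp_all add: add_group_def)

lemma add_subgroupD:
  assumes "add_subgroup Z"
  shows "0 \<in> Z" "x \<in> Z \<Longrightarrow> y \<in> Z \<Longrightarrow> x - y \<in> Z" "x \<in> Z \<Longrightarrow> - x \<in> Z" "x \<in> Z \<Longrightarrow> y \<in> Z \<Longrightarrow> x + y \<in> Z"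
proof -
  show 0: "0 \<in> Z" and d: "x \<in> Z \<Longrightarrow> y \<in> Z \<Longrightarrow> x - y \<in> Z" for x y
    using assms by (simp_all add: add_subgroup_def)
  show m: "x \<in> Z \<Longrightarrow> - x \<in> Z" for x using d[OF 0, of x] by simp
  show "x \<in> Z \<Longrightarrow> y \<in> Z \<Longrightarrow> x + y \<in> Z" using d[of x "- y"] m by simp
qed

lemma comm_group_add_group:
  assumes "add_subgroup Z"
  shows "comm_group (add_group Z)"
proof (rule comm_groupI)
  fix x assume "x \<in> carrier (add_group Z)"
  then show "\<exists>y \<in> carrier (add_group Z). y \<otimes>\<^bsub>add_group Z\<^esub> x = \<one>\<^bsub>add_group Z\<^esub>"
    using add_subgroupD(3)[OF assms] by (intro bexI[of _ "- x"]) simp_all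
qed (use add_subgroupD[OF assms] in \<open>simp_all add: algebra_simps\<close>)

lemma add_coset_eq_iff:
  assumes "add_subgroup I"
  shows "add_coset I x = add_coset I y \<longleftrightarrow> x - y \<in> I"
proof
  assume "add_coset I x = add_coset I y"
  moreover have "x \<in> add_coset I x"
    using add_subgroupD(1)[OF assms] by (auto simp: add_coset_def intro!: image_eqI[of _ _ 0])
  ultimately show "x - y \<in> I" by (auto simp: add_coset_def)
next
  assume d: "x - y \<in> I"
  show "add_coset I x = add_coset I y"
    unfolding add_coset_def
  proof (intro subset_antisym subsetI)
    fix z assume "z \<in> (\<lambda>h. h + x) ` I"
    then obtain h where "h \<in> I" "z = h + x" by auto
    then show "z \<in> (\<lambda>h. h + y) ` I"
      using add_subgroupD(4)[OF assms _ d, of h] by (intro image_eqI[of _ _ "h + (x - y)"]) simp_all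
  next
    fix z assume "z \<in> (\<lambda>h. h + y) ` I"
    then obtain h where "h \<in> I" "z = h + y" by auto
    then show "z \<in> (\<lambda>h. h + x) ` I"
      using add_subgroupD(2)[OF assms _ d, of h] by (intro image_eqI[of _ _ "h - (x - y)"]) simp_all
  qed
qed

locale add_quotient =
  fixes Z I :: "'a :: ab_group_add set"
  assumes Z: "add_subgroup Z" and I: "add_subgroup I" and IZ: "I \<subseteq> Z"
begin

abbreviation Q :: "'a set monoid"
  where "Q \<equiv> add_group Z Mod I"

lemma normal_I: "I \<lhd> add_group Z"
proof -
  interpret comm_group "add_group Z" by (rule comm_group_add_group[OF Z])
  have "subgroup I (add_group Z)"
  proof (rule subgroupI)
    fix a assume a: "a \<in> I"
    have "inv\<^bsub>add_group Z\<^esub> a = - a"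
      by (rule inv_equality) (use a IZ add_subgroupD(3)[OF Z] in auto)
    then show "inv\<^bsub>add_group Z\<^esub> a \<in> I" using add_subgroupD(3)[OF I a] by simp
  qed (use IZ add_subgroupD[OF I] in auto)
  then show ?thesis by (simp add: normal_iff_subgroup)
qed

lemma r_coset_eq: "I #>\<^bsub>add_group Z\<^esub> x = add_coset I x"
  by (auto simp: r_coset_def add_coset_def)

lemma group_Q: "group Q"
  by (rule normal.factorgroup_is_group[OF normal_I])

lemma comm_group_Q: "comm_group Q"
  by (rule comm_group.abelian_FactGroup[OF comm_group_add_group[OF Z]])
    (rule normal_imp_subgroup[OF normal_I])

lemma carrier_Q: "carrier Q = add_coset I ` Z"
  by (simp add: carrier_FactGroup r_coset_eq)

lemma one_Q: "\<one>\<^bsub>Q\<^esub> = add_coset I 0"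
  by (simp add: add_coset_def)

lemma mult_Q:
  assumes "x \<in> Z" "y \<in> Z"
  shows "add_coset I x \<otimes>\<^bsub>Q\<^esub> add_coset I y = add_coset I (x + y)"
  using normal.rcos_sum[OF normal_I, of x y] assms by (simp add: r_coset_eq)

lemma eq_one_iff: "x \<in> Z \<Longrightarrow> add_coset I x = \<one>\<^bsub>Q\<^esub> \<longleftrightarrow> x \<in> I"
  unfolding one_Q by (simp add: add_coset_eq_iff[OF I])

end

text \<open>A relation takes the place of a map on representatives because the connecting
  homomorphism involves the choice of a lift. By \<open>diff\<close> and \<open>bound\<close>, two
  choices differ by an element of \<open>I'\<close> only.\<close>

locale quotient_relation = S: add_quotient Z I + T: add_quotient Z' I'
  for Z I :: "'a :: ab_group_add set" and Z' I' :: "'b :: ab_group_add set" +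
  fixes R :: "'a \<Rightarrow> 'b \<Rightarrow> bool"
  assumes total: "x \<in> Z \<Longrightarrow> \<exists>y. R x y"
    and range: "x \<in> Z \<Longrightarrow> R x y \<Longrightarrow> y \<in> Z'"
    and diff: "x \<in> Z \<Longrightarrow> x' \<in> Z \<Longrightarrow> R x y \<Longrightarrow> R x' y' \<Longrightarrow> R (x - x') (y - y')"
    and bound: "x \<in> I \<Longrightarrow> R x y \<Longrightarrow> y \<in> I'"
begin

definition induced :: "'a set \<Rightarrow> 'b set"
  where "induced X = add_coset I' (SOME y. \<exists>x \<in> Z. add_coset I x = X \<and> R x y)"

lemma induced_eq:
  assumes "x \<in> Z" "R x y"
  shows "induced (add_coset I x) = add_coset I' y"
proof -
  let ?y = "SOME y. \<exists>x' \<in> Z. add_coset I x' = add_coset I x \<and> R x' y"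
  have "\<exists>x' \<in> Z. add_coset I x' = add_coset I x \<and> R x' ?y"
    by (rule someI[of _ y]) (use assms in auto)
  then obtain x' where x': "x' \<in> Z" "add_coset I x' = add_coset I x" "R x' ?y" by blast
  then have "x' - x \<in> I" by (simp add: add_coset_eq_iff[OF S.I])
  moreover have "R (x' - x) (?y - y)" by (rule diff) (use x' assms in auto)
  ultimately have "?y - y \<in> I'" by (rule bound)
  then show ?thesis by (simp add: induced_def add_coset_eq_iff[OF T.I])
qed

lemma add_rel:
  assumes "x \<in> Z" "x' \<in> Z" "R x y" "R x' y'"
  shows "R (x + x') (y + y')"
proof -
  \<comment> \<open>Only differences are available: first \<open>R 0 0\<close>, then
    \<open>R (- x') (- y')\<close>, and then the sum as a difference.\<close>
  have "R (x' - x') (y' - y')" by (rule diff) (use assms in auto)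
  then have "R (x' - x' - x') (y' - y' - y')"
    by (rule diff[rotated 2]) (use assms add_subgroupD(1)[OF S.Z] in auto)
  then have "R (x - (x' - x' - x')) (y - (y' - y' - y'))"
    by (rule diff[rotated 3]) (use assms add_subgroupD(3)[OF S.Z] in auto)
  then show ?thesis by simp
qed

lemma induced_hom: "induced \<in> hom S.Q T.Q"
proof (rule homI)
  fix X assume "X \<in> carrier S.Q"
  then obtain x where x: "x \<in> Z" "X = add_coset I x" by (auto simp: S.carrier_Q)
  then obtain y where "R x y" using total by auto
  then show "induced X \<in> carrier T.Q"
    using x range by (auto simp: induced_eq T.carrier_Q)
next
  fix X X' assume "X \<in> carrier S.Q" "X' \<in> carrier S.Q"
  then obtain x x' where x: "x \<in> Z" "X = add_coset I x" "x' \<in> Z" "X' = add_coset I x'"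
    by (auto simp: S.carrier_Q)
  obtain y y' where y: "R x y" "R x' y'" using total x by metis
  have "x + x' \<in> Z" using x add_subgroupD(4)[OF S.Z] by simp
  then show "induced (X \<otimes>\<^bsub>S.Q\<^esub> X') = induced X \<otimes>\<^bsub>T.Q\<^esub> induced X'"
    using x y range add_rel[OF x(1,3) y]
    by (simp add: S.mult_Q T.mult_Q induced_eq del: mult_FactGroup)
qed

end

text \<open>All six exactness claims of the hexagon are instances of this. The assumption
  \<open>exact\<close> asks for exactness on representatives, modulo \<open>I'\<close> and
  \<open>I''\<close>, where it can be settled by a diagram chase.\<close>

lemma kernel_induced:
  assumes "quotient_relation Z I Z' I' R" "quotient_relation Z' I' Z'' I'' R'"
    and exact: "\<And>y z. y \<in> Z' \<Longrightarrow> R' y z \<Longrightarrow> z \<in> I'' \<longleftrightarrow> (\<exists>x \<in> Z. \<exists>y'. R x y' \<and> y - y' \<in> I')"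
  shows "kernel (add_group Z' Mod I') (add_group Z'' Mod I'') (quotient_relation.induced Z' I' I'' R') =
    quotient_relation.induced Z I I' R ` carrier (add_group Z Mod I)"
proof -
  interpret F: quotient_relation Z I Z' I' R by fact
  interpret G: quotient_relation Z' I' Z'' I'' R' by fact
  show ?thesis
  proof (intro subset_antisym subsetI)
    fix Y assume "Y \<in> kernel F.T.Q G.T.Q G.induced"
    then have Y: "Y \<in> carrier F.T.Q" "G.induced Y = \<one>\<^bsub>G.T.Q\<^esub>" by (simp_all add: kernel_def)
    then obtain y where y: "y \<in> Z'" "Y = add_coset I' y" by (auto simp: F.T.carrier_Q)
    obtain z where z: "R' y z" using G.total[OF y(1)] by auto
    have "z \<in> I''"
      using Y(2) G.T.eq_one_iff[OF G.range[OF y(1) z]] unfolding y(2) G.induced_eq[OF y(1) z] by simp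
    then obtain x y' where x: "x \<in> Z" "R x y'" "y - y' \<in> I'" using exact[OF y(1) z] by auto
    then have "Y = F.induced (add_coset I x)"
      by (simp add: y F.induced_eq add_coset_eq_iff[OF F.T.I])
    then show "Y \<in> F.induced ` carrier F.S.Q" using x(1) by (simp add: F.S.carrier_Q)
  next
    fix Y assume "Y \<in> F.induced ` carrier F.S.Q"
    then obtain x where x: "x \<in> Z" "Y = F.induced (add_coset I x)" by (auto simp: F.S.carrier_Q)
    obtain y where y: "R x y" using F.total[OF x(1)] by auto
    have yZ: "y \<in> Z'" by (rule F.range[OF x(1) y])
    obtain z where z: "R' y z" using G.total[OF yZ] by auto
    have "y - y \<in> I'" using add_subgroupD(1)[OF F.T.I] by simp
    then have "z \<in> I''" using exact[OF yZ z] x(1) y by blast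
    moreover have "z \<in> Z''" by (rule G.range[OF yZ z])
    ultimately have "G.induced (add_coset I' y) = \<one>\<^bsub>G.T.Q\<^esub>"
      unfolding G.induced_eq[OF yZ z] using G.T.eq_one_iff by blast
    then show "Y \<in> kernel F.T.Q G.T.Q G.induced"
      unfolding kernel_def x(2) F.induced_eq[OF x(1) y] using yZ by (simp add: F.T.carrier_Q)
  qed
qed

text \<open>\<open>\<rho>\<close> and \<open>\<kappa>\<close> only supply witnesses: for the
  injectivity of \<open>\<iota>\<close>, for the surjectivity of \<open>\<pi>\<close>, and for the
  kernel of \<open>\<pi>\<close> lying in the image of \<open>\<iota>\<close>. The boolean index is
  the parity, so one argument for \<open>i\<close> covers both halves of the hexagon. That the
  differential squares to zero is assumed in the middle, from where it passes to both ends.\<close>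

locale split_short_exact =
  fixes B :: "bool \<Rightarrow> 'b :: ab_group_add set" and M :: "bool \<Rightarrow> 'm :: ab_group_add set"
    and A :: "bool \<Rightarrow> 'a :: ab_group_add set"
    and dB :: "'b \<Rightarrow> 'b" and dM :: "'m \<Rightarrow> 'm" and dA :: "'a \<Rightarrow> 'a"
    and \<iota> :: "'b \<Rightarrow> 'm" and \<pi> :: "'m \<Rightarrow> 'a" and \<rho> :: "'m \<Rightarrow> 'b" and \<kappa> :: "'a \<Rightarrow> 'm"
  assumes subgroups: "add_subgroup (B i)" "add_subgroup (M i)" "add_subgroup (A i)"
    and additive: "dB (b - b') = dB b - dB b'" "dM (m - m') = dM m - dM m'" "dA (a - a') = dA a - dA a'"
      "\<iota> (b - b') = \<iota> b - \<iota> b'" "\<pi> (m - m') = \<pi> m - \<pi> m'"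
    and maps: "b \<in> B i \<Longrightarrow> dB b \<in> B (\<not> i)" "m \<in> M i \<Longrightarrow> dM m \<in> M (\<not> i)"
      "a \<in> A i \<Longrightarrow> dA a \<in> A (\<not> i)" "b \<in> B i \<Longrightarrow> \<iota> b \<in> M i" "m \<in> M i \<Longrightarrow> \<pi> m \<in> A i"
      "m \<in> M i \<Longrightarrow> \<rho> m \<in> B i" "a \<in> A i \<Longrightarrow> \<kappa> a \<in> M i"
    and dd: "m \<in> M i \<Longrightarrow> dM (dM m) = 0"
    and chain: "b \<in> B i \<Longrightarrow> dM (\<iota> b) = \<iota> (dB b)" "m \<in> M i \<Longrightarrow> dA (\<pi> m) = \<pi> (dM m)"
    and split: "b \<in> B i \<Longrightarrow> \<rho> (\<iota> b) = b" "a \<in> A i \<Longrightarrow> \<pi> (\<kappa> a) = a" "b \<in> B i \<Longrightarrow> \<pi> (\<iota> b) = 0"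
      "m \<in> M i \<Longrightarrow> m = \<kappa> (\<pi> m) + \<iota> (\<rho> m)"
begin

definition ZB :: "bool \<Rightarrow> 'b set" where "ZB i = {b \<in> B i. dB b = 0}"
definition IB :: "bool \<Rightarrow> 'b set" where "IB i = dB ` B (\<not> i)"
definition ZM :: "bool \<Rightarrow> 'm set" where "ZM i = {m \<in> M i. dM m = 0}"
definition IM :: "bool \<Rightarrow> 'm set" where "IM i = dM ` M (\<not> i)"
definition ZA :: "bool \<Rightarrow> 'a set" where "ZA i = {a \<in> A i. dA a = 0}"
definition IA :: "bool \<Rightarrow> 'a set" where "IA i = dA ` A (\<not> i)"

lemma zero: "dB 0 = 0" "dM 0 = 0" "dA 0 = 0" "\<iota> 0 = 0" "\<pi> 0 = 0"
  using additive(1)[of 0 0] additive(2)[of 0 0] additive(3)[of 0 0] additive(4)[of 0 0]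
    additive(5)[of 0 0] by simp_all

lemma plus: "dM (m + m') = dM m + dM m'" "\<pi> (m + m') = \<pi> m + \<pi> m'"
  using additive(2)[of m "0 - m'"] additive(2)[of 0 m'] additive(5)[of m "0 - m'"] additive(5)[of 0 m']
  by (simp_all add: zero)

lemma inj: "b \<in> B i \<Longrightarrow> b' \<in> B i \<Longrightarrow> \<iota> b = \<iota> b' \<Longrightarrow> b = b'"
  using split(1) by metis

lemma kernel_\<pi>:
  assumes "m \<in> M i" "\<pi> m = 0"
  shows "\<iota> (\<rho> m) = m"
proof -
  have "\<rho> (\<iota> 0) = 0" by (rule split(1)[OF add_subgroupD(1)[OF subgroups(1)]])
  \<comment> \<open>Additivity of \<open>\<kappa>\<close> is not assumed; that it vanishes at 0 is
    extracted from the decomposition of 0.\<close>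
  have "0 = \<kappa> (\<pi> 0) + \<iota> (\<rho> 0)" by (rule split(4)[OF add_subgroupD(1)[OF subgroups(2)]])
  also have "\<dots> = \<kappa> 0" using \<open>\<rho> (\<iota> 0) = 0\<close> unfolding zero by (simp add: zero)
  finally have "\<kappa> 0 = 0" by (rule sym)
  then have "\<kappa> (\<pi> m) + \<iota> (\<rho> m) = \<iota> (\<rho> m)" using assms(2) by simp
  moreover have "m = \<kappa> (\<pi> m) + \<iota> (\<rho> m)" by (rule split(4)[OF assms(1)])
  ultimately show ?thesis by argo
qed

lemma ddB: "b \<in> B i \<Longrightarrow> dB (dB b) = 0"
proof -
  assume b: "b \<in> B i"
  have "\<iota> (dB (dB b)) = dM (dM (\<iota> b))" using chain(1)[OF b] chain(1)[OF maps(1)[OF b]] by simp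
  also have "\<dots> = \<iota> 0" using dd[OF maps(4)[OF b]] zero by simp
  finally show ?thesis
    using inj[OF maps(1)[OF maps(1)[OF b]] add_subgroupD(1)[OF subgroups(1)]] by simp
qed

lemma ddA: "a \<in> A i \<Longrightarrow> dA (dA a) = 0"
proof -
  assume a: "a \<in> A i"
  note k = maps(7)[OF a]
  have "dA (dA (\<pi> (\<kappa> a))) = \<pi> (dM (dM (\<kappa> a)))" using chain(2)[OF k] chain(2)[OF maps(2)[OF k]] by simp
  then show ?thesis using split(2)[OF a] dd[OF k] zero by simp
qed

sublocale QB: add_quotient "ZB i" "IB i" for i
proof
  show "add_subgroup (ZB i)"
    using add_subgroupD[OF subgroups(1)] by (simp add: add_subgroup_def ZB_def additive zero)
  show "add_subgroup (IB i)"
    using add_subgroupD[OF subgroups(1)] zero(1)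
    by (auto simp: add_subgroup_def IB_def image_iff simp flip: additive(1) intro!: bexI)
  show "IB i \<subseteq> ZB i" using maps(1)[of _ "\<not> i"] ddB by (auto simp: IB_def ZB_def)
qed

sublocale QM: add_quotient "ZM i" "IM i" for i
proof
  show "add_subgroup (ZM i)"
    using add_subgroupD[OF subgroups(2)] by (simp add: add_subgroup_def ZM_def additive zero)
  show "add_subgroup (IM i)"
    using add_subgroupD[OF subgroups(2)] zero(2)
    by (auto simp: add_subgroup_def IM_def image_iff simp flip: additive(2) intro!: bexI)
  show "IM i \<subseteq> ZM i" using maps(2)[of _ "\<not> i"] dd by (auto simp: IM_def ZM_def)
qed

sublocale QA: add_quotient "ZA i" "IA i" for i
proof
  show "add_subgroup (ZA i)"
    using add_subgroupD[OF subgroups(3)] by (simp add: add_subgroup_def ZA_def additive zero)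
  show "add_subgroup (IA i)"
    using add_subgroupD[OF subgroups(3)] zero(3)
    by (auto simp: add_subgroup_def IA_def image_iff simp flip: additive(3) intro!: bexI)
  show "IA i \<subseteq> ZA i" using maps(3)[of _ "\<not> i"] ddA by (auto simp: IA_def ZA_def)
qed

text \<open>The relation behind the connecting map of the snake lemma: \<open>b\<close> is the
  boundary of a lift of \<open>a\<close>.\<close>

definition connect :: "bool \<Rightarrow> 'a \<Rightarrow> 'b \<Rightarrow> bool"
  where "connect i a b \<longleftrightarrow> b \<in> B (\<not> i) \<and> (\<exists>m \<in> M i. \<pi> m = a \<and> \<iota> b = dM m)"

sublocale F: quotient_relation "ZB i" "IB i" "ZM i" "IM i" "\<lambda>b m. m = \<iota> b" for i
proof
  fix b m assume "b \<in> ZB i" "m = \<iota> b"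
  then show "m \<in> ZM i" using chain(1)[of b i] maps(4)[of b i] zero by (simp add: ZB_def ZM_def)
next
  fix b m assume "b \<in> IB i" "m = \<iota> b"
  then obtain b' where b': "b' \<in> B (\<not> i)" "m = \<iota> (dB b')" by (auto simp: IB_def)
  then show "m \<in> IM i" using chain(1)[OF b'(1)] imageI[OF maps(4)[OF b'(1)], of dM] by (simp add: IM_def)
qed (simp_all add: additive)

sublocale G: quotient_relation "ZM i" "IM i" "ZA i" "IA i" "\<lambda>m a. a = \<pi> m" for i
proof
  fix m a assume "m \<in> ZM i" "a = \<pi> m"
  then show "a \<in> ZA i" using chain(2)[of m i] maps(5)[of m i] zero by (simp add: ZM_def ZA_def)
next
  fix m a assume "m \<in> IM i" "a = \<pi> m"
  then obtain m' where m': "m' \<in> M (\<not> i)" "a = \<pi> (dM m')" by (auto simp: IM_def)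
  then show "a \<in> IA i" using chain(2)[OF m'(1)] imageI[OF maps(5)[OF m'(1)], of dA] by (simp add: IA_def)
qed (simp_all add: additive)

sublocale H: quotient_relation "ZA i" "IA i" "ZB (\<not> i)" "IB (\<not> i)" "connect i" for i
proof
  fix a assume a: "a \<in> ZA i"
  then have k: "\<kappa> a \<in> M i" "\<pi> (\<kappa> a) = a" using maps(7) split(2) by (auto simp: ZA_def)
  have "\<pi> (dM (\<kappa> a)) = 0" using chain(2)[OF k(1)] k(2) a by (simp add: ZA_def)
  then have "\<iota> (\<rho> (dM (\<kappa> a))) = dM (\<kappa> a)" using kernel_\<pi>[OF maps(2)[OF k(1)]] by simp
  then have "connect i a (\<rho> (dM (\<kappa> a)))"
    using k maps(6)[OF maps(2)[OF k(1)]] unfolding connect_def by blast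
  then show "\<exists>b. connect i a b" ..
next
  fix a b assume "connect i a b"
  then obtain m where m: "m \<in> M i" "\<iota> b = dM m" and b: "b \<in> B (\<not> i)" by (auto simp: connect_def)
  have "\<iota> (dB b) = \<iota> 0" using chain(1)[OF b] m dd[OF m(1)] zero by simp
  then have "dB b = 0"
    by (rule inj[OF maps(1)[OF b] add_subgroupD(1)[OF subgroups(1)]])
  then show "b \<in> ZB (\<not> i)" using b by (simp add: ZB_def)
next
  fix a a' b b' assume "connect i a b" "connect i a' b'"
  then obtain m m' where m: "m \<in> M i" "\<pi> m = a" "\<iota> b = dM m" "m' \<in> M i" "\<pi> m' = a'" "\<iota> b' = dM m'"
    and b: "b \<in> B (\<not> i)" "b' \<in> B (\<not> i)" by (auto simp: connect_def)
  have "m - m' \<in> M i" "\<pi> (m - m') = a - a'" "\<iota> (b - b') = dM (m - m')"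
    using m add_subgroupD(2)[OF subgroups(2)] by (simp_all add: additive)
  then show "connect i (a - a') (b - b')"
    using add_subgroupD(2)[OF subgroups(1) b] unfolding connect_def by blast
next
  fix a b assume "a \<in> IA i" "connect i a b"
  then obtain m a' where m: "m \<in> M i" "\<pi> m = dA a'" "\<iota> b = dM m" and b: "b \<in> B (\<not> i)"
    and a': "a' \<in> A (\<not> i)" by (auto simp: connect_def IA_def)
  note k = maps(7)[OF a']
  \<comment> \<open>Subtracting the boundary of a lift of \<open>a'\<close> moves \<open>m\<close>
    into the kernel of \<open>\<pi>\<close> without changing its boundary. So it comes from a chain
    of \<open>B\<close>, whose boundary must be \<open>b\<close>.\<close>
  define n where "n = m - dM (\<kappa> a')"
  have dk: "dM (\<kappa> a') \<in> M i" using maps(2)[OF k] by simp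
  have n: "n \<in> M i" using add_subgroupD(2)[OF subgroups(2) m(1) dk] by (simp add: n_def)
  have "\<pi> n = 0" using m(2) chain(2)[OF k] split(2)[OF a'] by (simp add: n_def additive)
  then have "\<iota> (\<rho> n) = n" by (rule kernel_\<pi>[OF n])
  moreover have "dM n = \<iota> b" using m(3) dd[OF k] by (simp add: n_def additive)
  ultimately have "\<iota> (dB (\<rho> n)) = \<iota> b" using chain(1)[OF maps(6)[OF n]] by simp
  then have "dB (\<rho> n) = b" by (rule inj[OF maps(1)[OF maps(6)[OF n]] b])
  then show "b \<in> IB (\<not> i)" using maps(6)[OF n] by (auto simp: IB_def)
qed

lemma exact_M:
  "kernel (QM.Q i) (QA.Q i) (G.induced i) = F.induced i ` carrier (QB.Q i)"
proof (rule kernel_induced[OF F.quotient_relation_axioms G.quotient_relation_axioms])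
  fix m a assume m: "m \<in> ZM i" and a: "a = \<pi> m"
  have mM: "m \<in> M i" "dM m = 0" using m by (simp_all add: ZM_def)
  show "a \<in> IA i \<longleftrightarrow> (\<exists>b \<in> ZB i. \<exists>m'. m' = \<iota> b \<and> m - m' \<in> IM i)"
  proof
    assume "a \<in> IA i"
    then obtain a' where a': "a' \<in> A (\<not> i)" "\<pi> m = dA a'" using a by (auto simp: IA_def)
    note k = maps(7)[OF a'(1)]
    \<comment> \<open>The same correction as for the connecting relation: \<open>n\<close> is
      homologous to \<open>m\<close> and comes from \<open>B\<close>.\<close>
    define n where "n = m - dM (\<kappa> a')"
    have dk: "dM (\<kappa> a') \<in> M i" using maps(2)[OF k] by simp
    have n: "n \<in> M i" using add_subgroupD(2)[OF subgroups(2) mM(1) dk] by (simp add: n_def)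
    have "\<pi> n = 0" using a'(2) chain(2)[OF k] split(2)[OF a'(1)] by (simp add: n_def additive)
    then have in_im: "\<iota> (\<rho> n) = n" by (rule kernel_\<pi>[OF n])
    have "dM n = 0" using mM dd[OF k] by (simp add: n_def additive)
    then have "\<iota> (dB (\<rho> n)) = \<iota> 0" using chain(1)[OF maps(6)[OF n]] in_im zero by simp
    then have "dB (\<rho> n) = 0"
      by (rule inj[OF maps(1)[OF maps(6)[OF n]] add_subgroupD(1)[OF subgroups(1)]])
    then have "\<rho> n \<in> ZB i" using maps(6)[OF n] by (simp add: ZB_def)
    moreover have "m - \<iota> (\<rho> n) \<in> IM i" using in_im k by (simp add: n_def IM_def)
    ultimately show "\<exists>b \<in> ZB i. \<exists>m'. m' = \<iota> b \<and> m - m' \<in> IM i" by blast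
  next
    assume "\<exists>b \<in> ZB i. \<exists>m'. m' = \<iota> b \<and> m - m' \<in> IM i"
    then obtain b u where b: "b \<in> B i" and u: "u \<in> M (\<not> i)" "m - \<iota> b = dM u"
      by (auto simp: ZB_def IM_def)
    have "\<pi> m = \<pi> (m - \<iota> b)" using split(3)[OF b] by (simp add: additive)
    also have "\<dots> = dA (\<pi> u)" using chain(2)[OF u(1)] u(2) by simp
    finally show "a \<in> IA i" using a maps(5)[OF u(1)] by (simp add: IA_def)
  qed
qed

lemma exact_A:
  "kernel (QA.Q i) (QB.Q (\<not> i)) (H.induced i) = G.induced i ` carrier (QM.Q i)"
proof (rule kernel_induced[OF G.quotient_relation_axioms H.quotient_relation_axioms])
  fix a b assume a: "a \<in> ZA i" and "connect i a b"
  then obtain m0 where m0: "m0 \<in> M i" "\<pi> m0 = a" "\<iota> b = dM m0" and b: "b \<in> B (\<not> i)"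
    by (auto simp: connect_def)
  show "b \<in> IB (\<not> i) \<longleftrightarrow> (\<exists>m \<in> ZM i. \<exists>a'. a' = \<pi> m \<and> a - a' \<in> IA i)"
  proof
    assume "b \<in> IB (\<not> i)"
    then obtain b' where b': "b' \<in> B i" "b = dB b'" by (auto simp: IB_def)
    \<comment> \<open>The lift \<open>m0\<close> fails to be a cycle by \<open>\<iota> b\<close>,
      and \<open>\<iota> b'\<close> has the same boundary.\<close>
    let ?m = "m0 - \<iota> b'"
    have "?m \<in> M i" using add_subgroupD(2)[OF subgroups(2) m0(1) maps(4)[OF b'(1)]] .
    moreover have "dM ?m = 0" using m0(3) chain(1)[OF b'(1)] b'(2) by (simp add: additive)
    moreover have "\<pi> ?m = a" using m0(2) split(3)[OF b'(1)] by (simp add: additive)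
    moreover have "a - a \<in> IA i" using add_subgroupD(1)[OF QA.I] by simp
    ultimately show "\<exists>m \<in> ZM i. \<exists>a'. a' = \<pi> m \<and> a - a' \<in> IA i"
      by (intro bexI[of _ ?m] exI[of _ a]) (simp_all add: ZM_def)
  next
    assume "\<exists>m \<in> ZM i. \<exists>a'. a' = \<pi> m \<and> a - a' \<in> IA i"
    then obtain m a' where m: "m \<in> M i" "dM m = 0" and a': "a' \<in> A (\<not> i)" "a - \<pi> m = dA a'"
      by (auto simp: ZM_def IA_def)
    note k = maps(7)[OF a'(1)]
    have dk: "dM (\<kappa> a') \<in> M i" using maps(2)[OF k] by simp
    \<comment> \<open>Under \<open>\<pi>\<close> the lift \<open>m0\<close> and the cycle
      \<open>m\<close> differ by a boundary. After correction their difference comes from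
      \<open>B\<close>, and its boundary is still \<open>\<iota> b\<close>.\<close>
    define n where "n = m0 - (m + dM (\<kappa> a'))"
    have n: "n \<in> M i"
      using add_subgroupD(2)[OF subgroups(2) m0(1) add_subgroupD(4)[OF subgroups(2) m(1) dk]]
      by (simp add: n_def)
    have "\<pi> n = 0"
      using m0(2) a'(2) chain(2)[OF k] split(2)[OF a'(1)]
      by (simp add: n_def additive plus algebra_simps)
    then have "\<iota> (\<rho> n) = n" by (rule kernel_\<pi>[OF n])
    moreover have "dM n = \<iota> b" using m0(3) m(2) dd[OF k] by (simp add: n_def additive plus)
    ultimately have "\<iota> (dB (\<rho> n)) = \<iota> b" using chain(1)[OF maps(6)[OF n]] by simp
    then have "dB (\<rho> n) = b" by (rule inj[OF maps(1)[OF maps(6)[OF n]] b])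
    then show "b \<in> IB (\<not> i)" using maps(6)[OF n] by (auto simp: IB_def)
  qed
qed

lemma exact_B:
  "kernel (QB.Q (\<not> i)) (QM.Q (\<not> i)) (F.induced (\<not> i)) = H.induced i ` carrier (QA.Q i)"
proof (rule kernel_induced[OF H.quotient_relation_axioms F.quotient_relation_axioms])
  fix b m assume bZ: "b \<in> ZB (\<not> i)" and m: "m = \<iota> b"
  have b: "b \<in> B (\<not> i)" using bZ by (simp add: ZB_def)
  show "m \<in> IM (\<not> i) \<longleftrightarrow> (\<exists>a \<in> ZA i. \<exists>b'. connect i a b' \<and> b - b' \<in> IB (\<not> i))"
  proof
    assume "m \<in> IM (\<not> i)"
    \<comment> \<open>A chain of \<open>M\<close> with boundary \<open>\<iota> b\<close> projects to
      a cycle of \<open>A\<close>, and this cycle is connected to \<open>b\<close>.\<close>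
    then obtain n where n: "n \<in> M i" "\<iota> b = dM n" using m by (auto simp: IM_def)
    have "dA (\<pi> n) = 0" using chain(2)[OF n(1)] n(2) split(3)[OF b] by simp
    then have "\<pi> n \<in> ZA i" using maps(5)[OF n(1)] by (simp add: ZA_def)
    moreover have "connect i (\<pi> n) b" using n b unfolding connect_def by blast
    moreover have "b - b \<in> IB (\<not> i)" using add_subgroupD(1)[OF QB.I] by simp
    ultimately show "\<exists>a \<in> ZA i. \<exists>b'. connect i a b' \<and> b - b' \<in> IB (\<not> i)" by blast
  next
    assume "\<exists>a \<in> ZA i. \<exists>b'. connect i a b' \<and> b - b' \<in> IB (\<not> i)"
    then obtain b' n u where n: "n \<in> M i" "\<iota> b' = dM n" and u: "u \<in> B i" "b - b' = dB u"
      by (auto simp: connect_def IB_def)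
    have "\<iota> b = \<iota> b' + \<iota> (b - b')" by (simp add: additive)
    also have "\<dots> = dM (n + \<iota> u)" using n u chain(1)[OF u(1)] by (simp add: plus)
    finally show "m \<in> IM (\<not> i)"
      using m add_subgroupD(4)[OF subgroups(2) n(1) maps(4)[OF u(1)]] by (simp add: IM_def)
  qed
qed

end

lemma exact_hexagonI:
  assumes "f1 \<in> hom G1 G2" "f2 \<in> hom G2 G3" "f3 \<in> hom G3 G4" "f4 \<in> hom G4 G5" "f5 \<in> hom G5 G6" "f6 \<in>
      hom G6 G1"
    and "group G1" "group G2" "group G3" "group G4" "group G5" "group G6"
    and "kernel G2 G3 f2 = f1 ` carrier G1" "kernel G3 G4 f3 = f2 ` carrier G2"
      "kernel G4 G5 f4 = f3 ` carrier G3" "kernel G5 G6 f5 = f4 ` carrier G4"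
      "kernel G6 G1 f6 = f5 ` carrier G5" "kernel G1 G2 f1 = f6 ` carrier G6"
  shows "exact_hexagon G1 G2 G3 G4 G5 G6"
  unfolding exact_hexagon_def
proof (intro exI)
  have "exact_seq ([G2, G1], [f1])"
    by (rule exact_seq.unity) (use assms in \<open>simp add: group_hom_def group_hom_axioms_def\<close>)
  then show "exact_seq ([G2, G1, G6, G5, G4, G3, G2, G1], [f1, f6, f5, f4, f3, f2, f1])"
    by (intro exact_seq.extension) (use assms in simp_all)
qed

lemma (in split_short_exact) induced_homs:
  "F.induced i \<in> hom (QB.Q i) (QM.Q i)" "G.induced i \<in> hom (QM.Q i) (QA.Q i)"
  "H.induced i \<in> hom (QA.Q i) (QB.Q (\<not> i))"
  by (rule F.induced_hom G.induced_hom H.induced_hom)+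

lemma split_short_exact_hexagon:
  assumes "split_short_exact B M A dB dM dA \<iota> \<pi> \<rho> \<kappa>"
  defines "HB \<equiv> \<lambda>i. add_group {b \<in> B i. dB b = 0} Mod (dB ` B (\<not> i))"
    and "HM \<equiv> \<lambda>i. add_group {m \<in> M i. dM m = 0} Mod (dM ` M (\<not> i))"
    and "HA \<equiv> \<lambda>i. add_group {a \<in> A i. dA a = 0} Mod (dA ` A (\<not> i))"
  shows "exact_hexagon (HB False) (HM False) (HA False) (HB True) (HM True) (HA True)"
proof -
  interpret split_short_exact B M A dB dM dA \<iota> \<pi> \<rho> \<kappa> by fact
  have HB: "HB i = QB.Q i" for i by (simp add: HB_def ZB_def IB_def)
  have HM: "HM i = QM.Q i" for i by (simp add: HM_def ZM_def IM_def)
  have HA: "HA i = QA.Q i" for i by (simp add: HA_def ZA_def IA_def)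
  show ?thesis
    unfolding HB HM HA
    by (rule exact_hexagonI[of "F.induced False" _ _ "G.induced False" _ "H.induced False" _
          "F.induced True" _ "G.induced True" _ "H.induced True"])
      (use induced_homs[of False] induced_homs[of True] QB.group_Q QM.group_Q QA.group_Q exact_M
          exact_A[of False]
        exact_A[of True] exact_B[of False] exact_B[of True] in simp_all)
qed

section \<open>The skein sequence\<close>

definition inversions :: "'h list list \<Rightarrow> 'h list list \<Rightarrow> 'h state \<Rightarrow> ('h list \<times> 'h list) set"
  where "inversions cs cs' s =
    {(x, y). precedes cs x y \<and> precedes cs' y x \<and> s x = MarkB \<and> s y = MarkB}"

text \<open>
  Multiplying the summand of \<open>s\<close> by \<open>order_sign cs cs' s\<close> turns the differential of the order
  \<open>cs\<close> into that of \<open>cs'\<close>.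
\<close>

definition order_sign :: "'h list list \<Rightarrow> 'h list list \<Rightarrow> 'h state \<Rightarrow> int"
  where "order_sign cs cs' s = (-1) ^ card (inversions cs cs' s)"

lemma order_sign_square [simp]: "order_sign cs cs' s * order_sign cs cs' s = 1"
  by (simp add: order_sign_def flip: power_add)

lemma order_sign_nonzero [simp]: "order_sign cs cs' s \<noteq> 0"
  by (simp add: order_sign_def)

text \<open>The new mark B at \<open>c\<close> adds exactly the inversions in which \<open>c\<close>
  takes part, one for each crossing in \<open>V\<close> and in \<open>V'\<close>. The same two sets
  account for the difference between the numbers of B marks before \<open>c\<close> in the two
  orders, so the parities match.\<close>

lemma edge_sign_order_sign:
  assumes cs: "distinct cs" "distinct cs'" "set cs = set cs'" and c: "c \<in> set cs" and s: "s c = MarkA"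
  shows "edge_sign cs' c s * order_sign cs cs' s = order_sign cs cs' (s(c := MarkB)) * edge_sign cs c s"
proof -
  let ?N = "{y. precedes cs y c \<and> s y = MarkB}" and ?N' = "{y. precedes cs' y c \<and> s y = MarkB}"
  \<comment> \<open>These are the B-marked crossings that precede \<open>c\<close> in both orders,
    in \<open>cs\<close> only, and in \<open>cs'\<close> only.\<close>
  define U V V' where "U = {y. precedes cs y c \<and> precedes cs' y c \<and> s y = MarkB}"
    and "V = {y. precedes cs y c \<and> precedes cs' c y \<and> s y = MarkB}"
    and "V' = {y. precedes cs c y \<and> precedes cs' y c \<and> s y = MarkB}"
  have finite_prec: "finite {y. precedes cs y c \<and> P y}" "finite {y. precedes cs' y c \<and> P y}" for P
    by simp_all
  have fin: "finite U" "finite V" "finite V'"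
    using finite_prec(1)[of "\<lambda>_. True"] finite_prec(2)[of "\<lambda>_. True"]
    by (auto simp: U_def V_def V'_def elim!: rev_finite_subset)
  have dich: "precedes cs x c \<longleftrightarrow> \<not> precedes cs c x" "precedes cs' x c \<longleftrightarrow> \<not> precedes cs' c x"
    if "x \<in> set cs" "s x = MarkB" for x
  proof -
    have "x \<noteq> c" using that s by auto
    then show "precedes cs x c \<longleftrightarrow> \<not> precedes cs c x" "precedes cs' x c \<longleftrightarrow> \<not> precedes cs' c x"
      using precedes_total[OF cs(1), of x c] precedes_total[OF cs(2), of x c] that c cs(3) by simp_all
  qed
  have "?N = U \<union> V" using dich precedes_in[of cs _ c] by (auto simp: U_def V_def)
  moreover have "U \<inter> V = {}" using dich precedes_in[of cs _ c] by (auto simp: U_def V_def)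
  ultimately have N: "card ?N = card U + card V" using fin by (simp add: card_Un_disjoint)
  have "?N' = U \<union> V'" using dich precedes_in[of cs' _ c] cs(3) by (auto simp: U_def V'_def)
  moreover have "U \<inter> V' = {}" using dich precedes_in[of cs _ c] by (auto simp: U_def V'_def)
  ultimately have N': "card ?N' = card U + card V'" using fin by (simp add: card_Un_disjoint)
  let ?t = "s(c := MarkB)"
  have inv: "inversions cs cs' ?t = inversions cs cs' s \<union> (Pair c ` V' \<union> (\<lambda>x. (x, c)) ` V)"
  proof (rule Set.set_eqI)
    fix p :: "'a list \<times> 'a list"
    obtain x y where p: "p = (x, y)" by (cases p)
    have "p \<in> Pair c ` V' \<longleftrightarrow> x = c \<and> y \<in> V'" "p \<in> (\<lambda>x. (x, c)) ` V \<longleftrightarrow> y = c \<and> x \<in> V"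
      by (auto simp: p)
    then show "p \<in> inversions cs cs' ?t \<longleftrightarrow>
        p \<in> inversions cs cs' s \<union> (Pair c ` V' \<union> (\<lambda>x. (x, c)) ` V)"
      using s precedes_irrefl[of cs c]
      by (cases "x = c"; cases "y = c") (simp_all add: p inversions_def V_def V'_def conj_ac)
  qed
  have fini: "finite (inversions cs cs' s)"
    by (rule finite_subset[of _ "set cs \<times> set cs"])
      (auto simp: inversions_def cs(3) dest: precedes_in)
  have "inversions cs cs' s \<inter> (Pair c ` V' \<union> (\<lambda>x. (x, c)) ` V) = {}"
    using s by (auto simp: inversions_def)
  then have "card (inversions cs cs' ?t) = card (inversions cs cs' s) + card (Pair c ` V' \<union> (\<lambda>x. (x,
      c)) ` V)"
    unfolding inv using fini fin by (intro card_Un_disjoint) auto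
  also have "card (Pair c ` V' \<union> (\<lambda>x. (x, c)) ` V) = card (Pair c ` V') + card ((\<lambda>x. (x, c)) ` V)"
    using fin s by (intro card_Un_disjoint) (auto simp: V_def V'_def)
  also have "\<dots> = card V' + card V" by (simp add: card_image inj_on_def)
  finally have "card (inversions cs cs' ?t) = card (inversions cs cs' s) + (card V' + card V)" .
  then have "even (card ?N' + card (inversions cs cs' s)) \<longleftrightarrow>
      even (card (inversions cs cs' ?t) + card ?N)"
    unfolding N N' by presburger
  then show ?thesis
    unfolding order_sign_def edge_sign_card[OF cs(1)] edge_sign_card[OF cs(2)] power_add[symmetric]
      minus_one_power_iff by (auto split: if_splits)
qed

section \<open>Chains, and chain maps given by relabelling states\<close>

definition bracket_chains :: "'h diagram \<Rightarrow> bool \<Rightarrow> int \<Rightarrow> ('h generator \<Rightarrow>\<^sub>0 int) set"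
  where "bracket_chains D i j = {x. Poly_Mapping.keys x \<subseteq> gens D (of_bool i) j}"

definition bracket_homology ::
    "'h diagram \<Rightarrow> 'h list list \<Rightarrow> bool \<Rightarrow> int \<Rightarrow> ('h generator \<Rightarrow>\<^sub>0 int) set monoid"
  where "bracket_homology D cs i j =
    add_group {x \<in> bracket_chains D i j. bracket_boundary D cs x
        = 0} Mod (bracket_boundary D cs ` bracket_chains D (\<not> i) j)"

lemma HF_eq: "HF0 D cs j = bracket_homology D cs False j" "HF1 D cs j = bracket_homology D cs True j"
  by (simp_all add: HF_def bracket_def bracket_group_gens ker_mod_im_def kernel_def
      bracket_homology_def bracket_chains_def free_Abelian_group_def add_group_def)

lemma add_subgroup_bracket_chains: "add_subgroup (bracket_chains D i j)"
  unfolding add_subgroup_def bracket_chains_def using keys_diff by (fastforce simp: subset_iff)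

lemma bracket_chains_generators: "x \<in> bracket_chains D i j \<Longrightarrow> Poly_Mapping.keys x \<subseteq> generators D"
  unfolding bracket_chains_def gens_def by blast

lemma (in diagram) bracket_chains_boundary: "x \<in> bracket_chains D i j
    \<Longrightarrow> bracket_boundary D cs x \<in> bracket_chains D (\<not> i) j"
  using keys_boundary[of x "of_bool i" j cs] by (cases i) (simp_all add: bracket_chains_def)

lemma frag_extend_id: "(\<And>x. x \<in> Poly_Mapping.keys c \<Longrightarrow> f x = frag_of x) \<Longrightarrow> frag_extend f c = c"
  using frag_extend_eq[of c f frag_of] by (simp flip: frag_expansion)

lemma frag_extend_plus: "frag_extend (\<lambda>x. f x + g x) c = frag_extend f c + frag_extend g c"
  by (simp add: frag_extend_def frag_cmul_distrib2 sum.distrib)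

text \<open>The part of \<open>edge_map\<close> that depends only on the resolved diagrams before
  and after the switch. It allows diagrams with the same resolutions to be compared although their
  states differ.\<close>

definition label_map ::
    "'h diagram \<Rightarrow> 'h diagram \<Rightarrow> 'h list \<Rightarrow> ('h set \<Rightarrow> sign) \<Rightarrow> ('h set \<Rightarrow> sign) \<Rightarrow>\<^sub>0 int"
  where "label_map K L c \<epsilon> =
    (let P = component K (c ! 0); Q = component K (c ! 2);
         P' = component L (c ! 0); Q' = component L (c ! 2)
     in if P \<noteq> Q
        then frag_extend (\<lambda>w. frag_of (restrict (\<epsilon>(P' := w)) (components L))) (mbar (\<epsilon> P) (\<epsilon> Q))
        else frag_extend (\<lambda>(w, w'). frag_of (restrict (\<epsilon>(P' := w, Q' := w')) (components L)))
          (Deltabar (\<epsilon> P)))"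

lemma edge_map_label_map:
  "edge_map D c (s, \<epsilon>) = frag_extend (\<lambda>\<delta>. frag_of (s(c := MarkB), \<delta>))
    (label_map (resolution D s) (resolution D (s(c := MarkB))) c \<epsilon>)"
  by (simp add: label_map_def Let_def frag_extend_frag_extend case_prod_unfold)

text \<open>The common shape of the chain maps \<open>\<iota>\<close>, \<open>\<pi>\<close> and
  \<open>f\<close> below. The coefficient is a sign, or 0 where a projection discards the summand of
  a state.\<close>

definition relabel ::
    "('h state \<Rightarrow> int) \<Rightarrow> ('h state \<Rightarrow> 'h state) \<Rightarrow> (('h set \<Rightarrow> sign) \<Rightarrow> ('h set \<Rightarrow> sign)) \<Rightarrow>
     ('h generator \<Rightarrow>\<^sub>0 int) \<Rightarrow> 'h generator \<Rightarrow>\<^sub>0 int"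
  where "relabel \<eta> f h = frag_extend (\<lambda>(s, \<epsilon>). frag_cmul (\<eta> s) (frag_of (f s, h \<epsilon>)))"

lemma relabel_diff: "relabel \<eta> f h (x - y) = relabel \<eta> f h x - relabel \<eta> f h y"
  by (simp add: relabel_def frag_extend_diff)

lemma relabel_relabel:
  "relabel \<eta>' f' h' (relabel \<eta> f h x) = relabel (\<lambda>s. \<eta> s * \<eta>' (f s)) (f' \<circ> f) (h' \<circ> h) x"
  unfolding relabel_def frag_extend_frag_extend by (simp add: case_prod_unfold frag_extend_cmul)

lemma keys_relabel:
  assumes "k \<in> Poly_Mapping.keys (relabel \<eta> f h x)"
  obtains s \<epsilon> where "(s, \<epsilon>) \<in> Poly_Mapping.keys x" "\<eta> s \<noteq> 0" "k = (f s, h \<epsilon>)"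
proof -
  obtain p where "p \<in> Poly_Mapping.keys x" "k \<in> Poly_Mapping.keys
      (case p of (s, \<epsilon>) \<Rightarrow> frag_cmul (\<eta> s) (frag_of (f s, h \<epsilon>)))"
    using assms keys_frag_extend unfolding relabel_def by fast
  then show thesis using that by (cases p) simp
qed

lemma relabel_id:
  assumes "\<And>s \<epsilon>. (s, \<epsilon>) \<in> Poly_Mapping.keys x \<Longrightarrow> \<eta> s = 1 \<and> f s = s \<and> h \<epsilon> = \<epsilon>"
  shows "relabel \<eta> f h x = x"
  unfolding relabel_def by (rule frag_extend_id) (use assms in auto)

text \<open>A criterion for a relabelling to be a chain map, reduced to conditions on single edges
  of the cube. \<open>zero\<close> says that edges from a discarded state lead to discarded states,
  and \<open>extra\<close> that edges without a counterpart in \<open>D'\<close> do so too; the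
  remaining edges must agree in target, sign and labels.\<close>

lemma boundary_relabel:
  assumes fin: "finite (crossings D)" and x: "Poly_Mapping.keys x \<subseteq> G"
    and zero: "\<And>s \<epsilon> c. (s, \<epsilon>) \<in> G \<Longrightarrow> \<eta> s = 0 \<Longrightarrow> c \<in> crossings D \<Longrightarrow> s c = MarkA \<Longrightarrow> \<eta> (s(c := MarkB)) = 0"
    and sub: "\<And>s \<epsilon> c. (s, \<epsilon>) \<in> G \<Longrightarrow> \<eta> s \<noteq> 0 \<Longrightarrow> c \<in> crossings D' \<Longrightarrow> f s c = MarkA \<Longrightarrow>
      c \<in> crossings D \<and> s c = MarkA"
    and extra: "\<And>s \<epsilon> c. (s, \<epsilon>) \<in> G \<Longrightarrow> \<eta> s \<noteq> 0 \<Longrightarrow> c \<in> crossings D \<Longrightarrow> s c = MarkA \<Longrightarrow>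
      c \<notin> crossings D' \<or> f s c \<noteq> MarkA \<Longrightarrow> \<eta> (s(c := MarkB)) = 0"
    and upd: "\<And>s \<epsilon> c. (s, \<epsilon>) \<in> G \<Longrightarrow> \<eta> s \<noteq> 0 \<Longrightarrow> c \<in> crossings D' \<Longrightarrow> f s c = MarkA \<Longrightarrow>
      f (s(c := MarkB)) = (f s)(c := MarkB)"
    and sign: "\<And>s \<epsilon> c. (s, \<epsilon>) \<in> G \<Longrightarrow> \<eta> s \<noteq> 0 \<Longrightarrow> c \<in> crossings D' \<Longrightarrow> f s c = MarkA \<Longrightarrow>
      edge_sign cs' c (f s) * \<eta> s = \<eta> (s(c := MarkB)) * edge_sign cs c s"
    and lab: "\<And>s \<epsilon> c. (s, \<epsilon>) \<in> G \<Longrightarrow> \<eta> s \<noteq> 0 \<Longrightarrow> c \<in> crossings D' \<Longrightarrow> f s c = MarkA \<Longrightarrow>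
      label_map (resolution D' (f s)) (resolution D' ((f s)(c := MarkB))) c (h \<epsilon>) =
      frag_extend (\<lambda>\<delta>. frag_of (h \<delta>)) (label_map (resolution D s) (resolution D (s(c := MarkB))) c \<epsilon>)"
  shows "bracket_boundary D' cs' (relabel \<eta> f h x) = relabel \<eta> f h (bracket_boundary D cs x)"
  unfolding bracket_boundary_def relabel_def
proof (rule frag_extend_commute)
  fix p assume "p \<in> Poly_Mapping.keys x"
  then obtain s \<epsilon> where p: "p = (s, \<epsilon>)" "(s, \<epsilon>) \<in> G" using x by (cases p) auto
  let ?A = "{c \<in> crossings D. s c = MarkA}" and ?A' = "{c \<in> crossings D'. f s c = MarkA}"
  let ?L = "\<lambda>c. label_map (resolution D s) (resolution D (s(c := MarkB))) c \<epsilon>"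
  let ?r = "\<lambda>(s, \<epsilon>). frag_cmul (\<eta> s) (frag_of (f s, h \<epsilon>))"
  have r: "frag_extend ?r (edge_map D c (s, \<epsilon>)) = frag_cmul (\<eta> (s(c := MarkB)))
      (frag_extend (\<lambda>\<delta>. frag_of (f (s(c := MarkB)), h \<delta>)) (?L c))" for c
  proof -
    have "frag_extend (\<lambda>\<delta>. frag_cmul k (frag_of (g \<delta>))) y
        = frag_cmul k (frag_extend (\<lambda>\<delta>. frag_of (g \<delta>)) y)"
      for k and y :: "('a set \<Rightarrow> sign) \<Rightarrow>\<^sub>0 int" and g :: "('a set \<Rightarrow> sign) \<Rightarrow> 'a generator"
      by (simp add: frag_extend_def frag_cmul_sum mult.commute)
    then show ?thesis unfolding edge_map_label_map frag_extend_frag_extend by (simp del: fun_upd_apply)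
  qed
  have R: "frag_extend ?r (generator_boundary D cs p)
      = (\<Sum>c \<in> ?A. frag_cmul (edge_sign cs c s * \<eta> (s(c := MarkB)))
      (frag_extend (\<lambda>\<delta>. frag_of (f (s(c := MarkB)), h \<delta>)) (?L c)))"
    using fin by (simp add: p(1) frag_extend_sum frag_extend_cmul o_def r del: edge_map.simps
        fun_upd_apply)
  show "frag_extend (generator_boundary D' cs') (?r p) = frag_extend ?r (generator_boundary D cs p)"
  proof (cases "\<eta> s = 0")
    case True
    then have "\<eta> (s(c := MarkB)) = 0" if "c \<in> ?A" for c using zero[OF p(2) True] that by blast
    then show ?thesis unfolding R using True by (simp add: p(1) del: fun_upd_apply)
  next
    case False
    have "frag_extend (generator_boundary D' cs') (?r p) =
        (\<Sum>c \<in> ?A'. frag_cmul (\<eta> s * edge_sign cs' c (f s)) (edge_map D' c (f s, h \<epsilon>)))"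
      by (simp add: p(1) frag_extend_cmul frag_cmul_sum del: edge_map.simps)
    also have "\<dots> = (\<Sum>c \<in> ?A'. frag_cmul (edge_sign cs c s * \<eta> (s(c := MarkB)))
      (frag_extend (\<lambda>\<delta>. frag_of (f (s(c := MarkB)), h \<delta>)) (?L c)))"
    proof (rule sum.cong[OF refl])
      fix c assume "c \<in> ?A'"
      then have c: "c \<in> crossings D'" "f s c = MarkA" by auto
      have "\<eta> s * edge_sign cs' c (f s) = edge_sign cs c s * \<eta> (s(c := MarkB))"
        using sign[OF p(2) False c] by (simp add: mult.commute)
      moreover have "edge_map D' c (f s, h \<epsilon>) =
          frag_extend (\<lambda>\<delta>. frag_of (f (s(c := MarkB)), h \<delta>)) (?L c)"
        unfolding edge_map_label_map lab[OF p(2) False c] upd[OF p(2) False c] frag_extend_frag_extend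
        by simp
      ultimately show "frag_cmul (\<eta> s * edge_sign cs' c (f s)) (edge_map D' c (f s, h \<epsilon>)) =
          frag_cmul (edge_sign cs c s * \<eta> (s(c := MarkB)))
            (frag_extend (\<lambda>\<delta>. frag_of (f (s(c := MarkB)), h \<delta>)) (?L c))" by (simp only:)
    qed
    also have "\<dots> = (\<Sum>c \<in> ?A. frag_cmul (edge_sign cs c s * \<eta> (s(c := MarkB)))
      (frag_extend (\<lambda>\<delta>. frag_of (f (s(c := MarkB)), h \<delta>)) (?L c)))"
    proof (rule sum.mono_neutral_left)
      show "finite ?A" using fin by simp
      show "?A' \<subseteq> ?A" using sub[OF p(2) False] by blast
      show "\<forall>c \<in> ?A - ?A'. frag_cmul (edge_sign cs c s * \<eta> (s(c := MarkB)))
          (frag_extend (\<lambda>\<delta>. frag_of (f (s(c := MarkB)), h \<delta>)) (?L c)) = 0"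
      proof
        fix c assume "c \<in> ?A - ?A'"
        then have "\<eta> (s(c := MarkB)) = 0" using extra[OF p(2) False, of c] by blast
        then show "frag_cmul (edge_sign cs c s * \<eta> (s(c := MarkB)))
          (frag_extend (\<lambda>\<delta>. frag_of (f (s(c := MarkB)), h \<delta>)) (?L c)) = 0" by (simp del: fun_upd_apply)
      qed
    qed
    finally show ?thesis unfolding R .
  qed
qed

lemma edge_sign_append:
  assumes "c \<notin> set cs" "x \<in> set cs" "\<And>y. y \<noteq> c \<Longrightarrow> s y = s' y"
  shows "edge_sign (cs @ [c]) x s = edge_sign cs x s'"
proof -
  have "takeWhile (\<lambda>c'. c' \<noteq> x) (cs @ [c]) = takeWhile (\<lambda>c'. c' \<noteq> x) cs"
    using assms(2) by (intro takeWhile_append1) simp_all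
  moreover have "filter (\<lambda>c'. s c' = MarkB) (takeWhile (\<lambda>c'. c' \<noteq> x) cs) =
      filter (\<lambda>c'. s' c' = MarkB) (takeWhile (\<lambda>c'. c' \<noteq> x) cs)"
  proof (rule filter_cong[OF refl])
    fix y assume "y \<in> set (takeWhile (\<lambda>c'. c' \<noteq> x) cs)"
    then have "y \<noteq> c" using assms(1) set_takeWhileD by metis
    then show "(s y = MarkB) = (s' y = MarkB)" using assms(3) by simp
  qed
  ultimately show ?thesis by (simp add: edge_sign_def)
qed

lemma keys_boundary_state:
  assumes "k \<in> Poly_Mapping.keys (bracket_boundary E cs x)"
  obtains s \<epsilon> c where "(s, \<epsilon>) \<in> Poly_Mapping.keys x" "c \<in> crossings E" "fst k = s(c := MarkB)"
proof -
  obtain p where p: "p \<in> Poly_Mapping.keys x" "k \<in> Poly_Mapping.keys (generator_boundary E cs p)"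
    using assms keys_frag_extend unfolding bracket_boundary_def by fast
  obtain s \<epsilon> where se: "p = (s, \<epsilon>)" by (cases p)
  have "k \<in> (\<Union>c \<in> {c \<in> crossings E. s c = MarkA}.
      Poly_Mapping.keys (frag_cmul (edge_sign cs c s) (edge_map E c (s, \<epsilon>))))"
    using p(2) keys_sum unfolding se generator_boundary.simps by fast
  then obtain c where c: "c \<in> crossings E" "k \<in> Poly_Mapping.keys (edge_map E c (s, \<epsilon>))" by auto
  then obtain \<delta> where "k \<in> Poly_Mapping.keys (frag_of (s(c := MarkB), \<delta>))"
    using keys_frag_extend unfolding edge_map_label_map by fast
  then show thesis using that[OF p(1)[unfolded se] c(1)] by simp
qed

section \<open>The two splittings at a crossing\<close>

locale split_crossing = diagram D for D :: "'h diagram" +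
  fixes c :: "'h list"
  assumes c: "c \<in> crossings D"
begin

abbreviation S :: "mark \<Rightarrow> 'h diagram"
  where "S m \<equiv> split_at D c m"

lemma splitting_length: "v \<in> splitting m w \<Longrightarrow> length v = 2"
  by (cases m) auto

lemma crossings_S: "crossings (S m) = crossings D - {c}"
  using splitting_length[of _ m c] by (auto simp: split_at_def crossings_def)

lemma resolution_S: "resolution (S m) s = resolution D (s(c := m))"
proof -
  have "verts (resolution (S m) s) = verts (resolution D (s(c := m)))"
  proof -
    have "verts (S m) - crossings (S m) = (verts D - crossings D) \<union> splitting m c"
      using splitting_length[of _ m c] c by (auto simp: crossings_S) (auto simp: split_at_def
          crossings_def)
    moreover have "(\<Union>x \<in> crossings D. splitting ((s(c := m)) x) x) =
        splitting m c \<union> (\<Union>x \<in> crossings D - {c}. splitting (s x) x)"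
      using c by (auto split: if_splits)
    ultimately show ?thesis by (simp add: resolution_def crossings_S Un_assoc del: fun_upd_apply)
  qed
  moreover have "edges (resolution (S m) s) = edges (resolution D (s(c := m)))"
    by (simp add: resolution_def split_at_def)
  ultimately show ?thesis by (simp add: resolution_def split_at_def)
qed

text \<open>States are extensional and \<open>c\<close> is no crossing of \<open>S m\<close>, so a
  state of \<open>D\<close> is restricted by resetting its value at \<open>c\<close> to
  \<open>undefined\<close>.\<close>

lemma states_S: "s \<in> states (S m) \<Longrightarrow> s(c := m') \<in> states D" "s \<in> states D
    \<Longrightarrow> s(c := undefined) \<in> states (S m)"
  using c by (auto simp: states_def crossings_S PiE_def extensional_def)

lemma state_S_undefined: "s \<in> states (S m) \<Longrightarrow> s(c := undefined) = s"
  by (rule fun_upd_idem) (simp add: states_def crossings_S PiE_def extensional_def)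

text \<open>For the A-splitting neither number changes. For the B-splitting, marking
  \<open>c\<close> with B adds one to \<open>num_B\<close>; the all-A state of
  \<open>S MarkB\<close> is a neighbour in the cube of that of \<open>D\<close>, so its number of
  circles differs by one, and the two changes cancel modulo 2.\<close>

lemma parity_S: "(num_B (S m) s + card (circles (S m) (all_A (S m)))) mod 2 =
  (num_B D (s(c := m)) + card (circles D (all_A D))) mod 2"
proof (cases m)
  case MarkA
  have "(all_A (S m))(c := m) = all_A D"
    using c MarkA by (auto simp: all_A_def crossings_S)
  moreover have "{x \<in> crossings D - {c}. s x = MarkB} = {x \<in> crossings D. (s(c := m)) x = MarkB}"
    using MarkA by auto
  ultimately show ?thesis by (simp only: resolution_S num_B_def crossings_S)
next
  case MarkB
  have all: "(all_A (S m))(c := m) = (all_A D)(c := MarkB)"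
    using MarkB by (auto simp: all_A_def crossings_S)
  have A: "all_A D c = MarkA" using c by (simp add: all_A_def)
  have d: "c ! 0 \<in> darts D" "c ! 2 \<in> darts D"
    using crossing_darts[OF c, of 0] crossing_darts[OF c, of 2] by simp_all
  have "card (circles D (all_A D)) = Suc (card (circles D ((all_A D)(c := MarkB)))) \<or>
      card (circles D ((all_A D)(c := MarkB))) = Suc (card (circles D (all_A D)))"
    using skein_joins[where s = "all_A D", OF c A] joins_card[OF _ d] by blast
  moreover have "{x \<in> crossings D. (s(c := m)) x = MarkB} = insert c {x \<in> crossings D - {c}. s x = MarkB}"
    using MarkB c by auto
  then have "num_B D (s(c := m)) = Suc (num_B (S m) s)"
    by (simp add: num_B_def crossings_S del: fun_upd_apply)
  ultimately show ?thesis unfolding resolution_S all by presburger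
qed

text \<open>Circles and labels are the same; only the mark at \<open>c\<close> is not counted in
  \<open>S m\<close>. This is where the degrees \<open>j - 1\<close> and \<open>j + 1\<close> of the
  hexagon come from.\<close>

lemma gdeg_S:
  "gdeg (S m) (s, \<epsilon>) = gdeg D (s(c := m), \<epsilon>) + (case m of MarkA \<Rightarrow> - 1 | MarkB \<Rightarrow> 1)"
proof (cases m)
  case MarkA
  have "{x \<in> crossings D. (s(c := m)) x = MarkA} = insert c {x \<in> crossings D - {c}. s x = MarkA}"
    "{x \<in> crossings D. (s(c := m)) x = MarkB} = {x \<in> crossings D - {c}. s x = MarkB}"
    using MarkA c by auto
  then have "num_A D (s(c := m)) = Suc (num_A (S m) s)" "num_B D (s(c := m)) = num_B (S m) s"
    by (simp_all add: num_A_def num_B_def crossings_S del: fun_upd_apply)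
  then show ?thesis using MarkA by (simp add: resolution_S)
next
  case MarkB
  have "{x \<in> crossings D. (s(c := m)) x = MarkB} = insert c {x \<in> crossings D - {c}. s x = MarkB}"
    "{x \<in> crossings D. (s(c := m)) x = MarkA} = {x \<in> crossings D - {c}. s x = MarkA}"
    using MarkB c by auto
  then have "num_B D (s(c := m)) = Suc (num_B (S m) s)" "num_A D (s(c := m)) = num_A (S m) s"
    by (simp_all add: num_A_def num_B_def crossings_S del: fun_upd_apply)
  then show ?thesis using MarkB by (simp add: resolution_S)
qed

lemma gens_S:
  assumes "s \<in> states (S m)"
  shows "(s, \<epsilon>) \<in> gens (S m) i (j + (case m of MarkA \<Rightarrow> - 1 | MarkB \<Rightarrow> 1)) \<longleftrightarrow> (s(c := m), \<epsilon>) \<in> gens D i j"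
  using assms states_S(1)[OF assms, of m] parity_S[of m s]
  by (simp add: gens_def generators_def gdeg_S resolution_S del: gdeg.simps)

lemma gens_S_restrict:
  assumes "(s, \<epsilon>) \<in> gens D i j" "s c = m"
  shows "(s(c := undefined), \<epsilon>) \<in> gens (S m) i (j + (case m of MarkA \<Rightarrow> - 1 | MarkB \<Rightarrow> 1))"
proof -
  have "s \<in> states D" using assms(1) by (simp add: gens_def generators_def)
  then have "s(c := undefined) \<in> states (S m)" by (rule states_S(2))
  from gens_S[OF this] show ?thesis using assms by (simp add: fun_upd_idem)
qed

lemma gens_states: "(s, \<epsilon>) \<in> gens E i j \<Longrightarrow> s \<in> states E"
  by (simp add: gens_def generators_def)

lemma skein_exact:
  assumes cs: "crossing_order D cs" and csA: "crossing_order (S MarkA) csA" and csB: "crossing_order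
      (S MarkB) csB"
  shows "exact_hexagon
    (bracket_homology (S MarkB) csB False (j + 1)) (bracket_homology D cs False j)
    (bracket_homology (S MarkA) csA False (j - 1))
    (bracket_homology (S MarkB) csB True (j + 1)) (bracket_homology D cs True j)
    (bracket_homology (S MarkA) csA True (j - 1))"
proof -
  have oD: "distinct cs" "set cs = crossings D" using cs by (auto simp: crossing_order_def)
  have oA: "distinct csA" "set csA = crossings D - {c}" "distinct (csA @ [c])" "set (csA @ [c])
      = crossings D"
    using csA c by (auto simp: crossing_order_def crossings_S)
  have oB: "distinct csB" "set csB = crossings D - {c}" "distinct (csB @ [c])" "set (csB @ [c])
      = crossings D"
    using csB c by (auto simp: crossing_order_def crossings_S)
  have fin: "finite (crossings (S m))" for m by (simp add: crossings_S)
  \<comment> \<open>\<open>\<eta>A\<close> converts from the order \<open>cs\<close> to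
    \<open>csA @ [c]\<close> and serves \<open>\<pi>\<close>; \<open>\<eta>B\<close> converts from
    \<open>csB @ [c]\<close> to \<open>cs\<close> and serves \<open>\<iota>\<close>. Each sign is
    its own inverse, so \<open>\<kappa>\<close> and \<open>\<rho>\<close> take the same
    ones.\<close>
  define \<eta>A where "\<eta>A = order_sign cs (csA @ [c])"
  define \<eta>B where "\<eta>B = order_sign (csB @ [c]) cs"
  define \<iota> where "\<iota> = relabel (\<lambda>s. \<eta>B (s(c := MarkB))) (\<lambda>s. s(c := MarkB)) id"
  define \<kappa> where "\<kappa> = relabel (\<lambda>s. \<eta>A (s(c := MarkA))) (\<lambda>s. s(c := MarkA)) id"
  define \<pi> where "\<pi> = relabel (\<lambda>s. if s c = MarkA then \<eta>A s else 0) (\<lambda>s. s(c := undefined)) id"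
  define \<rho> where "\<rho> = relabel (\<lambda>s. if s c = MarkB then \<eta>B s else 0) (\<lambda>s. s(c := undefined)) id"
  have nz: "\<eta>A s \<noteq> 0" "\<eta>B s \<noteq> 0" "\<eta>A s * \<eta>A s = 1" "\<eta>B s * \<eta>B s = 1" for s
    by (simp_all add: \<eta>A_def \<eta>B_def)
  txt \<open>
    Putting \<open>c\<close> last in the orders keeps it from contributing to the signs of the other crossings.
  \<close>
  have "split_short_exact (\<lambda>i. bracket_chains (S MarkB) i (j + 1)) (\<lambda>i. bracket_chains D i j) (\<lambda>i.
      bracket_chains (S MarkA) i (j - 1))
    (bracket_boundary (S MarkB) csB) (bracket_boundary D cs) (bracket_boundary (S MarkA) csA) \<iota> \<pi> \<rho> \<kappa>"
  proof
    fix i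
    show \<iota>_chain: "bracket_boundary D cs (\<iota> x) = \<iota> (bracket_boundary (S MarkB) csB x)"
      if "x \<in> bracket_chains (S MarkB) i (j + 1)" for x
      unfolding \<iota>_def
    proof (rule boundary_relabel[where G = "gens (S MarkB) (of_bool i) (j + 1)"])
      show "Poly_Mapping.keys x \<subseteq> gens (S MarkB) (of_bool i) (j + 1)" using that
          by (simp add: bracket_chains_def)
    next
      fix s \<epsilon> x assume x: "x \<in> crossings D" "(s(c := MarkB)) x = MarkA"
      have ne: "x \<noteq> c" using x by auto
      show "x \<in> crossings (S MarkB) \<and> s x = MarkA" using x ne by (simp add: crossings_S)
      show t: "(s(x := MarkB))(c := MarkB) = (s(c := MarkB))(x := MarkB)" using ne
          by (simp add: fun_upd_twist)
      have "edge_sign (csB @ [c]) x (s(c := MarkB)) = edge_sign csB x s"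
        by (rule edge_sign_append) (use oB x ne in auto)
      then show "edge_sign cs x (s(c := MarkB)) * \<eta>B (s(c := MarkB)) =
          \<eta>B ((s(x := MarkB))(c := MarkB)) * edge_sign csB x s"
        using edge_sign_order_sign[OF oB(3) oD(1), of x "s(c := MarkB)"] oB oD x t
            by (simp add: \<eta>B_def del: fun_upd_apply)
      show "label_map (resolution D (s(c := MarkB))) (resolution D (s(c := MarkB, x := MarkB))) x (id \<epsilon>) =
        frag_extend (\<lambda>\<delta>. frag_of (id \<delta>)) (label_map (resolution (S MarkB) s) (resolution (S MarkB)
            (s(x := MarkB))) x \<epsilon>)"
        by (simp add: resolution_S t flip: frag_expansion)
    next
      fix s \<epsilon> x assume "x \<in> crossings (S MarkB)" "s x = MarkA"
        "x \<notin> crossings D \<or> (s(c := MarkB)) x \<noteq> MarkA"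
      then show "\<eta>B ((s(x := MarkB))(c := MarkB)) = 0" by (auto simp: crossings_S)
    qed (use fin nz in simp_all)
    show \<pi>_chain: "bracket_boundary (S MarkA) csA (\<pi> x) = \<pi> (bracket_boundary D cs x)"
      if "x \<in> bracket_chains D i j" for x
      unfolding \<pi>_def
    proof (rule boundary_relabel[where G = "gens D (of_bool i) j"])
      show "Poly_Mapping.keys x \<subseteq> gens D (of_bool i) j" using that by (simp add: bracket_chains_def)
    next
      fix s \<epsilon> x assume 0: "(if s c = MarkA then \<eta>A s else 0) = 0"
      then have "s c \<noteq> MarkA" using nz by (auto split: if_splits)
      then show "(if (s(x := MarkB)) c = MarkA then \<eta>A (s(x := MarkB)) else 0) = 0" by auto
    next
      fix s \<epsilon> x assume "(if s c = MarkA then \<eta>A s else 0) \<noteq> 0" and x: "x \<in> crossings D" "s x = MarkA"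
        "x \<notin> crossings (S MarkA) \<or> (s(c := undefined)) x \<noteq> MarkA"
      \<comment> \<open>The only edge from such a state that has no counterpart in
        \<open>S MarkA\<close> switches \<open>c\<close> itself, and it leads to a state that
        \<open>\<pi>\<close> discards.\<close>
      then have "x = c" by (auto simp: crossings_S split: if_splits)
      then show "(if (s(x := MarkB)) c = MarkA then \<eta>A (s(x := MarkB)) else 0) = 0" by simp
    next
      fix s \<epsilon> x assume "(if s c = MarkA then \<eta>A s else 0) \<noteq> 0"
        and x': "x \<in> crossings (S MarkA)" "(s(c := undefined)) x = MarkA"
      then have sc: "s c = MarkA" by (auto split: if_splits)
      have x: "x \<in> crossings D" "x \<noteq> c" "s x = MarkA" using x' by (auto simp: crossings_S)
      show "x \<in> crossings D \<and> s x = MarkA" using x by simp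
      show t: "(s(x := MarkB))(c := undefined) = (s(c := undefined))(x := MarkB)"
        using x by (simp add: fun_upd_twist)
      have "edge_sign (csA @ [c]) x s = edge_sign csA x (s(c := undefined))"
        by (rule edge_sign_append) (use oA x in auto)
      then show "edge_sign csA x (s(c := undefined)) * (if s c = MarkA then \<eta>A s else 0) =
          (if (s(x := MarkB)) c = MarkA then \<eta>A (s(x := MarkB)) else 0) * edge_sign cs x s"
        using edge_sign_order_sign[OF oD(1) oA(3), of x s] oA oD x sc by (simp add: \<eta>A_def)
      have r: "(s(c := undefined))(c := MarkA) = s" "(s(c := undefined, x := MarkB))(c := MarkA)
          = s(x := MarkB)"
        using sc x by (auto simp: fun_eq_iff)
      show "label_map (resolution (S MarkA) (s(c := undefined)))
          (resolution (S MarkA) (s(c := undefined, x := MarkB))) x (id \<epsilon>) =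
        frag_extend (\<lambda>\<delta>. frag_of (id \<delta>)) (label_map (resolution D s) (resolution D (s(x := MarkB))) x \<epsilon>)"
        unfolding resolution_S r by (simp flip: frag_expansion)
    qed simp
    show \<iota>_mem: "\<iota> x \<in> bracket_chains D i j" if "x \<in> bracket_chains (S MarkB) i (j + 1)" for x
      unfolding bracket_chains_def mem_Collect_eq
    proof
      fix k assume "k \<in> Poly_Mapping.keys (\<iota> x)"
      then obtain s \<epsilon> where s: "(s, \<epsilon>) \<in> Poly_Mapping.keys x" "k = (s(c := MarkB), \<epsilon>)"
        unfolding \<iota>_def by (rule keys_relabel) simp
      then have g: "(s, \<epsilon>) \<in> gens (S MarkB) (of_bool i) (j + 1)" using that
          by (auto simp: bracket_chains_def)
      show "k \<in> gens D (of_bool i) j"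
        using gens_S[OF gens_states[OF g], of \<epsilon> "of_bool i" j] g s(2) by simp
    qed
    show \<kappa>_mem: "\<kappa> x \<in> bracket_chains D i j" if "x \<in> bracket_chains (S MarkA) i (j - 1)" for x
      unfolding bracket_chains_def mem_Collect_eq
    proof
      fix k assume "k \<in> Poly_Mapping.keys (\<kappa> x)"
      then obtain s \<epsilon> where s: "(s, \<epsilon>) \<in> Poly_Mapping.keys x" "k = (s(c := MarkA), \<epsilon>)"
        unfolding \<kappa>_def by (rule keys_relabel) simp
      then have g: "(s, \<epsilon>) \<in> gens (S MarkA) (of_bool i) (j - 1)" using that
          by (auto simp: bracket_chains_def)
      show "k \<in> gens D (of_bool i) j"
        using gens_S[OF gens_states[OF g], of \<epsilon> "of_bool i" j] g s(2) by simp
    qed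
    show \<pi>_mem: "\<pi> x \<in> bracket_chains (S MarkA) i (j - 1)" if "x \<in> bracket_chains D i j" for x i
      unfolding bracket_chains_def mem_Collect_eq
    proof
      fix k assume "k \<in> Poly_Mapping.keys (\<pi> x)"
      then obtain s \<epsilon> where s: "(s, \<epsilon>) \<in> Poly_Mapping.keys x" "s c = MarkA" "k = (s(c := undefined), \<epsilon>)"
        unfolding \<pi>_def by (rule keys_relabel) (simp split: if_splits)
      then show "k \<in> gens (S MarkA) (of_bool i) (j - 1)"
        using gens_S_restrict[of s \<epsilon> "of_bool i" j MarkA] that by (auto simp: bracket_chains_def)
    qed
    show \<rho>_mem: "\<rho> x \<in> bracket_chains (S MarkB) i (j + 1)" if "x \<in> bracket_chains D i j" for x i
      unfolding bracket_chains_def mem_Collect_eq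
    proof
      fix k assume "k \<in> Poly_Mapping.keys (\<rho> x)"
      then obtain s \<epsilon> where s: "(s, \<epsilon>) \<in> Poly_Mapping.keys x" "s c = MarkB" "k = (s(c := undefined), \<epsilon>)"
        unfolding \<rho>_def by (rule keys_relabel) (simp split: if_splits)
      then show "k \<in> gens (S MarkB) (of_bool i) (j + 1)"
        using gens_S_restrict[of s \<epsilon> "of_bool i" j MarkB] that by (auto simp: bracket_chains_def)
    qed
    show "bracket_boundary D cs x \<in> bracket_chains D (\<not> i) j" if "x \<in> bracket_chains D i j" for x
      by (rule bracket_chains_boundary[OF that])
    show \<rho>\<iota>: "\<rho> (\<iota> x) = x" if "x \<in> bracket_chains (S MarkB) i (j + 1)" for x
      unfolding \<rho>_def \<iota>_def relabel_relabel
    proof (rule relabel_id)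
      fix s \<epsilon> assume "(s, \<epsilon>) \<in> Poly_Mapping.keys x"
      then have "s \<in> states (S MarkB)"
        using that gens_states[of s \<epsilon> "S MarkB" "of_bool i" "j + 1"] by (auto simp: bracket_chains_def)
      then show "\<eta>B (s(c := MarkB)) * (if (s(c := MarkB)) c = MarkB then \<eta>B (s(c := MarkB)) else 0) = 1 \<and>
          ((\<lambda>s. s(c := undefined)) \<circ> (\<lambda>s. s(c := MarkB))) s = s \<and> (id \<circ> id) \<epsilon> = \<epsilon>"
        using state_S_undefined nz by simp
    qed
    show \<pi>\<kappa>: "\<pi> (\<kappa> x) = x" if "x \<in> bracket_chains (S MarkA) i (j - 1)" for x
      unfolding \<pi>_def \<kappa>_def relabel_relabel
    proof (rule relabel_id)
      fix s \<epsilon> assume "(s, \<epsilon>) \<in> Poly_Mapping.keys x"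
      then have "s \<in> states (S MarkA)"
        using that gens_states[of s \<epsilon> "S MarkA" "of_bool i" "j - 1"] by (auto simp: bracket_chains_def)
      then show "\<eta>A (s(c := MarkA)) * (if (s(c := MarkA)) c = MarkA then \<eta>A (s(c := MarkA)) else 0) = 1 \<and>
          ((\<lambda>s. s(c := undefined)) \<circ> (\<lambda>s. s(c := MarkA))) s = s \<and> (id \<circ> id) \<epsilon> = \<epsilon>"
        using state_S_undefined nz by simp
    qed
    show "\<pi> (\<iota> x) = 0" for x
      unfolding \<pi>_def \<iota>_def relabel_relabel unfolding relabel_def by (rule frag_extend_eq_0) auto
    show "x = \<kappa> (\<pi> x) + \<iota> (\<rho> x)" for x
    proof -
      have "\<kappa> (\<pi> x) + \<iota> (\<rho> x) = x"
        unfolding \<kappa>_def \<pi>_def \<iota>_def \<rho>_def relabel_relabel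
        unfolding relabel_def frag_extend_plus[symmetric]
      proof (rule frag_extend_id)
        fix p :: "'h generator"
        obtain s \<epsilon> where p: "p = (s, \<epsilon>)" by (cases p)
        show "(case p of (s, \<epsilon>) \<Rightarrow> frag_cmul ((if s c
            = MarkA then \<eta>A s else 0) * \<eta>A (s(c := undefined, c := MarkA)))
            (frag_of (((\<lambda>s. s(c := MarkA)) \<circ> (\<lambda>s. s(c := undefined))) s, (id \<circ> id) \<epsilon>))) +
          (case p of (s, \<epsilon>) \<Rightarrow> frag_cmul ((if s c
              = MarkB then \<eta>B s else 0) * \<eta>B (s(c := undefined, c := MarkB)))
            (frag_of (((\<lambda>s. s(c := MarkB)) \<circ> (\<lambda>s. s(c := undefined))) s, (id \<circ> id) \<epsilon>))) = frag_of p"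
          using nz by (cases "s c") (simp_all add: p fun_upd_idem)
      qed
      then show ?thesis ..
    qed
    \<comment> \<open>Degree and parity of this boundary are read off in \<open>D\<close>: its image
      \<open>\<iota> ?y\<close> is a boundary there, and \<open>\<rho>\<close> recovers
      \<open>?y\<close>. Since \<open>?y\<close> is not yet known to be a chain, the recovery first
      has to look at the states that occur in it.\<close>
    show "bracket_boundary (S MarkB) csB x \<in> bracket_chains (S MarkB) (\<not> i) (j + 1)"
      if x: "x \<in> bracket_chains (S MarkB) i (j + 1)" for x
    proof -
      let ?y = "bracket_boundary (S MarkB) csB x"
      have "s(c := undefined) = s" if k: "(s, \<epsilon>) \<in> Poly_Mapping.keys ?y" for s \<epsilon>
      proof -
        obtain s' \<epsilon>' b where s': "(s', \<epsilon>') \<in> Poly_Mapping.keys x" "b \<in> crossings (S MarkB)" "s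
            = s'(b := MarkB)"
          using k by (rule keys_boundary_state) simp
        then have "s' \<in> states (S MarkB)"
          using x gens_states[of s' \<epsilon>' "S MarkB" "of_bool i" "j + 1"] by (auto simp: bracket_chains_def)
        then have "s \<in> states (S MarkB)" using states_upd s' by simp
        then show ?thesis by (rule state_S_undefined)
      qed
      then have "\<rho> (\<iota> ?y) = ?y"
        unfolding \<rho>_def \<iota>_def relabel_relabel using nz by (intro relabel_id) simp
      moreover have "\<rho> (\<iota> ?y) \<in> bracket_chains (S MarkB) (\<not> i) (j + 1)"
        unfolding \<iota>_chain[OF x, symmetric] by (rule \<rho>_mem[OF bracket_chains_boundary[OF \<iota>_mem[OF x]]])
      ultimately show ?thesis by simp
    qed
    \<comment> \<open>Here \<open>x\<close> is the image of the chain \<open>\<kappa> x\<close>, so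
      its boundary is the image under \<open>\<pi>\<close> of a boundary in
      \<open>D\<close>.\<close>
    show "bracket_boundary (S MarkA) csA x \<in> bracket_chains (S MarkA) (\<not> i) (j - 1)"
      if x: "x \<in> bracket_chains (S MarkA) i (j - 1)" for x
      using \<pi>_mem[OF bracket_chains_boundary[OF \<kappa>_mem[OF x]]] \<pi>_chain[OF \<kappa>_mem[OF x]] \<pi>\<kappa>[OF x] by simp
    show "bracket_boundary D cs (bracket_boundary D cs x) = 0" if "x \<in> bracket_chains D i j" for x
      by (rule boundary_boundary[OF cs bracket_chains_generators[OF that]])
  qed (simp_all add: add_subgroup_bracket_chains bracket_boundary_def frag_extend_diff relabel_diff
      \<iota>_def \<pi>_def)
  from split_short_exact_hexagon[OF this] show ?thesis by (simp add: bracket_homology_def)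
qed

end

section \<open>Tensor products with \<open>W\<close>\<close>

lemma iso_from_kernel:
  assumes "group G" "group H" "h \<in> hom G H" "kernel G H h = N" "h ` carrier G = carrier H"
  shows "G Mod N \<cong> H"
proof -
  interpret group_hom G H h using assms by (simp add: group_hom_def group_hom_axioms_def)
  show ?thesis using FactGroup_iso_set[OF assms(5)] assms(4) unfolding is_iso_def by blast
qed

lemma trivial_group_iso:
  assumes "trivial_group G" "trivial_group H"
  shows "G \<cong> H"
proof -
  have "(\<lambda>_. \<one>\<^bsub>H\<^esub>) \<in> iso G H"
    using assms by (auto simp: trivial_group_def iso_def hom_def bij_betw_def group.is_monoid
        monoid.l_one)
  then show ?thesis unfolding is_iso_def by blast
qed

lemma DirProd_trivial_left:
  assumes "trivial_group G" "group H"
  shows "G \<times>\<times> H \<cong> H"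
proof -
  have "snd \<in> iso (G \<times>\<times> H) H"
    using assms by (auto simp: trivial_group_def iso_def hom_def bij_betw_def inj_on_def mult_DirProd')
  then show ?thesis unfolding is_iso_def by blast
qed

lemma sum_group_trivial:
  assumes "\<And>k. k \<in> I \<Longrightarrow> trivial_group (T k)"
  shows "trivial_group (sum_group I T)"
proof -
  have g: "\<And>k. k \<in> I \<Longrightarrow> group (T k)" using assms by (simp add: trivial_group_def)
  have "carrier (sum_group I T) = {\<one>\<^bsub>sum_group I T\<^esub>}"
  proof (intro subset_antisym subsetI)
    fix x assume "x \<in> carrier (sum_group I T)"
    then have "x \<in> (\<Pi>\<^sub>E i\<in>I. carrier (T i))" using g by (simp add: carrier_sum_group)
    then have "x i = (\<lambda>i\<in>I. \<one>\<^bsub>T i\<^esub>) i" for i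
      using assms[of i] by (cases "i \<in> I") (auto simp: trivial_group_def PiE_def extensional_def)
    then have "x = (\<lambda>i\<in>I. \<one>\<^bsub>T i\<^esub>)" by (rule ext)
    then show "x \<in> {\<one>\<^bsub>sum_group I T\<^esub>}" unfolding one_sum_group singleton_iff .
  next
    fix x assume "x \<in> {\<one>\<^bsub>sum_group I T\<^esub>}"
    then show "x \<in> carrier (sum_group I T)"
      using monoid.one_closed[OF group.is_monoid[OF sum_group[OF g]]] unfolding singleton_iff by simp
  qed
  then show ?thesis using sum_group[OF g] by (simp add: trivial_group_def)
qed

lemma sum_group_two:
  assumes T: "\<And>k. group (T k)" and ab: "a \<noteq> b"
    and triv: "\<And>k. k \<noteq> a \<Longrightarrow> k \<noteq> b \<Longrightarrow> trivial_group (T k)"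
  shows "sum_group UNIV T \<cong> T a \<times>\<times> T b"
proof -
  let ?h = "\<lambda>x. (x a, x b)"
  have car: "x \<in> carrier (sum_group UNIV T) \<longleftrightarrow> (\<forall>k. x k \<in> carrier (T k)) \<and> finite {k. x k \<noteq> \<one>\<^bsub>T k\<^esub>}" for x
    using T by (simp add: carrier_sum_group PiE_def Pi_def)
  have "?h \<in> hom (sum_group UNIV T) (T a \<times>\<times> T b)"
    by (rule homI) (auto simp: car)
  moreover have "inj_on ?h (carrier (sum_group UNIV T))"
  proof (rule inj_onI)
    fix x y assume xy: "x \<in> carrier (sum_group UNIV T)" "y \<in> carrier (sum_group UNIV T)" "?h x = ?h y"
    show "x = y"
    proof
      fix k
      show "x k = y k"
      proof (cases "k = a \<or> k = b")
        case False
        then have "carrier (T k) = {\<one>\<^bsub>T k\<^esub>}" using triv[of k] by (simp add: trivial_group_def)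
        moreover have "x k \<in> carrier (T k)" "y k \<in> carrier (T k)" using xy(1,2) car by auto
        ultimately show ?thesis by simp
      qed (use xy(3) in auto)
    qed
  qed
  moreover have "?h ` carrier (sum_group UNIV T) = carrier (T a \<times>\<times> T b)"
  proof (intro subset_antisym subsetI)
    fix p assume "p \<in> ?h ` carrier (sum_group UNIV T)"
    then show "p \<in> carrier (T a \<times>\<times> T b)" by (auto simp: car)
  next
    fix p assume "p \<in> carrier (T a \<times>\<times> T b)"
    then obtain u v where p: "p = (u, v)" "u \<in> carrier (T a)" "v \<in> carrier (T b)" by auto
    let ?x = "\<lambda>k. if k = a then u else if k = b then v else \<one>\<^bsub>T k\<^esub>"
    have "?x k \<in> carrier (T k)" for k
      using p group.is_monoid[OF T[of k]] monoid.one_closed by auto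
    moreover have "finite {k. ?x k \<noteq> \<one>\<^bsub>T k\<^esub>}"
      by (rule finite_subset[of _ "{a, b}"]) auto
    ultimately have "?x \<in> carrier (sum_group UNIV T)" by (simp only: car simp_thms)
    then have "?h ?x \<in> ?h ` carrier (sum_group UNIV T)" by (rule imageI)
    moreover have "?h ?x = p" using p ab by simp
    ultimately show "p \<in> ?h ` carrier (sum_group UNIV T)" by (simp only:)
  qed
  ultimately show ?thesis unfolding is_iso_def iso_def bij_betw_def by blast
qed

section \<open>Tensor products by generators and relations\<close>

lemma free_Abelian_group_eq: "free_Abelian_group S = add_group {c. Poly_Mapping.keys c \<subseteq> S}"
  by (simp add: free_Abelian_group_def add_group_def)

lemma tensor_relations_carrier:
  assumes "comm_group G" "comm_group H"
  shows "tensor_relations G H \<subseteq> carrier (free_Abelian_group (carrier G \<times> carrier H))"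
proof -
  interpret G: comm_group G by fact
  interpret H: comm_group H by fact
  have "Poly_Mapping.keys (frag_of p - frag_of q - frag_of r) \<subseteq> {p, q, r}" for p q r :: "'a \<times> 'b"
    using keys_diff[of "frag_of p - frag_of q" "frag_of r"] keys_diff[of "frag_of p" "frag_of q"] by auto
  then show ?thesis unfolding tensor_relations_def by fastforce
qed

lemma tensor_ideal:
  assumes "comm_group G" "comm_group H"
  defines "N \<equiv> generate (free_Abelian_group (carrier G \<times> carrier H)) (tensor_relations G H)"
  shows "add_subgroup N" "subgroup N (free_Abelian_group (carrier G \<times> carrier H))"
proof -
  let ?F = "free_Abelian_group (carrier G \<times> carrier H)"
  interpret group ?F by simp
  show s: "subgroup N ?F"
    unfolding N_def by (rule generate_is_subgroup[OF tensor_relations_carrier[OF assms(1,2)]])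
  show "add_subgroup N"
    unfolding add_subgroup_def
  proof (intro conjI ballI)
    show "0 \<in> N" using subgroup.one_closed[OF s] by simp
    fix x y assume xy: "x \<in> N" "y \<in> N"
    then have "Poly_Mapping.keys y \<subseteq> carrier G \<times> carrier H" using subgroup.mem_carrier[OF s] by simp
    then have "- y \<in> N" using subgroup.m_inv_closed[OF s xy(2)] by simp
    then show "x - y \<in> N" using subgroup.m_closed[OF s xy(1), of "- y"] by simp
  qed
qed

lemma comm_group_tensor:
  assumes "comm_group G" "comm_group H"
  shows "comm_group (tensor G H)"
  unfolding tensor_def
  by (rule comm_group.abelian_FactGroup[OF abelian_free_Abelian_group tensor_ideal(2)[OF assms]])

text \<open>Bilinearity, applied to the identity of \<open>H\<close> as the product of itself with
  itself, already puts every generator into the subgroup of relations.\<close>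

lemma tensor_trivial_right:
  assumes G: "comm_group G" and H: "comm_group H" and triv: "carrier H = {\<one>\<^bsub>H\<^esub>}"
  shows "trivial_group (tensor G H)"
proof -
  let ?F = "free_Abelian_group (carrier G \<times> carrier H)"
  define N where "N = generate ?F (tensor_relations G H)"
  note N = tensor_ideal[OF G H, folded N_def]
  interpret H: comm_group H by fact
  have gen: "frag_of p \<in> N" if "p \<in> carrier G \<times> carrier H" for p
  proof -
    obtain x where p: "p = (x, \<one>\<^bsub>H\<^esub>)" "x \<in> carrier G" using \<open>p \<in> _\<close> triv by auto
    have "frag_of (x, \<one>\<^bsub>H\<^esub> \<otimes>\<^bsub>H\<^esub> \<one>\<^bsub>H\<^esub>) - frag_of (x, \<one>\<^bsub>H\<^esub>) - frag_of (x, \<one>\<^bsub>H\<^esub>) \<in> tensor_relations G H"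
      using p(2) H.one_closed unfolding tensor_relations_def by blast
    then have "- frag_of p \<in> N" unfolding N_def p(1) using generate.incl by fastforce
    then show ?thesis using add_subgroupD(3)[OF N(1)] by fastforce
  qed
  have "carrier ?F \<subseteq> N"
  proof
    fix x assume "x \<in> carrier ?F"
    then have "Poly_Mapping.keys x \<subseteq> carrier G \<times> carrier H" by simp
    then show "x \<in> N"
      by (rule free_Abelian_group_induct) (use gen add_subgroupD[OF N(1)] in auto)
  qed
  then have "carrier ?F = N" using subgroup.subset[OF N(2)] by blast
  moreover have "trivial_group (?F Mod carrier ?F)"
  proof -
    interpret F: comm_group ?F by (rule abelian_free_Abelian_group)
    have "comm_group (?F Mod carrier ?F)" by (rule F.abelian_FactGroup[OF F.subgroup_self])
    then have "group (?F Mod carrier ?F)" by (simp add: comm_group_def)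
    moreover have "carrier (?F Mod carrier ?F) \<subseteq> {carrier ?F}"
      by (auto simp: carrier_FactGroup F.coset_join2 F.subgroup_self)
    ultimately show ?thesis by (intro group.trivial_group_subset[THEN iffD2]) simp_all
  qed
  ultimately show ?thesis by (simp add: tensor_def N_def)
qed

text \<open>The homomorphism \<open>h\<close> sends \<open>(x, y)\<close> to the power of
  \<open>x\<close> whose exponent is the coefficient of \<open>y\<close> at \<open>w\<close>. It
  kills the relations. Conversely every element is congruent modulo \<open>N\<close> to
  \<open>e\<close> of its image under \<open>h\<close>, so an element of the kernel is congruent to
  \<open>e\<close> of the identity, which lies in \<open>N\<close>.\<close>

lemma tensor_free_singleton:
  fixes G :: "'a monoid" and w :: 'b
  assumes G: "comm_group G"
  shows "tensor G (free_Abelian_group {w}) \<cong> G"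
proof -
  let ?H = "free_Abelian_group {w}"
  let ?F = "free_Abelian_group (carrier G \<times> carrier ?H)"
  interpret G: comm_group G by fact
  interpret F: comm_group ?F by (rule abelian_free_Abelian_group)
  have H: "comm_group ?H" by (rule abelian_free_Abelian_group)
  define N where "N = generate ?F (tensor_relations G ?H)"
  note N = tensor_ideal[OF G H, folded N_def]
  note N0 = add_subgroupD[OF N(1)]
  have rel1: "frag_of (x \<otimes>\<^bsub>G\<^esub> x', y) - frag_of (x, y) - frag_of (x', y) \<in> N"
    if "x \<in> carrier G" "x' \<in> carrier G" "y \<in> carrier ?H" for x x' y
    unfolding N_def by (rule generate.incl) (use that in \<open>unfold tensor_relations_def, blast\<close>)
  have rel2: "frag_of (x, y + y') - frag_of (x, y) - frag_of (x, y') \<in> N"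
    if "x \<in> carrier G" "y \<in> carrier ?H" "y' \<in> carrier ?H" for x y y'
  proof -
    have "frag_of (x, y \<otimes>\<^bsub>?H\<^esub> y') - frag_of (x, y) - frag_of (x, y') \<in> N"
      unfolding N_def by (rule generate.incl) (use that in \<open>unfold tensor_relations_def, blast\<close>)
    then show ?thesis by simp
  qed
  have wH: "frag_cmul n (frag_of w) \<in> carrier ?H" for n
    using keys_cmul[of n "frag_of w"] by simp
  define e where "e x = frag_of (x, frag_of w)" for x :: 'a
  have e_mult: "e (x \<otimes>\<^bsub>G\<^esub> y) - e x - e y \<in> N" if "x \<in> carrier G" "y \<in> carrier G" for x y
    unfolding e_def using rel1[OF that] wH[of 1] by simp
  have e_one: "e \<one>\<^bsub>G\<^esub> \<in> N"
    using e_mult[of "\<one>\<^bsub>G\<^esub>" "\<one>\<^bsub>G\<^esub>"] N0(3)[of "- e \<one>\<^bsub>G\<^esub>"] by simp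
  obtain h where h: "h \<in> hom ?F G"
    "\<And>p. p \<in> carrier G \<times> carrier ?H \<Longrightarrow> h (frag_of p) = fst p [^]\<^bsub>G\<^esub> Poly_Mapping.lookup (snd p) w"
  proof (rule G.free_Abelian_group_universal)
    show "(\<lambda>p. fst p [^]\<^bsub>G\<^esub> Poly_Mapping.lookup (snd p) w) ` (carrier G \<times> carrier ?H) \<subseteq> carrier G"
      by auto
  qed blast
  interpret h: group_hom ?F G h using h(1) by (simp add: group_hom_def group_hom_axioms_def)
  have h_diff: "h (x - y) = h x \<otimes>\<^bsub>G\<^esub> inv\<^bsub>G\<^esub> h y"
    if "Poly_Mapping.keys x \<subseteq> carrier G \<times> carrier ?H" "Poly_Mapping.keys y \<subseteq> carrier G \<times> carrier ?H"
        for x y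
    using h.hom_mult[of x "- y"] h.hom_inv[of y] that by simp
  \<comment> \<open>The error term \<open>r\<close> is additive in the exponent modulo
    \<open>N\<close> and lies in \<open>N\<close> for exponent 1; induction upwards and downwards
    from 1 covers all integers.\<close>
  have pw: "frag_of (x, frag_cmul n (frag_of w)) - e (x [^]\<^bsub>G\<^esub> n) \<in> N" if x: "x \<in> carrier G"
      for x and n :: int
  proof -
    define r where "r n = frag_of (x, frag_cmul n (frag_of w)) - e (x [^]\<^bsub>G\<^esub> n)" for n :: int
    have add: "r (m + n) - r m - r n \<in> N" for m n
    proof -
      have 1: "frag_of (x, frag_cmul (m + n) (frag_of w)) - frag_of (x, frag_cmul m (frag_of w))
          - frag_of (x, frag_cmul n (frag_of w)) \<in> N"
        unfolding frag_cmul_distrib by (rule rel2[OF x wH wH])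
      have 2: "e (x [^]\<^bsub>G\<^esub> (m + n)) - e (x [^]\<^bsub>G\<^esub> m) - e (x [^]\<^bsub>G\<^esub> n) \<in> N"
        unfolding G.int_pow_mult[OF x] by (rule e_mult) (use x in simp_all)
      show ?thesis using N0(2)[OF 1 2] unfolding r_def by (simp add: algebra_simps)
    qed
    have r1: "r 1 \<in> N" using N0(1) x by (simp add: r_def e_def)
    have "r n \<in> N"
    proof (induction n rule: int_induct[where k = 1])
      case base
      show ?case by (rule r1)
    next
      case (step1 i)
      from N0(4)[OF add[of i 1] N0(4)[OF step1(2) r1]] show ?case by simp
    next
      case (step2 i)
      from N0(2)[OF N0(2)[OF step2(2) r1] add[of "i - 1" 1]] show ?case by simp
    qed
    then show ?thesis by (simp add: r_def)
  qed
  have normal_form: "c - e (h c) \<in> N" if "Poly_Mapping.keys c \<subseteq> carrier G \<times> carrier ?H" for c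
  proof (rule free_Abelian_group_induct[OF that])
    have "h 0 = \<one>\<^bsub>G\<^esub>" using h.hom_one by simp
    then show "0 - e (h 0) \<in> N" using N0(3)[OF e_one] by simp
  next
    fix x y
    assume 2: "Poly_Mapping.keys x \<subseteq> carrier G \<times> carrier ?H" "Poly_Mapping.keys y \<subseteq> carrier G \<times>
        carrier ?H"
      "x - e (h x) \<in> N" "y - e (h y) \<in> N"
    have c: "h x \<in> carrier G" "h y \<in> carrier G" using 2(1,2) h.hom_closed by simp_all
    let ?g = "h x \<otimes>\<^bsub>G\<^esub> inv\<^bsub>G\<^esub> h y"
    have "?g \<otimes>\<^bsub>G\<^esub> h y = h x" using c by (simp add: G.m_assoc)
    then have "e (h x) - e ?g - e (h y) \<in> N" using e_mult[of ?g "h y"] c by simp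
    from N0(4)[OF this N0(2)[OF 2(3,4)]] show "x - y - e (h (x - y)) \<in> N"
      unfolding h_diff[OF 2(1,2)] by (simp add: algebra_simps)
  next
    fix p assume 3: "p \<in> carrier G \<times> carrier ?H"
    obtain x y where p: "p = (x, y)" "x \<in> carrier G" "Poly_Mapping.keys y \<subseteq> {w}" using 3 by auto
    have "y = frag_cmul (Poly_Mapping.lookup y w) (frag_of w)"
    proof (rule poly_mapping_eqI)
      fix k
      show "Poly_Mapping.lookup y k = Poly_Mapping.lookup (frag_cmul (Poly_Mapping.lookup y w)
          (frag_of w)) k"
        using p(3) by (cases "k = w") (auto simp: in_keys_iff)
    qed
    then show "frag_of p - e (h (frag_of p)) \<in> N"
        using pw[OF p(2), of "Poly_Mapping.lookup y w"] h(2)[OF 3] p(1) by simp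
  qed
  have "kernel ?F G h = N"
  proof (intro subset_antisym subsetI)
    fix c assume "c \<in> kernel ?F G h"
    then have "Poly_Mapping.keys c \<subseteq> carrier G \<times> carrier ?H" "h c = \<one>\<^bsub>G\<^esub>" by (simp_all add: kernel_def)
    then show "c \<in> N" using N0(4)[OF normal_form e_one, of c] by simp
  next
    have "tensor_relations G ?H \<subseteq> kernel ?F G h"
    proof
      fix r assume r: "r \<in> tensor_relations G ?H"
      then have rF: "r \<in> carrier ?F" using tensor_relations_carrier[OF G H] by blast
      have h3: "h (frag_of p - frag_of q - frag_of q')
          = h (frag_of p) \<otimes>\<^bsub>G\<^esub> inv\<^bsub>G\<^esub> h (frag_of q) \<otimes>\<^bsub>G\<^esub> inv\<^bsub>G\<^esub> h (frag_of q')"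
        if "p \<in> carrier G \<times> carrier ?H" "q \<in> carrier G \<times> carrier ?H" "q' \<in> carrier G \<times> carrier ?H"
            for p q q'
      proof -
        have "Poly_Mapping.keys (frag_of p - frag_of q) \<subseteq> carrier G \<times> carrier ?H"
          using keys_diff[of "frag_of p" "frag_of q"] that by auto
        then show ?thesis using h_diff[of "frag_of p - frag_of q" "frag_of q'"]
            h_diff[of "frag_of p" "frag_of q"] that by simp
      qed
      have cancel: "a \<otimes>\<^bsub>G\<^esub> b \<otimes>\<^bsub>G\<^esub> inv\<^bsub>G\<^esub> a \<otimes>\<^bsub>G\<^esub> inv\<^bsub>G\<^esub> b = \<one>\<^bsub>G\<^esub>" if "a \<in> carrier G" "b \<in> carrier G"
          for a b
      proof -
        have "a \<otimes>\<^bsub>G\<^esub> b \<otimes>\<^bsub>G\<^esub> inv\<^bsub>G\<^esub> a = b"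
          using that G.m_comm[of a b] by (simp add: G.m_assoc)
        then show ?thesis using that by simp
      qed
      from r consider (left) x x' y where "r = frag_of (x \<otimes>\<^bsub>G\<^esub> x', y) - frag_of (x, y) - frag_of (x', y)"
          "x \<in> carrier G" "x' \<in> carrier G" "y \<in> carrier ?H"
        | (right) x y y' where "r = frag_of (x, y \<otimes>\<^bsub>?H\<^esub> y') - frag_of (x, y) - frag_of (x, y')"
          "x \<in> carrier G" "y \<in> carrier ?H" "y' \<in> carrier ?H"
        unfolding tensor_relations_def by blast
      then have "h r = \<one>\<^bsub>G\<^esub>"
      proof cases
        case left
        then show ?thesis
          using h3[of "(x \<otimes>\<^bsub>G\<^esub> x', y)" "(x, y)" "(x', y)"] h(2)[of "(x \<otimes>\<^bsub>G\<^esub> x', y)"] h(2)[of "(x, y)"]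
            h(2)[of "(x', y)"] cancel[of "x [^]\<^bsub>G\<^esub> Poly_Mapping.lookup y w" "x' [^]\<^bsub>G\<^esub>
                Poly_Mapping.lookup y w"]
          by (simp add: G.int_pow_distrib)
      next
        case right
        have yy: "y \<otimes>\<^bsub>?H\<^esub> y' \<in> carrier ?H"
          using right(3,4) group.is_monoid[OF group_free_Abelian_group] monoid.m_closed by metis
        show ?thesis
          using right h3[of "(x, y \<otimes>\<^bsub>?H\<^esub> y')" "(x, y)" "(x, y')"] h(2)[of "(x, y \<otimes>\<^bsub>?H\<^esub> y')"] h(2)[of
              "(x, y)"]
            h(2)[of "(x, y')"] cancel[of "x [^]\<^bsub>G\<^esub> Poly_Mapping.lookup y w" "x [^]\<^bsub>G\<^esub>
                Poly_Mapping.lookup y' w"] yy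
          by (simp add: G.int_pow_mult lookup_add)
      qed
      then show "r \<in> kernel ?F G h" using rF by (simp add: kernel_def)
    qed
    from F.generate_subgroup_incl[OF this h.subgroup_kernel] show "c \<in> N \<Longrightarrow> c \<in> kernel ?F G h" for c
      unfolding N_def by blast
  qed
  moreover have "h ` carrier ?F = carrier G"
  proof (intro subset_antisym subsetI)
    fix x assume x: "x \<in> carrier G"
    have "h (e x) = x" using h(2)[of "(x, frag_of w)"] x by (simp add: e_def)
    moreover have "e x \<in> carrier ?F" using x by (simp add: e_def)
    ultimately show "x \<in> h ` carrier ?F" by (metis imageI)
  qed (use h.hom_closed in auto)
  ultimately have "?F Mod N \<cong> G"
    by (intro iso_from_kernel[OF _ _ h(1)]) (simp_all add: G.is_group)
  then show ?thesis by (simp add: tensor_def N_def)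
qed

text \<open>\<open>W\<close> is infinite cyclic in degrees 2 and -2 and trivial elsewhere, so only
  the summands \<open>k = j - 2\<close> and \<open>k = j + 2\<close> survive.\<close>

lemma graded_tensor_W:
  fixes G :: "'a graded"
  assumes G: "\<And>k. comm_group (G k)"
  shows "(G \<otimes>\<^sub>g W) j \<cong> G (j - 2) \<times>\<times> G (j + 2)"
proof -
  let ?T = "\<lambda>k. tensor (G k) (W (j - k))"
  have W: "comm_group (W k)" for k by (simp add: W_def abelian_free_Abelian_group)
  have T: "comm_group (?T k)" for k by (rule comm_group_tensor[OF G W])
  have wd: "{w. wdeg w = k} = (if k = 2 then {Wplus} else if k = -2 then {Wminus} else {})" for k
  proof (rule Set.set_eqI)
    fix w
    show "w \<in> {w. wdeg w = k} \<longleftrightarrow> w \<in> (if k = 2 then {Wplus} else if k = -2 then {Wminus} else {})"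
      by (cases w) auto
  qed
  have "sum_group UNIV ?T \<cong> ?T (j - 2) \<times>\<times> ?T (j + 2)"
  proof (rule sum_group_two)
    fix k assume k: "k \<noteq> j - 2" "k \<noteq> j + 2"
    then have "W (j - k) = free_Abelian_group {}" by (simp add: W_def wd)
    then have "carrier (W (j - k)) = {\<one>\<^bsub>W (j - k)\<^esub>}" by (simp add: free_Abelian_group_def)
    then show "trivial_group (?T k)" by (rule tensor_trivial_right[OF G W])
  qed (use T in \<open>simp_all add: comm_group_def\<close>)
  moreover have "?T (j - 2) \<cong> G (j - 2)" "?T (j + 2) \<cong> G (j + 2)"
    using tensor_free_singleton[OF G] by (simp_all add: W_def wd)
  then have "?T (j - 2) \<times>\<times> ?T (j + 2) \<cong> G (j - 2) \<times>\<times> G (j + 2)"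
    using T[of "j - 2"] by (intro group.DirProd_iso_trans) (simp_all add: comm_group_def)
  ultimately show ?thesis unfolding graded_tensor_def by (rule iso_trans)
qed

lemma graded_tensor_zero:
  assumes G: "\<And>k. comm_group (G k)"
  shows "trivial_group ((G \<otimes>\<^sub>g zero_graded) j)"
  unfolding graded_tensor_def
proof (rule sum_group_trivial)
  fix k
  show "trivial_group (tensor (G k) (zero_graded (j - k)))"
    unfolding zero_graded_def
    by (rule tensor_trivial_right[OF G singleton_abelian_group]) (simp add: singleton_group_def)
qed

lemma DirProd_trivial_right:
  assumes "group G" "trivial_group H"
  shows "G \<times>\<times> H \<cong> G"
proof -
  have "fst \<in> iso (G \<times>\<times> H) G"
    using assms by (auto simp: trivial_group_def iso_def hom_def bij_betw_def inj_on_def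
        mult_DirProd' intro: rev_image_eqI)
  then show ?thesis unfolding is_iso_def by blast
qed

lemma group_graded_tensor:
  assumes "\<And>k. comm_group (G k)" "\<And>k. comm_group (H k)"
  shows "group ((G \<otimes>\<^sub>g H) j)"
  unfolding graded_tensor_def using comm_group_tensor[OF assms] by (simp add: comm_group_def)

lemma comm_group_W: "comm_group (W k)"
  by (simp add: W_def abelian_free_Abelian_group)

section \<open>Adding a circle\<close>

lemma (in diagram) homology_quotient:
  assumes "crossing_order D cs"
  shows "add_quotient {x \<in> bracket_chains D i j. bracket_boundary D cs x
      = 0} (bracket_boundary D cs ` bracket_chains D (\<not> i) j)"
proof
  have diff: "bracket_boundary D cs (x - y) = bracket_boundary D cs x - bracket_boundary D cs y" for x y
    by (simp add: bracket_boundary_def frag_extend_diff)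
  have zero: "bracket_boundary D cs 0 = 0" by (simp add: bracket_boundary_def)
  note sub = add_subgroupD[OF add_subgroup_bracket_chains[of D]]
  show "add_subgroup {x \<in> bracket_chains D i j. bracket_boundary D cs x = 0}"
    unfolding add_subgroup_def using sub by (simp add: diff zero)
  show "add_subgroup (bracket_boundary D cs ` bracket_chains D (\<not> i) j)"
    unfolding add_subgroup_def
  proof (intro conjI ballI)
    show "0 \<in> bracket_boundary D cs ` bracket_chains D (\<not> i) j"
      by (rule image_eqI[of _ _ 0]) (simp_all add: zero sub)
    fix x y assume "x \<in> bracket_boundary D cs ` bracket_chains D (\<not> i) j" "y \<in> bracket_boundary D cs
        ` bracket_chains D (\<not> i) j"
    then obtain u v where "u \<in> bracket_chains D (\<not> i) j" "v \<in> bracket_chains D (\<not> i) j"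
      "x = bracket_boundary D cs u" "y = bracket_boundary D cs v" by blast
    then show "x - y \<in> bracket_boundary D cs ` bracket_chains D (\<not> i) j"
      by (intro image_eqI[of _ _ "u - v"]) (simp_all add: diff sub)
  qed
  show "bracket_boundary D cs ` bracket_chains D (\<not> i) j \<subseteq> {x \<in> bracket_chains D i j.
      bracket_boundary D cs x = 0}"
  proof
    fix x assume "x \<in> bracket_boundary D cs ` bracket_chains D (\<not> i) j"
    then obtain u where u: "u \<in> bracket_chains D (\<not> i) j" "x = bracket_boundary D cs u" by blast
    then show "x \<in> {x \<in> bracket_chains D i j. bracket_boundary D cs x = 0}"
      using bracket_chains_boundary[OF u(1), of cs] boundary_boundary[OF assms
          bracket_chains_generators[OF u(1)]] by simp
  qed
qed

lemma (in diagram) comm_group_homology: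
  "crossing_order D cs \<Longrightarrow> comm_group (bracket_homology D cs i j)"
  unfolding bracket_homology_def by (rule add_quotient.comm_group_Q[OF homology_quotient])

section \<open>Components of a disjoint union\<close>

lemma component_union_left:
  assumes K: "\<And>x. x \<in> edges K \<union> set ` verts K \<Longrightarrow> x \<subseteq> S"
    and L: "\<And>x. x \<in> edges L \<union> set ` verts L \<Longrightarrow> x \<inter> S = {}" and h: "h \<in> S"
  shows "component (diagram_union K L) h = component K h"
proof (intro subset_antisym subsetI)
  fix y assume "y \<in> component (diagram_union K L) h"
  then have "(h, y) \<in> (adjacent (diagram_union K L))\<^sup>*" by (simp add: component_def)
  then have "y \<in> S \<and> (h, y) \<in> (adjacent K)\<^sup>*"
  proof (induction rule: rtrancl_induct)
    case (step y z)
    from step.hyps(2) obtain x where x: "x \<in> edges (diagram_union K L) \<union> set ` verts (diagram_union K L)"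
      "y \<in> x" "z \<in> x" by (auto simp: adjacent_def)
    have "x \<notin> edges L \<union> set ` verts L" using L[of x] x(2) step.IH by blast
    then have xK: "x \<in> edges K \<union> set ` verts K" using x(1) by (auto simp: diagram_union_def)
    then have "z \<in> S" using K x(3) by blast
    moreover have "(y, z) \<in> adjacent K" using xK x(2,3) unfolding adjacent_def by blast
    ultimately show ?case using step.IH by (meson rtrancl.rtrancl_into_rtrancl)
  qed (use h in simp)
  then show "y \<in> component K h" by (simp add: component_def)
next
  fix y assume "y \<in> component K h"
  moreover have "adjacent K \<subseteq> adjacent (diagram_union K L)"
    unfolding adjacent_def diagram_union_def by auto
  ultimately show "y \<in> component (diagram_union K L) h"
    using rtrancl_mono unfolding component_def by blast
qed

lemma diagram_union_commute: "diagram_union K L = diagram_union L K"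
  by (simp add: diagram_union_def Un_commute)

lemma diagram_sets:
  assumes "link_diagram K" "x \<in> edges K \<union> set ` verts K"
  shows "x \<subseteq> darts K"
  using assms unfolding link_diagram_def darts_def by blast

lemma unknot_component:
  assumes U: "crossingless_unknot U"
  shows "components U = {darts U}" "h \<in> darts U \<Longrightarrow> component U h = darts U" "darts U \<noteq> {}"
proof -
  have l: "link_diagram U" and "card (components U) = 1" using U
      by (simp_all add: crossingless_unknot_def)
  then obtain X where X: "components U = {X}" by (auto simp: card_1_singleton_iff)
  then show ne: "darts U \<noteq> {}" by (auto simp: components_def)
  have comp: "component U h = X" if "h \<in> darts U" for h using X that by (auto simp: components_def)
  have "y \<in> darts U" if "h \<in> darts U" "(h, y) \<in> (adjacent U)\<^sup>*" for h y
    using that(2)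
  proof (induction rule: rtrancl_induct)
    case (step y z)
    then obtain x where "x \<in> edges U \<union> set ` verts U" "z \<in> x" by (auto simp: adjacent_def)
    then show ?case using diagram_sets[OF l] by blast
  qed (rule that(1))
  then have "X \<subseteq> darts U" using ne comp unfolding component_def by blast
  moreover have "darts U \<subseteq> X"
  proof
    fix h assume h: "h \<in> darts U"
    have "h \<in> component U h" by (simp add: component_def)
    then show "h \<in> X" using comp[OF h] by simp
  qed
  ultimately have "X = darts U" by blast
  then show "components U = {darts U}" "h \<in> darts U \<Longrightarrow> component U h = darts U" using X comp by simp_all
qed

lemma unknot_no_crossing: "crossingless_unknot U \<Longrightarrow> v \<in> verts U \<Longrightarrow> length v \<noteq> 4"
  unfolding crossingless_unknot_def crossings_def by blast

section \<open>The complex of a diagram with an additional circle\<close>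

locale diagram_and_circle = diagram D for D :: "'h diagram" +
  fixes U :: "'h diagram"
  assumes U: "crossingless_unknot U" and disj: "darts D \<inter> darts U = {}"
begin

abbreviation E :: "'h diagram"
  where "E \<equiv> diagram_union D U"

abbreviation V :: "'h set"
  where "V \<equiv> darts U"

lemma crossings_E: "crossings E = crossings D"
  using unknot_no_crossing[OF U] by (auto simp: crossings_def diagram_union_def)

lemma resolution_E: "resolution E s = diagram_union (resolution D s) U"
proof -
  have "verts U \<inter> crossings D = {}" using unknot_no_crossing[OF U] by (auto simp: crossings_def)
  then have "verts E - crossings E = (verts D - crossings D) \<union> verts U"
    unfolding crossings_E by (auto simp: diagram_union_def)
  then show ?thesis by (simp add: resolution_def crossings_E) (simp add: diagram_union_def Un_ac)
qed

lemma resolution_sets: "x \<in> edges (resolution D s) \<union> set ` verts (resolution D s) \<Longrightarrow> x \<subseteq> darts D"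
  using Union_arcs[of s] unfolding arcs_def by (auto simp: resolution_def darts_def)

lemma unknot_sets: "x \<in> edges U \<union> set ` verts U \<Longrightarrow> x \<subseteq> V"
  using U by (intro diagram_sets) (simp_all add: crossingless_unknot_def)

lemma component_E: "h \<in> darts D \<Longrightarrow> component (resolution E s) h = R s h"
  unfolding resolution_E
  by (rule component_union_left[where S = "darts D"]) (use resolution_sets unknot_sets disj in blast)+

lemma component_E_circle: "h \<in> V \<Longrightarrow> component (resolution E s) h = V"
proof -
  assume h: "h \<in> V"
  have "component (diagram_union U (resolution D s)) h = component U h"
    by (rule component_union_left[where S = V]) (use resolution_sets unknot_sets disj h in blast)+
  then show ?thesis
    unfolding resolution_E diagram_union_commute[of "resolution D s" U]
        using unknot_component(2)[OF U h] by simp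
qed

lemma circles_E: "circles E s = insert V (circles D s)"
proof -
  have "darts (resolution E s) = darts D \<union> V"
    by (simp add: resolution_def diagram_union_def darts_def)
  moreover have "component (resolution E s) ` V = {V}"
    using component_E_circle unknot_component(3)[OF U] by auto
  moreover have "component (resolution E s) ` darts D = R s ` darts D"
    using component_E by auto
  ultimately show ?thesis by (simp add: components_def image_Un)
qed

lemma R_ne_V: "h \<in> darts D \<Longrightarrow> R s h \<noteq> V"
proof
  assume h: "h \<in> darts D" "R s h = V"
  have "h \<in> R s h" by (simp add: component_def)
  then show False using h disj by auto
qed

lemma V_notin: "V \<notin> circles D s"
  using R_ne_V by (auto simp: circles_eq)

lemma num_E: "num_A E s = num_A D s" "num_B E s = num_B D s" "all_A E = all_A D" "states E = states D"
  by (simp_all add: num_A_def num_B_def all_A_def states_def crossings_E)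

text \<open>The circle \<open>V\<close> occurs in every state, so the all-A state gains a circle;
  this reverses the parity and is the origin of \<open>spade\<close>. Resetting \<open>V\<close> to
  \<open>undefined\<close> removes its label, and the degree of that label is the shift.\<close>

lemma gens_E:
  "(s, \<delta>) \<in> gens E (of_bool i) j \<longleftrightarrow>
    (s, \<delta>(V := undefined)) \<in> gens D (of_bool (\<not> i)) (j - wdeg (\<delta> V))"
proof -
  have fin: "finite (circles D s)" for s by (simp add: circles_eq)
  have "\<delta> \<in> circles E s \<rightarrow>\<^sub>E UNIV \<longleftrightarrow> \<delta>(V := undefined) \<in> circles D s \<rightarrow>\<^sub>E UNIV"
    using V_notin[of s] unfolding circles_E by (auto simp: PiE_def extensional_def)
  then have gen: "(s, \<delta>) \<in> generators E \<longleftrightarrow> (s, \<delta>(V := undefined)) \<in> generators D"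
    by (simp add: generators_def num_E)
  have "(\<Sum>C \<in> circles E s. wdeg (\<delta> C)) = wdeg (\<delta> V) + (\<Sum>C \<in> circles D s. wdeg (\<delta> C))"
    unfolding circles_E using fin V_notin by simp
  also have "(\<Sum>C \<in> circles D s. wdeg (\<delta> C)) = (\<Sum>C \<in> circles D s. wdeg ((\<delta>(V := undefined)) C))"
    by (rule sum.cong) (use V_notin[of s] in auto)
  finally have deg: "gdeg E (s, \<delta>) = wdeg (\<delta> V) + gdeg D (s, \<delta>(V := undefined))"
    by (simp only: gdeg.simps num_E)
  have "card (circles E (all_A E)) = Suc (card (circles D (all_A D)))"
    unfolding circles_E num_E using fin V_notin by simp
  moreover have "Suc n mod 2 = of_bool i \<longleftrightarrow> n mod 2 = of_bool (\<not> i)" for n :: nat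
    by (cases i) (auto simp: mod_Suc)
  ultimately have "(num_B E s + card (circles E (all_A E))) mod 2 = of_bool i \<longleftrightarrow>
      (num_B D s + card (circles D (all_A D))) mod 2 = of_bool (\<not> i)"
    unfolding num_E by (simp only: add_Suc_right)
  then show ?thesis unfolding gens_def using gen deg by (auto simp del: gdeg.simps fun_upd_apply)
qed

text \<open>No crossing touches \<open>V\<close>, so its label \<open>w\<close> is carried along
  unchanged.\<close>

lemma label_map_E:
  assumes c: "c \<in> crossings D"
  shows "label_map (resolution E s) (resolution E t) c (\<epsilon>(V := w)) =
    frag_extend (\<lambda>\<delta>. frag_of (\<delta>(V := w))) (label_map (resolution D s) (resolution D t) c \<epsilon>)"
proof -
  have d: "c ! 0 \<in> darts D" "c ! 2 \<in> darts D"
    using crossing_darts[OF c, of 0] crossing_darts[OF c, of 2] by simp_all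
  have lab: "restrict ((\<epsilon>(V := w))(P := x)) (insert V (circles D t))
      = (restrict (\<epsilon>(P := x)) (circles D t))(V := w)"
    if "P \<noteq> V" for P x
    using that V_notin[of t] by (auto simp: fun_eq_iff)
  have lab2: "restrict ((\<epsilon>(V := w))(P := x, Q := y)) (insert V (circles D t)) =
      (restrict (\<epsilon>(P := x, Q := y)) (circles D t))(V := w)" if "P \<noteq> V" "Q \<noteq> V" for P Q x y
    using that V_notin[of t] by (auto simp: fun_eq_iff)
  show ?thesis
    unfolding label_map_def Let_def component_E[OF d(1)] component_E[OF d(2)] circles_E
    using R_ne_V[OF d(1), of s] R_ne_V[OF d(2), of s] R_ne_V[OF d(1), of t] R_ne_V[OF d(2), of t]
    by (simp add: frag_extend_frag_extend lab lab2 case_prod_unfold)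
qed

text \<open>Up to order signs, \<open>f w\<close> gives the extra circle the label \<open>w\<close>
  and \<open>g w\<close> extracts the part with that label. They split the chains of
  \<open>E\<close> into two copies of those of \<open>D\<close>, and all facts about the
  differential of \<open>E\<close> are derived from this. The isomorphism comes from a surjection
  \<open>h\<close> of the cycles onto the product of two homology groups, with the boundaries as its
  kernel.\<close>

lemma homology_E:
  assumes cs: "crossing_order D cs" and cs': "crossing_order E cs'"
  shows "bracket_homology E cs' i j \<cong>
    bracket_homology D cs (\<not> i) (j - 2) \<times>\<times> bracket_homology D cs (\<not> i) (j + 2)"
proof -
  have o: "distinct cs" "distinct cs'" "set cs = set cs'" "set cs = crossings D"
    using cs cs' by (auto simp: crossing_order_def crossings_E)
  define \<eta> where "\<eta> = order_sign cs cs'"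
  have \<eta>: "\<eta> s * \<eta> s = 1" "\<eta> s \<noteq> 0" for s by (simp_all add: \<eta>_def)
  let ?dD = "bracket_boundary D cs" and ?dE = "bracket_boundary E cs'"
  define f :: "sign \<Rightarrow> ('h generator \<Rightarrow>\<^sub>0 int) \<Rightarrow> 'h generator \<Rightarrow>\<^sub>0 int"
    where "f w = relabel \<eta> id (\<lambda>\<epsilon>. \<epsilon>(V := w))" for w
  define g :: "sign \<Rightarrow> ('h generator \<Rightarrow>\<^sub>0 int) \<Rightarrow> 'h generator \<Rightarrow>\<^sub>0 int"
    where "g w = frag_extend (\<lambda>(s, \<delta>). if \<delta> V = w
    then frag_cmul (\<eta> s) (frag_of (s, \<delta>(V := undefined))) else 0)" for w
  have d_diff: "?dD (x - y) = ?dD x - ?dD y" "?dE (u - v) = ?dE u - ?dE v"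
    "?dD (x + y) = ?dD x + ?dD y" "?dE (u + v) = ?dE u + ?dE v" "?dE 0 = 0" for x y u v
    by (simp_all add: bracket_boundary_def frag_extend_diff frag_extend_add)
  have f_add: "f w 0 = 0" for w by (simp add: f_def relabel_def)
  have g_add: "g w (x + y) = g w x + g w y" "g w (x - y) = g w x - g w y" "g w 0 = 0" for w x y
    by (simp_all add: g_def frag_extend_add frag_extend_diff)
  have f_mem: "f w x \<in> bracket_chains E (\<not> k) l" if "x \<in> bracket_chains D k (l - wdeg w)" for w x k l
    unfolding bracket_chains_def mem_Collect_eq
  proof
    fix p assume "p \<in> Poly_Mapping.keys (f w x)"
    then obtain s \<epsilon> where p: "(s, \<epsilon>) \<in> Poly_Mapping.keys x" "p = (s, \<epsilon>(V := w))"
      unfolding f_def by (rule keys_relabel) simp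
    have gen: "(s, \<epsilon>) \<in> gens D (of_bool k) (l - wdeg w)" using p(1) that
        by (auto simp: bracket_chains_def)
    then have "\<epsilon> V = undefined"
      using V_notin[of s] by (simp add: gens_def generators_def PiE_def extensional_def)
    then have "\<epsilon>(V := w, V := undefined) = \<epsilon>" by (simp add: fun_upd_idem)
    then show "p \<in> gens E (of_bool (\<not> k)) l"
      unfolding p(2) gens_E using gen by simp
  qed
  have g_mem: "g w y \<in> bracket_chains D (\<not> k) (l - wdeg w)" if "y \<in> bracket_chains E k l" for w y k l
    unfolding bracket_chains_def mem_Collect_eq
  proof
    fix p assume "p \<in> Poly_Mapping.keys (g w y)"
    then obtain q where q: "q \<in> Poly_Mapping.keys y" "p \<in> Poly_Mapping.keys
        (case q of (s, \<delta>) \<Rightarrow> if \<delta> V = w then frag_cmul (\<eta> s) (frag_of (s, \<delta>(V := undefined))) else 0)"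
      using keys_frag_extend unfolding g_def by fast
    obtain s \<delta> where sd: "q = (s, \<delta>)" by (cases q)
    have "\<delta> V = w" "p = (s, \<delta>(V := undefined))" using q(2) by (simp_all add: sd split: if_splits)
    moreover have "(s, \<delta>) \<in> gens E (of_bool k) l" using q(1) that by (auto simp: bracket_chains_def sd)
    ultimately show "p \<in> gens D (of_bool (\<not> k)) (l - wdeg w)" using gens_E[of s \<delta> k l] by simp
  qed
  have gf: "g w (f w' x) = (if w = w' then x else 0)" if "x \<in> bracket_chains D k l" for w w' x k l
  proof -
    have e: "g w (f w' x) = frag_extend (\<lambda>(s, \<epsilon>). if w' = w
        then frag_cmul (\<eta> s * \<eta> s) (frag_of (s, \<epsilon>(V := w', V := undefined))) else 0) x"
      unfolding g_def f_def relabel_def frag_extend_frag_extend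
      by (rule frag_extend_eq) (simp add: case_prod_unfold frag_extend_cmul)
    show ?thesis
    proof (cases "w = w'")
      case True
      have "frag_extend (\<lambda>(s, \<epsilon>). if w' = w
          then frag_cmul (\<eta> s * \<eta> s) (frag_of (s, \<epsilon>(V := w', V := undefined))) else 0) x = x"
      proof (rule frag_extend_id)
        fix p assume p: "p \<in> Poly_Mapping.keys x"
        obtain s \<epsilon> where se: "p = (s, \<epsilon>)" by (cases p)
        have "(s, \<epsilon>) \<in> gens D (of_bool k) l" using p that by (auto simp: bracket_chains_def se)
        then have "\<epsilon> V = undefined"
          using V_notin[of s] by (simp add: gens_def generators_def PiE_def extensional_def)
        then have "\<epsilon>(V := w', V := undefined) = \<epsilon>" by (simp add: fun_upd_idem)
        then show "(case p of (s, \<epsilon>) \<Rightarrow> if w' = w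
          then frag_cmul (\<eta> s * \<eta> s) (frag_of (s, \<epsilon>(V := w', V := undefined))) else 0) = frag_of p"
          using True \<eta> by (simp add: se)
      qed
      then show ?thesis using e True by simp
    next
      case False
      then show ?thesis unfolding e by (simp add: case_prod_unfold frag_extend_eq_0)
    qed
  qed
  \<comment> \<open>Every label of \<open>V\<close> is \<open>Wplus\<close> or
    \<open>Wminus\<close>, and the sign is applied twice, so it cancels.\<close>
  have fg: "f Wplus (g Wplus y) + f Wminus (g Wminus y) = y" for y
  proof -
    have "f w (g w y) = frag_extend (\<lambda>(s, \<delta>). if \<delta> V = w then frag_of (s, \<delta>) else 0) y" for w
      unfolding g_def f_def relabel_def frag_extend_frag_extend
      by (rule frag_extend_eq) (auto simp: case_prod_unfold frag_extend_cmul \<eta>)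
    then have "f Wplus (g Wplus y) + f Wminus (g Wminus y) = frag_extend (\<lambda>p.
        (case p of (s, \<delta>) \<Rightarrow> if \<delta> V = Wplus then frag_of (s, \<delta>) else 0) +
        (case p of (s, \<delta>) \<Rightarrow> if \<delta> V = Wminus then frag_of (s, \<delta>) else 0)) y"
      by (simp add: frag_extend_plus)
    also have "\<dots> = y"
    proof (rule frag_extend_id)
      fix p :: "'h generator"
      obtain s \<delta> where "p = (s, \<delta>)" by (cases p)
      then show "(case p of (s, \<delta>) \<Rightarrow> if \<delta> V = Wplus then frag_of (s, \<delta>) else 0) +
        (case p of (s, \<delta>) \<Rightarrow> if \<delta> V = Wminus then frag_of (s, \<delta>) else 0) = frag_of p"
        by (cases "\<delta> V") simp_all
    qed
    finally show ?thesis .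
  qed
  have fd: "?dE (f w x) = f w (?dD x)" for w x
    unfolding f_def
  proof (rule boundary_relabel[where G = UNIV])
    fix s :: "'h state" and \<epsilon> c assume "c \<in> crossings E" "id s c = MarkA"
    then have c: "c \<in> crossings D" "s c = MarkA" by (simp_all add: crossings_E)
    show "c \<in> crossings D \<and> s c = MarkA" using c by simp
    show "edge_sign cs' c (id s) * \<eta> s = \<eta> (s(c := MarkB)) * edge_sign cs c s"
      using edge_sign_order_sign[OF o(1-3), of c s] c o(4) by (simp add: \<eta>_def)
    show "label_map (resolution E (id s)) (resolution E ((id s)(c := MarkB))) c (\<epsilon>(V := w)) =
      frag_extend (\<lambda>\<delta>. frag_of (\<delta>(V := w))) (label_map (resolution D s) (resolution D (s(c :=
          MarkB))) c \<epsilon>)"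
      unfolding id_apply by (rule label_map_E[OF c(1)])
  qed (use \<eta> in \<open>simp_all add: crossings_E\<close>)
  \<comment> \<open>The decomposition \<open>fg\<close> and the chain map property of
    \<open>f\<close> determine the boundary of \<open>y\<close>; applying \<open>g w\<close> then
    singles out one label.\<close>
  have gd: "g w (?dE y) = ?dD (g w y)" if y: "y \<in> bracket_chains E k l" for w y k l
  proof -
    have "?dE y = f Wplus (?dD (g Wplus y)) + f Wminus (?dD (g Wminus y))"
      using d_diff(4)[of "f Wplus (g Wplus y)" "f Wminus (g Wminus y)"] unfolding fg fd .
    moreover have m: "?dD (g v y) \<in> bracket_chains D k (l - wdeg v)" for v
      using bracket_chains_boundary[OF g_mem[OF y], of cs v] by simp
    ultimately show ?thesis by (cases w) (simp_all add: g_add gf[OF m])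
  qed
  have dE_mem: "?dE y \<in> bracket_chains E (\<not> k) l" if y: "y \<in> bracket_chains E k l" for y k l
  proof -
    have "?dE y = f Wplus (?dD (g Wplus y)) + f Wminus (?dD (g Wminus y))"
      using d_diff(4)[of "f Wplus (g Wplus y)" "f Wminus (g Wminus y)"] unfolding fg fd .
    moreover have "f w (?dD (g w y)) \<in> bracket_chains E (\<not> k) l" for w
      using f_mem[OF bracket_chains_boundary[where cs = cs, OF g_mem[OF y, of w]]] by simp
    ultimately show ?thesis using add_subgroupD(4)[OF add_subgroup_bracket_chains[of E]] by simp
  qed
  define Z where "Z = {y \<in> bracket_chains E i j. ?dE y = 0}"
  define I where "I = ?dE ` bracket_chains E (\<not> i) j"
  define ZD where "ZD l = {x \<in> bracket_chains D (\<not> i) l. ?dD x = 0}" for l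
  define ID where "ID l = ?dD ` bracket_chains D i l" for l
  have Q: "add_quotient (ZD l) (ID l)" for l
    using homology_quotient[OF cs, of "\<not> i" l] by (simp add: ZD_def ID_def)
  have Z: "add_subgroup Z"
    unfolding add_subgroup_def Z_def using add_subgroupD[OF add_subgroup_bracket_chains[of E]]
        by (simp add: d_diff)
  have gZ: "g w y \<in> ZD (j - wdeg w)" if "y \<in> Z" for w y
    using that g_mem[of y i j w] gd[of y i j w] g_add(3) by (simp add: Z_def ZD_def)
  have fZ: "f w x \<in> Z" if "x \<in> ZD (j - wdeg w)" for w x
    using that f_mem[of x "\<not> i" j w] by (simp add: Z_def ZD_def fd f_add)
  define h where "h y = (add_coset (ID (j - 2)) (g Wplus y), add_coset (ID (j + 2)) (g Wminus y))" for y
  let ?H = "(add_group (ZD (j - 2)) Mod ID (j - 2)) \<times>\<times> (add_group (ZD (j + 2)) Mod ID (j + 2))"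
  interpret P: add_quotient "ZD (j - 2)" "ID (j - 2)" by (rule Q)
  interpret M: add_quotient "ZD (j + 2)" "ID (j + 2)" by (rule Q)
  have gZ': "g Wplus y \<in> ZD (j - 2)" "g Wminus y \<in> ZD (j + 2)" if "y \<in> Z" for y
    using gZ[OF that, of Wplus] gZ[OF that, of Wminus] by simp_all
  have "add_group Z Mod I \<cong> ?H"
  proof (rule iso_from_kernel)
    show "group (add_group Z)" using comm_group_add_group[OF Z] by (simp add: comm_group_def)
    show "group ?H" by (rule DirProd_group[OF P.group_Q M.group_Q])
    show "h \<in> hom (add_group Z) ?H"
    proof (rule homI)
      fix y assume "y \<in> carrier (add_group Z)"
      then show "h y \<in> carrier ?H" using gZ' by (simp add: h_def P.carrier_Q M.carrier_Q)
    next
      fix x y assume "x \<in> carrier (add_group Z)" "y \<in> carrier (add_group Z)"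
      then show "h (x \<otimes>\<^bsub>add_group Z\<^esub> y) = h x \<otimes>\<^bsub>?H\<^esub> h y"
        using gZ'[of x] gZ'[of y] by (simp add: h_def g_add P.mult_Q M.mult_Q del: mult_FactGroup)
    qed
    show "kernel (add_group Z) ?H h = I"
    proof (intro subset_antisym subsetI)
      fix y assume "y \<in> kernel (add_group Z) ?H h"
      then have y: "y \<in> Z" "h y = \<one>\<^bsub>?H\<^esub>" by (simp_all add: kernel_def)
      then have "g Wplus y \<in> ID (j - 2)" "g Wminus y \<in> ID (j + 2)"
        using P.eq_one_iff[OF gZ'(1)[OF y(1)]] M.eq_one_iff[OF gZ'(2)[OF y(1)]] by (simp_all add: h_def)
      then obtain u v where u: "u \<in> bracket_chains D i (j - 2)" "g Wplus y = ?dD u"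
        and v: "v \<in> bracket_chains D i (j + 2)" "g Wminus y = ?dD v" by (auto simp: ID_def)
      have "y = ?dE (f Wplus u + f Wminus v)" using fg[of y] u(2) v(2) by (simp add: d_diff fd)
      moreover have "f Wplus u + f Wminus v \<in> bracket_chains E (\<not> i) j"
        using f_mem[of u i j Wplus] f_mem[of v i j Wminus] u(1) v(1)
        by (intro add_subgroupD(4)[OF add_subgroup_bracket_chains]) simp_all
      ultimately show "y \<in> I" unfolding I_def by (rule image_eqI)
    next
      fix y assume "y \<in> I"
      then obtain u where u: "u \<in> bracket_chains E (\<not> i) j" "y = ?dE u" by (auto simp: I_def)
      have gu: "g w y = ?dD (g w u)" "g w u \<in> bracket_chains D i (j - wdeg w)" for w
        using gd[OF u(1)] g_mem[OF u(1)] u(2) by simp_all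
      have in_ID: "g w y \<in> ID (j - wdeg w)" for w unfolding gu(1) ID_def using gu(2) by (rule imageI)
      have y: "y \<in> bracket_chains E i j" using dE_mem[OF u(1)] u(2) by simp
      \<comment> \<open>The differential of \<open>E\<close> squares to zero because it does so in
        \<open>D\<close> for each of the two labels.\<close>
      have "?dD (g w y) = 0" for w
        unfolding gu(1) by (rule boundary_boundary[OF cs bracket_chains_generators[OF gu(2)]])
      then have "?dE y = 0"
        using d_diff(4)[of "f Wplus (g Wplus y)" "f Wminus (g Wminus y)"] unfolding fg fd
            by (simp add: f_add)
      then have yZ: "y \<in> Z" using y by (simp add: Z_def)
      moreover have "h y = \<one>\<^bsub>?H\<^esub>"
        using P.eq_one_iff[OF gZ'(1)[OF yZ]] M.eq_one_iff[OF gZ'(2)[OF yZ]] in_ID[of Wplus] in_ID[of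
            Wminus]
        by (simp add: h_def)
      ultimately show "y \<in> kernel (add_group Z) ?H h" by (simp add: kernel_def)
    qed
    show "h ` carrier (add_group Z) = carrier ?H"
    proof (intro subset_antisym subsetI)
      fix p assume "p \<in> h ` carrier (add_group Z)"
      then show "p \<in> carrier ?H" using gZ' by (auto simp: h_def P.carrier_Q M.carrier_Q)
    next
      fix p assume "p \<in> carrier ?H"
      then obtain a b where ab: "a \<in> ZD (j - 2)" "b \<in> ZD (j + 2)"
        "p = (add_coset (ID (j - 2)) a, add_coset (ID (j + 2)) b)"
        by (auto simp: P.carrier_Q M.carrier_Q)
      let ?y = "f Wplus a + f Wminus b"
      have "?y \<in> Z" using fZ[of a Wplus] fZ[of b Wminus] ab by (intro add_subgroupD(4)[OF Z]) simp_all
      moreover have "a \<in> bracket_chains D (\<not> i) (j - 2)" "b \<in> bracket_chains D (\<not> i) (j + 2)"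
        using ab by (simp_all add: ZD_def)
      then have "h ?y = p" using ab(3) by (simp add: h_def g_add gf)
      ultimately show "p \<in> h ` carrier (add_group Z)" by (intro image_eqI[of _ _ ?y]) simp_all
    qed
  qed
  then show ?thesis by (simp add: bracket_homology_def Z_def I_def ZD_def ID_def)
qed

lemma homology_E_tensor:
  assumes cs: "crossing_order D cs" and cs': "crossing_order E cs'"
  shows "bracket_homology E cs' i j \<cong> (bracket_homology D cs (\<not> i) \<otimes>\<^sub>g W) j"
proof -
  note G = comm_group_homology[OF cs, of "\<not> i"]
  have "(bracket_homology D cs (\<not> i) \<otimes>\<^sub>g W) j \<cong>
      bracket_homology D cs (\<not> i) (j - 2) \<times>\<times> bracket_homology D cs (\<not> i) (j + 2)"
    by (rule graded_tensor_W[OF G])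
  from group.iso_sym[OF group_graded_tensor[OF G comm_group_W] this] homology_E[OF cs cs']
  show ?thesis by (meson iso_trans)
qed

text \<open>In the statement for pairs, the tensor product with \<open>(0, W)\<close> also has
  summands over \<open>zero_graded\<close>. These are trivial groups and split off, on the left in
  parity 0 and on the right in parity 1.\<close>

lemma HF_union:
  assumes cs: "crossing_order D cs" and cs': "crossing_order E cs'"
  shows "HF0 E cs' \<cong>\<^sub>g HF1 D cs \<otimes>\<^sub>g W" "HF1 E cs' \<cong>\<^sub>g HF0 D cs \<otimes>\<^sub>g W"
    "HF E cs' \<cong>\<^sub>p HF D cs \<otimes>\<^sub>p spade (as_pair W)"
proof -
  have H: "HF0 D cs = bracket_homology D cs False" "HF1 D cs = bracket_homology D cs True"
    "HF0 E cs' = bracket_homology E cs' False" "HF1 E cs' = bracket_homology E cs' True"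
    by (simp_all add: fun_eq_iff HF_eq)
  note G = comm_group_homology[OF cs]
  have triv: "trivial_group ((bracket_homology D cs i \<otimes>\<^sub>g zero_graded) j)" for i j
    by (rule graded_tensor_zero[OF G])
  have grp: "group ((bracket_homology D cs i \<otimes>\<^sub>g W) j)" for i j
    by (rule group_graded_tensor[OF G comm_group_W])
  show "HF0 E cs' \<cong>\<^sub>g HF1 D cs \<otimes>\<^sub>g W" "HF1 E cs' \<cong>\<^sub>g HF0 D cs \<otimes>\<^sub>g W"
    unfolding graded_iso_def H using homology_E_tensor[OF cs cs', of False] homology_E_tensor[OF cs
        cs', of True]
    by simp_all
  have zero: "bracket_homology E cs' False j \<cong>
      (bracket_homology D cs False \<otimes>\<^sub>g zero_graded) j \<times>\<times> (bracket_homology D cs True \<otimes>\<^sub>g W) j" for j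
  proof -
    have "group ((bracket_homology D cs False \<otimes>\<^sub>g zero_graded) j \<times>\<times> (bracket_homology D cs True \<otimes>\<^sub>g W) j)"
      using triv grp by (intro DirProd_group) (simp_all add: trivial_group_def)
    from group.iso_sym[OF this DirProd_trivial_left[OF triv grp]] homology_E_tensor[OF cs cs', of False j]
    show ?thesis by (simp add: iso_trans)
  qed
  have one: "bracket_homology E cs' True j \<cong>
      (bracket_homology D cs False \<otimes>\<^sub>g W) j \<times>\<times> (bracket_homology D cs True \<otimes>\<^sub>g zero_graded) j" for j
  proof -
    have "group ((bracket_homology D cs False \<otimes>\<^sub>g W) j \<times>\<times> (bracket_homology D cs True \<otimes>\<^sub>g zero_graded) j)"
      using triv grp by (intro DirProd_group) (simp_all add: trivial_group_def)
    from group.iso_sym[OF this DirProd_trivial_right[OF grp triv]] homology_E_tensor[OF cs cs', of True j]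
    show ?thesis by (simp add: iso_trans)
  qed
  show "HF E cs' \<cong>\<^sub>p HF D cs \<otimes>\<^sub>p spade (as_pair W)"
    using zero one
    by (simp add: pair_iso_def pair_tensor_def spade_def as_pair_def graded_iso_def graded_sum_def H)
qed

end

text \<open>Without crossings there is one state and the differential is zero, so homology is the
  group of chains. The single circle makes the parity odd, and its two labels are the basis of
  \<open>W\<close>.\<close>

lemma unknot_homology:
  fixes U :: "'h diagram"
  assumes U: "crossingless_unknot U"
  shows "trivial_group (bracket_homology U cs False j)" "bracket_homology U cs True j \<cong> W j"
proof -
  have l: "link_diagram U" and c: "crossings U = {}" using U by (simp_all add: crossingless_unknot_def)
  define s0 :: "'h state" where "s0 = (\<lambda>_. undefined)"
  have st: "states U = {s0}" by (simp add: states_def c s0_def)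
  have res: "resolution U s = U" for s by (simp add: resolution_def c)
  have circ: "circles U s = {darts U}" for s unfolding res by (rule unknot_component(1)[OF U])
  have num: "num_A U s = 0" "num_B U s = 0" for s by (simp_all add: num_A_def num_B_def c)
  have g0: "gens U (of_bool False) j = {}" for j by (auto simp: gens_def num circ)
  define lab :: "sign \<Rightarrow> 'h generator" where "lab w = (s0, \<lambda>C \<in> {darts U}. w)" for w
  have g1: "gens U (of_bool True) j = lab ` {w. wdeg w = j}" for j
  proof (intro subset_antisym subsetI)
    fix p assume p: "p \<in> gens U (of_bool True) j"
    obtain s \<epsilon> where se: "p = (s, \<epsilon>)" by (cases p)
    have e: "s = s0" "\<epsilon> \<in> {darts U} \<rightarrow>\<^sub>E UNIV" "wdeg (\<epsilon> (darts U)) = j"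
      using p by (simp_all add: se gens_def generators_def st circ num)
    then have "\<epsilon> = (\<lambda>C \<in> {darts U}. \<epsilon> (darts U))" by (auto simp: fun_eq_iff PiE_def extensional_def)
    then have "p = lab (\<epsilon> (darts U))" using e(1) by (simp add: lab_def se)
    then show "p \<in> lab ` {w. wdeg w = j}" using e(3) by blast
  next
    fix p assume "p \<in> lab ` {w. wdeg w = j}"
    then obtain w where "p = lab w" "wdeg w = j" by blast
    then show "p \<in> gens U (of_bool True) j"
      by (simp add: lab_def gens_def generators_def st circ num)
  qed
  have d: "bracket_boundary U cs x = 0" for x
    unfolding bracket_boundary_def by (rule frag_extend_eq_0) (simp add: case_prod_unfold c
        split_paired_all)
  have "0 \<in> bracket_chains U i j" for i by (simp add: bracket_chains_def)
  then have im: "bracket_boundary U cs ` bracket_chains U (\<not> i) j = {0}" for i by (auto simp: d)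
  have hom: "bracket_homology U cs i j = add_group (bracket_chains U i j) Mod {0}" for i
    unfolding bracket_homology_def im by (simp add: d)
  have grp: "group (add_group (bracket_chains U i j))" for i
    using comm_group_add_group[OF add_subgroup_bracket_chains[of U i j]] by (simp add: comm_group_def)
  have iso: "bracket_homology U cs i j \<cong> add_group (bracket_chains U i j)" for i
    using group.trivial_factor_iso[OF grp[of i]] unfolding hom is_iso_def by auto
  have grpH: "group (bracket_homology U cs i j)" for i
  proof -
    have "add_quotient (bracket_chains U i j) {0}"
      using \<open>0 \<in> bracket_chains U i j\<close> by unfold_locales (simp_all add: add_subgroup_bracket_chains
          add_subgroup_def[of "{0}"])
    then show ?thesis unfolding hom by (rule add_quotient.group_Q)
  qed
  have "carrier (add_group (bracket_chains U False j)) = {\<one>\<^bsub>add_group (bracket_chains U False j)\<^esub>}"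
    using g0 by (simp add: bracket_chains_def)
  then have "trivial_group (add_group (bracket_chains U False j))" using grp[of False]
      by (simp add: trivial_group_def)
  then show "trivial_group (bracket_homology U cs False j)"
    using isomorphic_group_triviality[OF iso[of False] grpH grp] by simp
  have "inj_on lab {w. wdeg w = j}"
    by (rule inj_onI) (auto simp: lab_def fun_eq_iff dest: spec[of _ "darts U"])
  then have "gens U (of_bool True) j \<approx> {w. wdeg w = j}" unfolding g1 by (rule inj_on_image_eqpoll_self)
  then have "free_Abelian_group (gens U (of_bool True) j) \<cong> W j"
    unfolding W_def isomorphic_free_Abelian_groups .
  then have "add_group (bracket_chains U True j) \<cong> W j"
      by (simp add: free_Abelian_group_eq bracket_chains_def)
  then show "bracket_homology U cs True j \<cong> W j" using iso[of True] iso_trans by blast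
qed

theorem mainTheorem4:
  shows
    "(\<forall>(D :: 'h diagram) c cs csA csB j.
        link_diagram D \<and> c \<in> crossings D \<and> crossing_order D cs \<and>
        crossing_order (split_at D c MarkA) csA \<and> crossing_order (split_at D c MarkB) csB \<longrightarrow>
        (let DA = split_at D c MarkA; DB = split_at D c MarkB in
         exact_hexagon
           (HF0 DB csB (j + 1)) (HF0 D cs j) (HF0 DA csA (j - 1))
           (HF1 DB csB (j + 1)) (HF1 D cs j) (HF1 DA csA (j - 1))))
     \<and>
     (\<forall>(D :: 'h diagram) U cs cs'.
        link_diagram D \<and> crossingless_unknot U \<and> darts D \<inter> darts U = {} \<and>
        crossing_order D cs \<and> crossing_order (diagram_union D U) cs' \<longrightarrow>
        HF (diagram_union D U) cs' \<cong>\<^sub>p HF D cs \<otimes>\<^sub>p spade (as_pair W) \<and>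
        HF0 (diagram_union D U) cs' \<cong>\<^sub>g HF1 D cs \<otimes>\<^sub>g W \<and>
        HF1 (diagram_union D U) cs' \<cong>\<^sub>g HF0 D cs \<otimes>\<^sub>g W)
     \<and>
     (\<forall>(U :: 'h diagram) cs.
        crossingless_unknot U \<and> crossing_order U cs \<longrightarrow>
        HF U cs \<cong>\<^sub>p spade (as_pair W) \<and>
        (\<forall>j. trivial_group (HF0 U cs j)) \<and>
        HF1 U cs \<cong>\<^sub>g W)"
proof (intro conjI allI impI; elim conjE)
  fix D :: "'h diagram" and c cs csA csB j
  assume "link_diagram D" "c \<in> crossings D" and order: "crossing_order D cs"
    "crossing_order (split_at D c MarkA) csA" "crossing_order (split_at D c MarkB) csB"
  then interpret split_crossing D c by unfold_locales
  show "let DA = split_at D c MarkA; DB = split_at D c MarkB in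
      exact_hexagon
        (HF0 DB csB (j + 1)) (HF0 D cs j) (HF0 DA csA (j - 1))
        (HF1 DB csB (j + 1)) (HF1 D cs j) (HF1 DA csA (j - 1))"
    unfolding Let_def HF_eq by (rule skein_exact[OF order])
next
  fix D U :: "'h diagram" and cs cs'
  assume "link_diagram D" "crossingless_unknot U" "darts D \<inter> darts U = {}"
    and order: "crossing_order D cs" "crossing_order (diagram_union D U) cs'"
  then interpret diagram_and_circle D U by unfold_locales
  show "HF (diagram_union D U) cs' \<cong>\<^sub>p HF D cs \<otimes>\<^sub>p spade (as_pair W)"
    "HF0 (diagram_union D U) cs' \<cong>\<^sub>g HF1 D cs \<otimes>\<^sub>g W"
    "HF1 (diagram_union D U) cs' \<cong>\<^sub>g HF0 D cs \<otimes>\<^sub>g W"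
    by (fact HF_union[OF order])+
next
  fix U :: "'h diagram" and cs
  assume U: "crossingless_unknot U"
  note H = unknot_homology[OF U]
  show "trivial_group (HF0 U cs j)" for j unfolding HF_eq by (rule H(1))
  show iso: "HF1 U cs \<cong>\<^sub>g W" unfolding graded_iso_def HF_eq using H(2) by blast
  have "HF0 U cs j \<cong> zero_graded j" for j
    unfolding HF_eq zero_graded_def by (rule trivial_group_iso[OF H(1) trivial_singleton_group])
  then show "HF U cs \<cong>\<^sub>p spade (as_pair W)"
    using iso by (simp add: pair_iso_def spade_def as_pair_def graded_iso_def)
qed

end
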